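(* Every $\Phi\in\mathcal P_{\mathrm c}$ admits a unique factorization $\Phi=\Psi\circ E_h$ with $(\Psi,h)\in\mathcal K_{\mathrm c}\times\operatorname{BiLip}(\mathbb T)$. The factors are given by $h=h_\Phi$ and $\Psi=\Phi\circ E_{h^{-1}}$. Consequently, the map $$\Xi:\mathcal K_{\mathrm c}\rtimes_\alpha\operatorname{BiLip}(\mathbb T)\longrightarrow\mathcal P_{\mathrm c},\qquad \Xi(\Psi,h)=\Psi\circ E_h,$$ is an isomorphism of groups (all group operations on maps being composition), where $\alpha_h(\Psi)=E_h\circ\Psi\circ E_{h^{-1}}$.
   Context: $\mathbb D=\{z\in\mathbb C:|z|<1\}$, $\mathbb T=\partial\mathbb D$, and $\rho(z,w)=\left|\frac{z-w}{1-\overline z w}\right|$ is the pseudohyperbolic metric. The notation $A(z)\asymp B(z)$ means that there are constants $0<c\le C<\infty$, independent of $z$ (possibly depending on the map), with $cB\le A\le CB$. Sequences are indexed families $\Lambda=(\lambda_j)$ (finite or countably infinite) of points of $\mathbb D$; the image $\Phi(\Lambda)=(\Phi(\lambda_j))$ retains repeated terms. $\mathcal C$ denotes the class of Carleson (interpolating) sequences: $\Lambda=(\lambda_j)\in\mathcal C$ if every bounded scalar sequence $(a_j)$ is of the form $a_j=f(\lambda_j)$ for some $f\in H^\infty(\mathbb D)$. Finite sequences of distinct points belong to $\mathcal C$; a sequence with a repeated term does not. $\mathcal C_{\leftrightarrow}^{\mathrm c}$ is the class of continuous maps $\Phi:\mathbb D\to\mathbb D$ such that for every indexed sequence $\Lambda\subset\mathbb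 D$, $\Lambda\in\mathcal C\Leftrightarrow\Phi(\Lambda)\in\mathcal C$. $\mathcal P_{\mathrm c}=\{\Phi\in\mathcal C_{\leftrightarrow}^{\mathrm c}:1-|\Phi(z)|^2\asymp1-|z|^2\text{ for }z\in\mathbb D\}$. Every $\Phi\in\mathcal P_{\mathrm c}$ is a homeomorphism of $\mathbb D$ onto itself such that $\Phi,\Phi^{-1}$ are uniformly continuous with respect to $\rho$, and it extends uniquely to a homeomorphism of $\overline{\mathbb D}$; $h_\Phi$ denotes the restriction of the extension to $\mathbb T$. $\mathcal K_{\mathrm c}=\{\Psi\in\mathcal P_{\mathrm c}:h_\Psi=\operatorname{id}_{\mathbb T}\}$. $\operatorname{BiLip}(\mathbb T)$ is the group of circle homeomorphisms $h$ (of either orientation) for which there is $L\ge1$ with $L^{-1}d_{\mathbb T}(\zeta,\eta)\le d_{\mathbb T}(h(\zeta),h(\eta))\le L\,d_{\mathbb T}(\zeta,\eta)$ for all $\zeta,\eta\in\mathbb T$, where $d_{\mathbb T}$ is the normalized arclength distance along the shorter arc. For a circle homeomorphism $h$, its radial extension $E_h:\mathbb D\to\mathbb D$ is $E_h(0)=0$, $E_h(r\zeta)=rh(\zeta)$ for $0<r<1$, $\zeta\in\mathbb T$. The semidirect product $\mathcal K_{\mathrm c}\rtimes_\alpha\operatorname{BiLip}(\mathbb T)$ is the set $\mathcal K_{\mathrm c}\times\operatorname{BiLip}(\mathbb T)$ with multiplication $(\Psi_1,h_1)(\Psi_2,h_2)=(\Psi_1\circ\alpha_{h_1}(\Psi_2),\,h_1\circ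 h_2)$. *)

theory Defs
  imports "HOL-Analysis.Analysis" "HOL-Algebra.Bij"
begin

(* Self-maps of a set S are represented as extensional functions (undefined outside S), so
   that HOL equality is equality of maps on S; they are composed with "compose S". *)

abbreviation unit_disc :: "complex set"  ("\<bbbD>")
  where "\<bbbD> \<equiv> ball 0 1"

abbreviation unit_circle :: "complex set"  ("\<bbbT>")
  where "\<bbbT> \<equiv> sphere 0 1"

definition H_infinity :: "(complex \<Rightarrow> complex) set"
  where "H_infinity = {f. f holomorphic_on \<bbbD> \<and> bounded (f ` \<bbbD>)}"

(* A finite or countably infinite indexed family is a function on an index set J of naturals.
   Values outside J are irrelevant; terms may repeat. *)
definition carleson_seq :: "nat set \<Rightarrow> (nat \<Rightarrow> complex) \<Rightarrow> bool"
  where "carleson_seq J l \<longleftrightarrow>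
    l ` J \<subseteq> \<bbbD> \<and>
    (\<forall>a :: nat \<Rightarrow> complex. bounded (a ` J) \<longrightarrow> (\<exists>f \<in> H_infinity. \<forall>j \<in> J. f (l j) = a j))"

definition carleson_maps :: "(complex \<Rightarrow> complex) set"
  where "carleson_maps =
    {\<Phi> \<in> \<bbbD> \<rightarrow>\<^sub>E \<bbbD>. continuous_on \<bbbD> \<Phi> \<and>
      (\<forall>J l. l ` J \<subseteq> \<bbbD> \<longrightarrow> (carleson_seq J l \<longleftrightarrow> carleson_seq J (\<lambda>j. \<Phi> (l j))))}"

definition P_c :: "(complex \<Rightarrow> complex) set"
  where "P_c =
    {\<Phi> \<in> carleson_maps. \<exists>c C :: real. 0 < c \<and> c \<le> C \<and>
      (\<forall>z \<in> \<bbbD>. c * (1 - (norm z)\<^sup>2) \<le> 1 - (norm (\<Phi> z))\<^sup>2 \<and>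
               1 - (norm (\<Phi> z))\<^sup>2 \<le> C * (1 - (norm z)\<^sup>2))}"

(* The description is meaningful when a homeomorphic extension exists, as it does for every
   element of P_c; uniqueness is automatic because the disc is dense in its closure. *)
definition closed_disc_extension :: "(complex \<Rightarrow> complex) \<Rightarrow> complex \<Rightarrow> complex"
  where "closed_disc_extension \<Phi> =
    (THE F. F \<in> extensional (cball 0 1) \<and>
            (\<exists>G. homeomorphism (cball 0 1) (cball 0 1) F G) \<and>
            (\<forall>z \<in> \<bbbD>. F z = \<Phi> z))"

definition boundary_map :: "(complex \<Rightarrow> complex) \<Rightarrow> complex \<Rightarrow> complex"
  where "boundary_map \<Phi> = restrict (closed_disc_extension \<Phi>) \<bbbT>"

definition K_c :: "(complex \<Rightarrow> complex) set"
  where "K_c = {\<Psi> \<in> P_c. boundary_map \<Psi> = (\<lambda>\<zeta>\<in>\<bbbT>. \<zeta>)}"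

(* Arg takes values in (-pi, pi], so |Arg (z / w)| is the length of the shorter arc from w to z;
   the whole circle is normalized to have length 1. *)
definition circle_dist :: "complex \<Rightarrow> complex \<Rightarrow> real"
  where "circle_dist \<zeta> \<eta> = \<bar>Arg (\<zeta> / \<eta>)\<bar> / (2 * pi)"

definition BiLip :: "(complex \<Rightarrow> complex) set"
  where "BiLip =
    {h \<in> extensional \<bbbT>. (\<exists>g. homeomorphism \<bbbT> \<bbbT> h g) \<and>
      (\<exists>L \<ge> 1. \<forall>\<zeta> \<in> \<bbbT>. \<forall>\<eta> \<in> \<bbbT>.
        inverse L * circle_dist \<zeta> \<eta> \<le> circle_dist (h \<zeta>) (h \<eta>) \<and>
        circle_dist (h \<zeta>) (h \<eta>) \<le> L * circle_dist \<zeta> \<eta>)}"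

definition circle_inv :: "(complex \<Rightarrow> complex) \<Rightarrow> complex \<Rightarrow> complex"
  where "circle_inv h = restrict (inv_into \<bbbT> h) \<bbbT>"

definition radial_ext :: "(complex \<Rightarrow> complex) \<Rightarrow> complex \<Rightarrow> complex"
  where "radial_ext h = (\<lambda>z\<in>\<bbbD>. if z = 0 then 0 else of_real (norm z) * h (z / of_real (norm z)))"

definition composition_group :: "'a set \<Rightarrow> ('a \<Rightarrow> 'a) set \<Rightarrow> ('a \<Rightarrow> 'a) monoid"
  where "composition_group S M = \<lparr>carrier = M, mult = compose S, one = (\<lambda>x\<in>S. x)\<rparr>"

abbreviation P_c_group :: "(complex \<Rightarrow> complex) monoid"
  where "P_c_group \<equiv> composition_group \<bbbD> P_c"

abbreviation K_c_group :: "(complex \<Rightarrow> complex) monoid"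
  where "K_c_group \<equiv> composition_group \<bbbD> K_c"

abbreviation BiLip_group :: "(complex \<Rightarrow> complex) monoid"
  where "BiLip_group \<equiv> composition_group \<bbbT> BiLip"

definition semidirect_product ::
    "('a, 'c) monoid_scheme \<Rightarrow> ('b, 'd) monoid_scheme \<Rightarrow> ('b \<Rightarrow> 'a \<Rightarrow> 'a) \<Rightarrow> ('a \<times> 'b) monoid"
  where "semidirect_product N H \<theta> =
    \<lparr>carrier = carrier N \<times> carrier H,
     mult = (\<lambda>(n1, h1) (n2, h2). (n1 \<otimes>\<^bsub>N\<^esub> \<theta> h1 n2, h1 \<otimes>\<^bsub>H\<^esub> h2)),
     one = (\<one>\<^bsub>N\<^esub>, \<one>\<^bsub>H\<^esub>)\<rparr>"

definition alpha :: "(complex \<Rightarrow> complex) \<Rightarrow> (complex \<Rightarrow> complex) \<Rightarrow> (complex \<Rightarrow> complex)"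
  where "alpha h = (\<lambda>\<Psi>\<in>K_c. compose \<bbbD> (radial_ext h) (compose \<bbbD> \<Psi> (radial_ext (circle_inv h))))"

definition Xi :: "(complex \<Rightarrow> complex) \<times> (complex \<Rightarrow> complex) \<Rightarrow> complex \<Rightarrow> complex"
  where "Xi = (\<lambda>(\<Psi>, h). compose \<bbbD> \<Psi> (radial_ext h))"

end

theory Submission
  imports Defs "HOL-Complex_Analysis.Complex_Analysis"
begin

text \<open>
  The algebra is short once two analytic facts are available: the radial extension \<open>E\<^sub>h\<close> of a
  bi-Lipschitz circle map \<open>h\<close> lies in \<open>\<P>\<^sub>c\<close> (lemma \<open>radial_ext_P_c\<close>), and every \<open>\<Phi> \<in> \<P>\<^sub>c\<close> extends to
  a homeomorphism of the closed disc whose boundary values are bi-Lipschitz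
  (lemma \<open>P_c_homeomorphic_extension\<close>).  Boundary values are then multiplicative,
  \<open>h\<^bsub>\<Phi>\<circ>\<Psi>\<^esub> = h\<^bsub>\<Phi>\<^esub> \<circ> h\<^bsub>\<Psi>\<^esub>\<close>, so \<open>\<Phi> \<mapsto> h\<^bsub>\<Phi>\<^esub>\<close> is a homomorphism onto the bi-Lipschitz group with kernel \<open>\<K>\<^sub>c\<close>,
  and \<open>h \<mapsto> E\<^sub>h\<close> is a homomorphic section of it.  A split extension is a semidirect product for the
  conjugation action, and the factors of \<open>\<Phi>\<close> are read off from its boundary values.

  Both analytic facts rest on Carleson's interpolation theorem in the form \<open>carleson_seq_iff\<close>:
  a sequence is interpolating iff it is separated in the pseudohyperbolic distance \<open>\<rho>\<close> and the sums
  \<open>\<Sum>\<^sub>j (1 - \<rho>(\<lambda>\<^sub>j, \<lambda>\<^sub>k)\<^sup>2)\<close> are bounded uniformly in \<open>k\<close>.  Necessity follows from the Schwarz lemma and a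
  gliding hump: were the products \<open>\<Prod>\<^sub>j \<rho>(\<lambda>\<^sub>j, \<lambda>\<^sub>k)\<close> not bounded below, the characteristic function of a
  sufficiently sparse set of indices could not be interpolated.  Sufficiency is P. Jones's explicit
  formula for finite sets of points, with a bound that does not depend on their number, followed by
  Montel's theorem.

  The criterion involves only \<open>\<rho>\<close>.  The map \<open>E\<^sub>h\<close> preserves moduli and is Euclidean bi-Lipschitz, so it
  changes both \<open>\<rho>\<close> and \<open>1 - \<rho>\<^sup>2\<close> by at most constant factors and preserves Carleson sequences in both
  directions.

  For \<open>\<Phi> \<in> \<P>\<^sub>c\<close>, pairs of points give injectivity; invariance of domain and the comparison
  \<open>1 - |\<Phi>(z)|\<^sup>2 \<asymp> 1 - |z|\<^sup>2\<close> give surjectivity.  If \<open>\<Phi>\<close> were not uniformly continuous for \<open>\<rho>\<close>, there would be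
  pairs of points, escaping rapidly to the circle, that are arbitrarily close together while their
  images stay apart; the images would form a Carleson sequence and the points themselves would not.
  Hence \<open>\<Phi>\<close> maps points within \<open>\<delta> (1 - |z|)\<close> of \<open>z\<close> to points within a constant times \<open>1 - |z|\<close> of
  \<open>\<Phi>(z)\<close>, since it preserves the distance to the circle up to a constant.  Chaining such steps along radii and
  a segment yields
  \<open>|\<Phi>(z) - \<Phi>(w)| \<le> M (|z - w| + (1 - |z|) + (1 - |w|))\<close>,
  which at the boundary is precisely a Lipschitz condition.  The same applies to the inverse of \<open>\<Phi>\<close>.
\<close>

section \<open>The pseudohyperbolic distance\<close>

definition rho :: "complex \<Rightarrow> complex \<Rightarrow> real"
  where "rho z w = norm ((z - w) / (1 - cnj z * w))"

lemma rho_nonneg [simp]: "0 \<le> rho z w"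
  by (simp add: rho_def)

lemma rho_self [simp]: "rho z z = 0"
  by (simp add: rho_def)

lemma rho_commute: "rho z w = rho w z"
proof -
  have "norm (1 - cnj z * w) = norm (cnj (1 - cnj z * w))"
    by (simp only: complex_mod_cnj)
  also have "\<dots> = norm (1 - cnj w * z)"
    by (simp add: mult.commute)
  finally show ?thesis
    by (simp add: rho_def norm_divide norm_minus_commute)
qed

lemma cnj_mult_neq_1:
  assumes "norm z < 1" "norm w < 1"
  shows "1 - cnj z * w \<noteq> 0"
proof
  assume "1 - cnj z * w = 0"
  then have "norm (cnj z * w) = 1" by simp
  moreover have "norm z * norm w < 1 * 1"
    using assms by (intro mult_strict_mono') auto
  ultimately show False by (simp add: norm_mult)
qed

lemma norm_1_minus_cnj_mult:
  "(norm (1 - cnj z * w))\<^sup>2 = (norm (z - w))\<^sup>2 + (1 - (norm z)\<^sup>2) * (1 - (norm w)\<^sup>2)"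
  unfolding cmod_power2 by (simp add: algebra_simps power2_eq_square)

lemma one_minus_rho_sq:
  assumes "norm z < 1" "norm w < 1"
  shows "1 - (rho z w)\<^sup>2 = (1 - (norm z)\<^sup>2) * (1 - (norm w)\<^sup>2) / (norm (1 - cnj z * w))\<^sup>2"
  using norm_1_minus_cnj_mult[of z w] cnj_mult_neq_1[OF assms]
  by (simp add: rho_def norm_divide power_divide field_simps)

lemma one_minus_norm_sq_pos: "norm z < 1 \<Longrightarrow> 0 < 1 - (norm z)\<^sup>2"
  for z :: complex
  using abs_square_less_1[of "norm z"] by simp

lemma rho_less_1:
  assumes "norm z < 1" "norm w < 1"
  shows "rho z w < 1"
proof -
  have "0 < 1 - (rho z w)\<^sup>2"
    unfolding one_minus_rho_sq[OF assms]
    using assms cnj_mult_neq_1[OF assms] by (intro divide_pos_pos mult_pos_pos one_minus_norm_sq_pos) auto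
  then show ?thesis
    using abs_square_less_1[of "rho z w"] by simp
qed

lemma rho_eq_0_iff: "norm z < 1 \<Longrightarrow> norm w < 1 \<Longrightarrow> rho z w = 0 \<longleftrightarrow> z = w"
  using cnj_mult_neq_1 by (auto simp: rho_def)

lemma norm_1_minus_cnj_ge:
  assumes "norm z < 1" "norm w < 1"
  shows "1 - norm z \<le> norm (1 - cnj z * w)" "1 - norm w \<le> norm (1 - cnj z * w)"
proof -
  have "1 - norm z * norm w \<le> norm (1 - cnj z * w)"
    using norm_triangle_ineq2[of 1 "cnj z * w"] by (simp add: norm_mult)
  moreover have "norm z * norm w \<le> norm z" "norm z * norm w \<le> norm w"
    using assms by (simp_all add: mult_left_le mult_left_le_one_le)
  ultimately show "1 - norm z \<le> norm (1 - cnj z * w)" "1 - norm w \<le> norm (1 - cnj z * w)"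
    by linarith+
qed

text \<open>
  Points at very different heights \<open>1 - |\<cdot>|\<^sup>2\<close> are nearly at maximal distance from each other.
\<close>

lemma one_minus_rho_sq_le:
  assumes "norm z < 1" "norm w < 1"
  shows "1 - (rho z w)\<^sup>2 \<le> 4 * (1 - (norm w)\<^sup>2) / (1 - (norm z)\<^sup>2)"
proof -
  have pz: "0 < 1 - (norm z)\<^sup>2" and pw: "0 < 1 - (norm w)\<^sup>2"
    using assms one_minus_norm_sq_pos by blast+
  have "1 - (norm z)\<^sup>2 \<le> 2 * (1 - norm z)"
    using sum_squares_ge_zero[of "1 - norm z" 0] by (simp add: power2_eq_square algebra_simps)
  also have "\<dots> \<le> 2 * norm (1 - cnj z * w)"
    using norm_1_minus_cnj_ge[OF assms] by simp
  finally have "(1 - (norm z)\<^sup>2)\<^sup>2 \<le> (2 * norm (1 - cnj z * w))\<^sup>2"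
    using pz by (intro power_mono) auto
  then have *: "(1 - (norm z)\<^sup>2) * (1 - (norm z)\<^sup>2) \<le> 4 * (norm (1 - cnj z * w))\<^sup>2"
    by (simp add: power_mult_distrib power2_eq_square)
  have "(1 - (norm z)\<^sup>2) * (1 - (norm z)\<^sup>2) * (1 - (norm w)\<^sup>2) \<le> 4 * (norm (1 - cnj z * w))\<^sup>2 * (1 - (norm w)\<^sup>2)"
    by (intro mult_right_mono[OF *]) (use pw in auto)
  then show ?thesis
    unfolding one_minus_rho_sq[OF assms]
    using pz cnj_mult_neq_1[OF assms] by (simp add: field_simps)
qed

section \<open>Bounded functions with prescribed zeros\<close>

text \<open>
  A Moebius map moves the zero to the origin, where the Schwarz lemma divides it out without
  increasing the bound.
\<close>

lemma factor_zero:
  assumes hol: "f holomorphic_on \<bbbD>" and bd: "\<And>z. norm z < 1 \<Longrightarrow> norm (f z) \<le> M"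
    and a: "norm a < 1" "f a = 0"
  obtains g where "g holomorphic_on \<bbbD>" "\<And>z. norm z < 1 \<Longrightarrow> norm (g z) \<le> M"
    "\<And>z. norm z < 1 \<Longrightarrow> f z = (z - a) / (1 - cnj a * z) * g z"
proof -
  define m where "m = Moebius_function 0 a"
  define m' where "m' = Moebius_function 0 (-a)"
  have m: "m holomorphic_on \<bbbD>" "m' holomorphic_on \<bbbD>"
    using a by (auto simp: m_def m'_def intro: Moebius_function_holomorphic)
  have mD: "norm (m z) < 1" "norm (m' z) < 1" if "norm z < 1" for z
    using a that by (auto simp: m_def m'_def intro: Moebius_function_norm_lt_1)
  have m'm: "m' (m z) = z" if "norm z < 1" for z
    using a that by (auto simp: m_def m'_def intro: Moebius_function_compose)
  define F where "F = f \<circ> m'"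
  have holF: "F holomorphic_on \<bbbD>"
    unfolding F_def by (rule holomorphic_on_compose_gen[OF m(2) hol]) (use mD in auto)
  have F0: "F 0 = 0"
    using a by (simp add: F_def m'_def Moebius_function_of_zero)
  obtain k where k: "k holomorphic_on \<bbbD>" "\<And>z. norm z < 1 \<Longrightarrow> F z = z * k z" "deriv F 0 = k 0"
    using Schwarz3[OF holF F0] by blast
  have kM: "norm (k z) \<le> M" if z: "norm z < 1" for z
  \<comment> \<open>The Schwarz lemma wants a strict bound, so \<open>M\<close> is first enlarged slightly.\<close>
  proof (rule dense_ge)
    fix M' assume M': "M < M'"
    have "0 \<le> M"
      using bd[OF a(1)] norm_ge_zero order_trans by blast
    then have M'0: "0 < M'" using M' by simp
    define H where "H = (\<lambda>z. F z / of_real M')"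
    have H: "H holomorphic_on \<bbbD>"
      unfolding H_def using holF M'0 by (intro holomorphic_intros) auto
    have H0: "H 0 = 0" by (simp add: H_def F0)
    have H1: "norm (H z) < 1" if "norm z < 1" for z
      using bd[OF mD(2)[OF that]] M' M'0 by (simp add: H_def F_def norm_divide)
    note S = Schwarz_Lemma[OF H H0 H1 z]
    show "norm (k z) \<le> M'"
    proof (cases "z = 0")
      case False
      have "norm (F z) / M' \<le> norm z"
        using S(1) M'0 by (simp add: H_def norm_divide)
      then show ?thesis
        using M'0 False k(2)[OF z] by (simp add: norm_mult field_simps)
    next
      case True
      have "F field_differentiable at 0"
        using holF by (auto simp: holomorphic_on_open field_differentiable_def)
      then have "deriv H 0 = deriv F 0 / of_real M'"
        unfolding H_def by (rule deriv_cdivide_right)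
      then show ?thesis
        using S(2) M'0 True k(3) by (simp add: norm_divide)
    qed
  qed
  show thesis
  proof
    show "(k \<circ> m) holomorphic_on \<bbbD>"
      by (rule holomorphic_on_compose_gen[OF m(1) k(1)]) (use mD in auto)
    show "norm ((k \<circ> m) z) \<le> M" if "norm z < 1" for z
      using kM[OF mD(1)[OF that]] by simp
    show "f z = (z - a) / (1 - cnj a * z) * (k \<circ> m) z" if z: "norm z < 1" for z
    proof -
      have "f z = F (m z)" by (simp add: F_def m'm z)
      also have "\<dots> = m z * k (m z)" using k(2) mD(1) z by blast
      finally show ?thesis by (simp add: m_def Moebius_function_simple)
    qed
  qed
qed

text \<open>
  Dividing out the zeros one at a time compares the function with the finite Blaschke product
  having these zeros.
\<close>

lemma bounded_zeros_le:
  assumes "finite F" "inj_on l F" "l ` F \<subseteq> \<bbbD>"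
    and "f holomorphic_on \<bbbD>" "\<And>z. norm z < 1 \<Longrightarrow> norm (f z) \<le> M"
    and "\<And>j. j \<in> F \<Longrightarrow> f (l j) = 0" and "norm z < 1"
  shows "norm (f z) \<le> M * (\<Prod>j\<in>F. rho (l j) z)"
  using assms
proof (induction F arbitrary: f rule: finite_induct)
  case empty
  then show ?case by simp
next
  case (insert i F)
  have li: "norm (l i) < 1" using insert.prems by auto
  obtain g where g: "g holomorphic_on \<bbbD>" "\<And>z. norm z < 1 \<Longrightarrow> norm (g z) \<le> M"
    "\<And>z. norm z < 1 \<Longrightarrow> f z = (z - l i) / (1 - cnj (l i) * z) * g z"
    using factor_zero[OF insert.prems(3,4) li] insert.prems(5) by blast
  have g0: "g (l j) = 0" if j: "j \<in> F" for j
  proof -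
    have lj: "norm (l j) < 1" "l j \<noteq> l i"
      using insert.prems(1,2) insert.hyps j by (auto simp: inj_on_def)
    have "0 = (l j - l i) / (1 - cnj (l i) * l j) * g (l j)"
      using g(3)[OF lj(1)] insert.prems(5) j by auto
    then show ?thesis
      using lj cnj_mult_neq_1[OF li lj(1)] by simp
  qed
  have "norm (g z) \<le> M * (\<Prod>j\<in>F. rho (l j) z)"
    by (rule insert.IH) (use insert.prems g g0 in auto)
  then have "rho (l i) z * norm (g z) \<le> rho (l i) z * (M * (\<Prod>j\<in>F. rho (l j) z))"
    by (intro mult_left_mono) auto
  moreover have "norm (f z) = rho (l i) z * norm (g z)"
    using g(3)[OF insert.prems(6)] by (simp add: rho_def norm_mult norm_divide norm_minus_commute)
  ultimately show ?case
    using insert.hyps by (simp add: mult_ac)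
qed

section \<open>Lacunary families\<close>

text \<open>
  Here \<open>h\<close> decreases geometrically and \<open>x\<close>, \<open>y\<close> lie at heights comparable with \<open>h m\<close> and \<open>h n\<close>.
  The ratio \<open>C / c\<close> lost by replacing true heights with values of \<open>h\<close> is absorbed by the first
  factor \<open>c / (64 * C)\<close> of the decay.
\<close>

lemma lacunary_rho:
  fixes h :: "nat \<Rightarrow> real"
  assumes c: "0 < c" "c \<le> C" and h: "\<And>n. 0 < h n" "\<And>n. h (Suc n) \<le> c / (64 * C) * h n"
    and "m \<noteq> n" and xy: "norm x < 1" "norm y < 1"
    and x: "c * h m \<le> 1 - (norm x)\<^sup>2" "1 - (norm x)\<^sup>2 \<le> C * h m"
    and y: "c * h n \<le> 1 - (norm y)\<^sup>2" "1 - (norm y)\<^sup>2 \<le> C * h n"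
  shows "1 - (rho x y)\<^sup>2 \<le> 4 * (1/64) ^ ((m - n) + (n - m))"
proof -
  have decay: "h (m + d) \<le> (c / (64 * C)) ^ d * h m" for m d
  proof (induction d)
    case (Suc d)
    have "h (m + Suc d) \<le> c / (64 * C) * h (m + d)" using h(2)[of "m + d"] by simp
    also have "\<dots> \<le> c / (64 * C) * ((c / (64 * C)) ^ d * h m)"
      using c Suc by (intro mult_left_mono) auto
    finally show ?case by (simp add: mult_ac)
  qed simp
  have main: "1 - (rho x y)\<^sup>2 \<le> 4 * (1/64) ^ Suc d"
    if xy: "norm x < 1" "norm y < 1" and x: "c * h m \<le> 1 - (norm x)\<^sup>2"
      and y: "1 - (norm y)\<^sup>2 \<le> C * h (m + Suc d)" for x y m d
  proof -
    have C: "0 < C" using c by simp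
    have px: "0 < c * h m" using c h by simp
    have "1 - (rho x y)\<^sup>2 \<le> 4 * (1 - (norm y)\<^sup>2) / (1 - (norm x)\<^sup>2)"
      by (rule one_minus_rho_sq_le[OF xy])
    also have "\<dots> \<le> 4 * (C * h (m + Suc d)) / (c * h m)"
      using px x y one_minus_norm_sq_pos[OF xy(2)] by (intro frac_le) auto
    also have "\<dots> \<le> 4 * (C * ((c / (64 * C)) ^ Suc d * h m)) / (c * h m)"
      using px C decay[of m "Suc d"] by (intro divide_right_mono mult_left_mono) auto
    also have "\<dots> = 4 * (1/64) * (c / (64 * C)) ^ d"
      using c C h(1)[of m] by (simp add: field_simps)
    also have "\<dots> \<le> 4 * (1/64) * (1/64) ^ d"
      using c C by (intro mult_left_mono power_mono) (auto simp: field_simps)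
    finally show ?thesis by simp
  qed
  show ?thesis
  proof (cases "m < n")
    case True
    then obtain d where "n = m + Suc d" using less_iff_Suc_add[of m n] by auto
    then show ?thesis using main[OF xy x(1), of d] y(2) by simp
  next
    case False
    then obtain d where "m = n + Suc d" using less_iff_Suc_add[of n m] \<open>m \<noteq> n\<close> by auto
    then show ?thesis using main[OF xy(2,1) y(1), of d] x(2) by (simp add: rho_commute)
  qed
qed

text \<open>
  The exponent is \<open>|m - n|\<close>, so the sum is at most twice a geometric series of value \<open>4/63\<close>.
\<close>

lemma lacunary_sum:
  assumes "finite I" "n \<notin> I"
  shows "(\<Sum>m\<in>I. 4 * (1/64 :: real) ^ ((m - n) + (n - m))) \<le> 1/2"
proof -
  obtain N where N: "I \<subseteq> {..<N}" using assms(1) finite_nat_iff_bounded by blast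
  let ?f = "\<lambda>m. 4 * (1/64 :: real) ^ ((m - n) + (n - m))"
  have lower: "(\<Sum>m<n. 4 * (1/64 :: real) ^ (n - m)) \<le> 4/63" for n :: nat
  proof (induction n)
    case (Suc n)
    have "(\<Sum>m<Suc n. 4 * (1/64 :: real) ^ (Suc n - m)) = (\<Sum>m<n. 4 * (1/64 :: real) ^ (n - m)) / 64 + 4/64"
      by (simp add: Suc_diff_le sum_divide_distrib)
    then show ?case using Suc by simp
  qed simp
  have upper: "(\<Sum>m<N. 4 * (1/64 :: real) ^ Suc m) \<le> 4/63 - 4/63 * (1/64) ^ N" for N
    by (induction N) auto
  have "(\<Sum>m\<in>I. ?f m) \<le> (\<Sum>m\<in>{..<n} \<union> {Suc n..<Suc n + N}. ?f m)"
  proof (rule sum_mono2)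
    show "I \<subseteq> {..<n} \<union> {Suc n..<Suc n + N}"
    proof
      fix x assume x: "x \<in> I"
      then have "x \<noteq> n" "x < N" using assms(2) N by auto
      then show "x \<in> {..<n} \<union> {Suc n..<Suc n + N}" by auto
    qed
  qed auto
  also have "\<dots> = (\<Sum>m<n. ?f m) + (\<Sum>m\<in>{Suc n..<Suc n + N}. ?f m)"
    by (intro sum.union_disjoint) auto
  also have "(\<Sum>m<n. ?f m) = (\<Sum>m<n. 4 * (1/64 :: real) ^ (n - m))"
    by (intro sum.cong) auto
  also have "(\<Sum>m\<in>{Suc n..<Suc n + N}. ?f m) = (\<Sum>m<N. 4 * (1/64 :: real) ^ Suc m)"
    by (rule sum.reindex_bij_witness[of _ "\<lambda>m. m + Suc n" "\<lambda>m. m - Suc n"]) (auto simp: Suc_diff_Suc)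
  also have "\<dots> \<le> 4/63" using upper[of N] by (smt (verit) divide_pos_pos mult_pos_pos zero_less_power)
  finally show ?thesis using lower[of n] by simp
qed

section \<open>Carleson sequences are uniformly separated\<close>

lemma H_infinityE:
  assumes "f \<in> H_infinity"
  obtains M where "0 < M" "f holomorphic_on \<bbbD>" "\<And>z. norm z < 1 \<Longrightarrow> norm (f z) \<le> M"
proof -
  have f: "f holomorphic_on \<bbbD>" "bounded (f ` \<bbbD>)"
    using assms by (simp_all add: H_infinity_def)
  from f(2) obtain M where "0 < M" "\<forall>x\<in>f ` \<bbbD>. norm x \<le> M"
    unfolding bounded_pos by blast
  then show thesis
    by (intro that[of M] f(1)) auto
qed

lemma bounded_indicator_image: "bounded ((\<lambda>j. if j \<in> K then 1 else (0::complex)) ` J)"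
  by (rule bounded_subset[of "{0,1}"]) auto

lemma carleson_seq_interpolates_indicator:
  assumes "carleson_seq J l"
  obtains f M where "0 < M" "f holomorphic_on \<bbbD>" "\<And>z. norm z < 1 \<Longrightarrow> norm (f z) \<le> M"
    "\<And>j. j \<in> J \<Longrightarrow> f (l j) = (if j \<in> K then 1 else 0)"
proof -
  obtain f where f: "f \<in> H_infinity" "\<forall>j\<in>J. f (l j) = (if j \<in> K then 1 else 0)"
    using assms bounded_indicator_image[of K J] unfolding carleson_seq_def by blast
  show thesis
  proof (rule H_infinityE[OF f(1)])
    fix M :: real assume "0 < M" "f holomorphic_on \<bbbD>" "\<And>z. norm z < 1 \<Longrightarrow> norm (f z) \<le> M"
    then show thesis using that[of M f] f(2) by simp
  qed
qed

lemma carleson_seq_inj_on: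
  assumes "carleson_seq J l"
  shows "inj_on l J"
proof (rule inj_onI)
  fix j k assume jk: "j \<in> J" "k \<in> J" "l j = l k"
  obtain f M where "0 < M" "f holomorphic_on \<bbbD>" "\<And>z. norm z < 1 \<Longrightarrow> norm (f z) \<le> M"
    and f: "\<And>i. i \<in> J \<Longrightarrow> f (l i) = (if i \<in> {j} then 1 else 0)"
    by (rule carleson_seq_interpolates_indicator[OF assms, of "{j}"]) (rule that)
  from f[OF jk(1)] f[OF jk(2)] jk(3) have "(1::complex) = (if k \<in> {j} then 1 else 0)" by simp
  then show "j = k" by (simp split: if_splits)
qed

text \<open>
  The constant still depends on the point: it is the reciprocal of a bound for a function
  taking the value one at that point and zero at all the others.
\<close>

lemma carleson_seq_separated_at:
  assumes C: "carleson_seq J l" and "k \<in> J"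
  obtains d where "0 < d" "\<And>F. finite F \<Longrightarrow> F \<subseteq> J - {k} \<Longrightarrow> d \<le> (\<Prod>j\<in>F. rho (l j) (l k))"
proof -
  have l: "l ` J \<subseteq> \<bbbD>" using C by (simp add: carleson_seq_def)
  obtain f M where f: "0 < M" "f holomorphic_on \<bbbD>" "\<And>z. norm z < 1 \<Longrightarrow> norm (f z) \<le> M"
    "\<And>j. j \<in> J \<Longrightarrow> f (l j) = (if j \<in> {k} then 1 else 0)"
    by (rule carleson_seq_interpolates_indicator[OF C, of "{k}"]) (rule that)
  show thesis
  proof (rule that[of "1 / M"])
    fix F assume F: "finite F" "F \<subseteq> J - {k}"
    have "norm (f (l k)) \<le> M * (\<Prod>j\<in>F. rho (l j) (l k))"
    proof (rule bounded_zeros_le[OF F(1) _ _ f(2,3)])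
      show "inj_on l F"
        by (rule inj_on_subset[OF carleson_seq_inj_on[OF C]]) (use F(2) in auto)
      show "l ` F \<subseteq> \<bbbD>" using F(2) l by auto
      show "norm (l k) < 1" using l \<open>k \<in> J\<close> by auto
      show "f (l j) = 0" if "j \<in> F" for j
      proof -
        have "j \<in> J" "j \<noteq> k" using F(2) that by auto
        then show ?thesis using f(4)[of j] by simp
      qed
    qed
    then show "1 / M \<le> (\<Prod>j\<in>F. rho (l j) (l k))"
      using f(1) f(4)[OF \<open>k \<in> J\<close>] by (simp add: field_simps)
  qed (use f(1) in auto)
qed

text \<open>
  This is Weierstrass's inequality for products; it turns the smallness of \<open>\<Sum>(1 - \<rho>\<^sup>2)\<close> into a lower bound
  for \<open>\<Prod>\<rho>\<close>.
\<close>

lemma prod_sq_ge: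
  fixes x :: "'a \<Rightarrow> real"
  assumes "\<And>j. j \<in> F \<Longrightarrow> 0 \<le> x j \<and> x j \<le> 1" 
  shows "1 - (\<Sum>j\<in>F. 1 - (x j)\<^sup>2) \<le> (\<Prod>j\<in>F. x j)"
proof -
  have "1 - (\<Sum>j\<in>F. 1 - (x j)\<^sup>2) \<le> (\<Prod>j\<in>F. 1 - (1 - (x j)\<^sup>2))"
    using assms by (intro Weierstrass_prod_ineq) (auto simp: abs_square_le_1)
  also have "\<dots> \<le> (\<Prod>j\<in>F. x j)"
    using assms by (intro prod_mono) (auto simp: power2_eq_square mult_left_le)
  finally show ?thesis .
qed

text \<open>
  Compared with a fixed point of the sequence, all points of height at least \<open>e\<close> have \<open>\<rho>\<close> bounded
  away from one, so infinitely many of them would make the products in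
  \<open>carleson_seq_separated_at\<close> arbitrarily small.
\<close>

lemma carleson_seq_finite_above:
  assumes C: "carleson_seq J l" and e: "0 < e"
  shows "finite {j \<in> J. e \<le> 1 - (norm (l j))\<^sup>2}"
proof (cases "J = {}")
  case False
  then obtain k where k: "k \<in> J" by blast
  have l: "norm (l j) < 1" if "j \<in> J" for j using C that by (auto simp: carleson_seq_def)
  obtain d where d: "0 < d" "\<And>F. finite F \<Longrightarrow> F \<subseteq> J - {k} \<Longrightarrow> d \<le> (\<Prod>j\<in>F. rho (l j) (l k))"
    using carleson_seq_separated_at[OF C k] by blast
  \<comment> \<open>The denominator of \<open>1 - \<rho>\<^sup>2\<close> is at most four.\<close>
  define c where "c = e * (1 - (norm (l k))\<^sup>2) / 4"
  have c: "0 < c" using e one_minus_norm_sq_pos[OF l[OF k]] by (simp add: c_def)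
  have small: "(rho (l j) (l k))\<^sup>2 \<le> 1 - c" if j: "j \<in> J" "e \<le> 1 - (norm (l j))\<^sup>2" for j
  proof -
    have nz: "1 - cnj (l j) * l k \<noteq> 0" using cnj_mult_neq_1 l j(1) k by blast
    have "norm (1 - cnj (l j) * l k) \<le> 1 + norm (cnj (l j) * l k)"
      using norm_triangle_ineq4[of 1 "cnj (l j) * l k"] by simp
    also have "norm (cnj (l j) * l k) \<le> 1"
      using l[OF j(1)] l[OF k] by (simp add: norm_mult mult_le_one)
    finally have "(norm (1 - cnj (l j) * l k))\<^sup>2 \<le> 2\<^sup>2"
      by (intro power_mono) auto
    moreover have "e * (1 - (norm (l k))\<^sup>2) \<le> (1 - (norm (l j))\<^sup>2) * (1 - (norm (l k))\<^sup>2)"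
      using j one_minus_norm_sq_pos[OF l[OF k]] by (intro mult_right_mono) auto
    ultimately have "c \<le> (1 - (norm (l j))\<^sup>2) * (1 - (norm (l k))\<^sup>2) / (norm (1 - cnj (l j) * l k))\<^sup>2"
      unfolding c_def using nz e one_minus_norm_sq_pos[OF l[OF k]] one_minus_norm_sq_pos[OF l[OF j(1)]]
      by (intro frac_le) auto
    then show ?thesis using one_minus_rho_sq[OF l[OF j(1)] l[OF k]] by simp
  qed
  show ?thesis
  proof (rule ccontr)
    assume inf: "infinite {j \<in> J. e \<le> 1 - (norm (l j))\<^sup>2}"
    obtain n where n: "(1 - c) ^ n < d\<^sup>2"
      using real_arch_pow_inv[of "d\<^sup>2" "1 - c"] d c by auto
    have "infinite ({j \<in> J. e \<le> 1 - (norm (l j))\<^sup>2} - {k})" using inf by simp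
    then obtain F where F: "finite F" "card F = n" "F \<subseteq> {j \<in> J. e \<le> 1 - (norm (l j))\<^sup>2} - {k}"
      using infinite_arbitrarily_large by blast
    have "d \<le> (\<Prod>j\<in>F. rho (l j) (l k))" using d(2) F by blast
    then have "d\<^sup>2 \<le> (\<Prod>j\<in>F. rho (l j) (l k))\<^sup>2" using d by (intro power_mono) auto
    also have "\<dots> = (\<Prod>j\<in>F. (rho (l j) (l k))\<^sup>2)" by (rule prod_power_distrib)
    also have "\<dots> \<le> (\<Prod>j\<in>F. 1 - c)" using F small by (intro prod_mono) auto
    also have "\<dots> = (1 - c) ^ n" using F by simp
    finally show False using n by simp
  qed
qed auto

text \<open>
  A gliding hump replaces the usual appeal to the open mapping theorem.  If the products were not
  bounded below, they would be arbitrarily small at points arbitrarily close to the circle, because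
  only finitely many points stay away from it and each has its own positive bound.  So there is a
  lacunary subsequence along which the products tend to zero.  Its members hardly interact, so
  the smallness comes from the other points.  A bounded function vanishing at those other points
  therefore tends to zero along the subsequence and cannot equal one on it.
\<close>

lemma carleson_seq_uniformly_separated:
  assumes C: "carleson_seq J l"
  shows "\<exists>d>0. \<forall>k\<in>J. \<forall>F. finite F \<longrightarrow> F \<subseteq> J - {k} \<longrightarrow> d \<le> (\<Prod>j\<in>F. rho (l j) (l k))"
proof (rule ccontr)
  assume neg: "\<not> ?thesis"
  have l: "norm (l j) < 1" if "j \<in> J" for j using C that by (auto simp: carleson_seq_def)
  define bad where "bad d k F \<longleftrightarrow> k \<in> J \<and> finite F \<and> F \<subseteq> J - {k} \<and> (\<Prod>j\<in>F. rho (l j) (l k)) < d" for d k F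
  have ex_bad: "\<exists>k F. bad d k F \<and> 1 - (norm (l k))\<^sup>2 \<le> e" if "0 < d" "0 < e" for d e
  proof -
    let ?N = "{j \<in> J. e \<le> 1 - (norm (l j))\<^sup>2}"
    have fin: "finite ?N" by (rule carleson_seq_finite_above[OF C that(2)])
    have "\<forall>k\<in>?N. \<exists>d>0. \<forall>F. finite F \<longrightarrow> F \<subseteq> J - {k} \<longrightarrow> d \<le> (\<Prod>j\<in>F. rho (l j) (l k))"
    proof
      fix k assume "k \<in> ?N"
      then have "k \<in> J" by simp
      then show "\<exists>d>0. \<forall>F. finite F \<longrightarrow> F \<subseteq> J - {k} \<longrightarrow> d \<le> (\<Prod>j\<in>F. rho (l j) (l k))"
        using carleson_seq_separated_at[OF C, of k] by blast
    qed
    from bchoice[OF this] obtain D where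
      D: "\<forall>k\<in>?N. 0 < D k \<and> (\<forall>F. finite F \<longrightarrow> F \<subseteq> J - {k} \<longrightarrow> D k \<le> (\<Prod>j\<in>F. rho (l j) (l k)))"
      ..
    define d' where "d' = Min (insert d (D ` ?N))"
    have "0 < d'" using fin D that by (auto simp: d'_def)
    then obtain k F where kF: "k \<in> J" "finite F" "F \<subseteq> J - {k}" "(\<Prod>j\<in>F. rho (l j) (l k)) < d'"
      using neg by (meson not_le)
    \<comment> \<open>Every point of height at least \<open>e\<close> respects the bound \<open>d'\<close>, so the offending point lies lower.\<close>
    have "k \<notin> ?N"
    proof
      assume k: "k \<in> ?N"
      then have "d' \<le> D k" using fin by (auto simp: d'_def)
      then show False using bspec[OF D k] kF by (meson leD le_less_trans order_trans)
    qed
    moreover have "d' \<le> d" using fin by (simp add: d'_def)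
    ultimately show ?thesis using kF by (intro exI[of _ k] exI[of _ F]) (auto simp: bad_def)
  qed
  let ?h = "\<lambda>k. 1 - (norm (l k))\<^sup>2"
  have "\<exists>g. \<forall>n. (\<exists>F. bad (1 / real (Suc n)) (g n) F) \<and> ?h (g (Suc n)) \<le> ?h (g n) / 64"
  proof (rule dependent_nat_choice)
    show "\<exists>k. \<exists>F. bad (1 / real (Suc 0)) k F" using ex_bad[of 1 1] by auto
  next
    fix k n assume "\<exists>F. bad (1 / real (Suc n)) k F"
    then have "0 < ?h k / 64" using one_minus_norm_sq_pos[OF l] by (auto simp: bad_def)
    then show "\<exists>k'. (\<exists>F. bad (1 / real (Suc (Suc n))) k' F) \<and> ?h k' \<le> ?h k / 64"
      using ex_bad[of "1 / real (Suc (Suc n))" "?h k / 64"] by auto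
  qed
  then obtain g where "\<And>n. \<exists>F. bad (1 / real (Suc n)) (g n) F" and hg: "\<And>n. ?h (g (Suc n)) \<le> ?h (g n) / 64"
    by blast
  then obtain F where bad: "\<And>n. bad (1 / real (Suc n)) (g n) (F n)" by metis
  have gJ: "g n \<in> J" for n using bad by (simp add: bad_def)
  obtain f M where f: "0 < M" "f holomorphic_on \<bbbD>" "\<And>z. norm z < 1 \<Longrightarrow> norm (f z) \<le> M"
    "\<And>j. j \<in> J \<Longrightarrow> f (l j) = (if j \<in> range g then 1 else 0)"
    by (rule carleson_seq_interpolates_indicator[OF C, of "range g"]) (rule that)
  have "1 \<le> 2 * M / real (Suc n)" for n
  proof -
    let ?r = "\<lambda>j. rho (l j) (l (g n))"
    have F: "finite (F n)" "F n \<subseteq> J - {g n}" "(\<Prod>j\<in>F n. ?r j) < 1 / real (Suc n)"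
      using bad[of n] by (auto simp: bad_def)
    have "norm (f (l (g n))) \<le> M * (\<Prod>j\<in>F n - range g. ?r j)"
    proof (rule bounded_zeros_le[OF _ _ _ f(2,3)])
      show "finite (F n - range g)" using F(1) by blast
      show "inj_on l (F n - range g)" by (rule inj_on_subset[OF carleson_seq_inj_on[OF C]]) (use F(2) in auto)
      show "l ` (F n - range g) \<subseteq> \<bbbD>" using F(2) l by auto
      show "norm (l (g n)) < 1" using l[OF gJ] .
      show "f (l j) = 0" if "j \<in> F n - range g" for j
        using f(4)[of j] F(2) that by auto
    qed
    then have 1: "1 \<le> M * (\<Prod>j\<in>F n - range g. ?r j)" using f(4)[OF gJ[of n]] by simp
    \<comment> \<open>The members of the subsequence contribute a factor of at least one half to the product.\<close>
    define I where "I = {m. g m \<in> F n}"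
    have strict: "?h (g (Suc m)) < ?h (g m)" for m
    proof -
      have "x / 64 < x" if "0 < x" for x :: real using that by simp
      from le_less_trans[OF hg this[OF one_minus_norm_sq_pos[OF l[OF gJ]]]] show ?thesis .
    qed
    have "strict_mono (\<lambda>m. - ?h (g m))"
      unfolding strict_mono_Suc_iff using strict by (intro allI) (rule iffD2[OF neg_less_iff_less])
    then have "inj ((\<lambda>k. - ?h k) \<circ> g)" by (simp add: comp_def strict_mono_imp_inj_on)
    then have inj: "inj g" by (rule inj_on_imageI2)
    have I: "finite I" "n \<notin> I" "F n \<inter> range g = g ` I"
      using F inj by (auto simp: I_def intro: finite_vimageI[of "F n" g, unfolded vimage_def])
    have "(\<Sum>j\<in>F n \<inter> range g. 1 - (?r j)\<^sup>2) = (\<Sum>m\<in>I. 1 - (?r (g m))\<^sup>2)"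
      unfolding I(3) using inj by (intro sum.reindex_cong[of g]) (auto intro: inj_on_subset)
    also have "\<dots> \<le> (\<Sum>m\<in>I. 4 * (1/64) ^ ((m - n) + (n - m)))"
    proof (rule sum_mono)
      fix m assume "m \<in> I"
      then have "m \<noteq> n" using I by auto
      show "1 - (?r (g m))\<^sup>2 \<le> 4 * (1/64) ^ ((m - n) + (n - m))"
        by (rule lacunary_rho[of 1 1 "\<lambda>n. ?h (g n)", OF _ _ _ _ \<open>m \<noteq> n\<close>])
           (use l gJ hg one_minus_norm_sq_pos[OF l[OF gJ]] in auto)
    qed
    also have "\<dots> \<le> 1/2" by (rule lacunary_sum[OF I(1,2)])
    finally have "1/2 \<le> 1 - (\<Sum>j\<in>F n \<inter> range g. 1 - (?r j)\<^sup>2)" by simp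
    also have "\<dots> \<le> (\<Prod>j\<in>F n \<inter> range g. ?r j)"
      using F l gJ by (intro prod_sq_ge) (auto intro!: less_imp_le[OF rho_less_1])
    finally have "(1/2) * (\<Prod>j\<in>F n - range g. ?r j) \<le> (\<Prod>j\<in>F n \<inter> range g. ?r j) * (\<Prod>j\<in>F n - range g. ?r j)"
      by (intro mult_right_mono prod_nonneg) auto
    also have "\<dots> = (\<Prod>j\<in>F n. ?r j)"
      using F(1) by (subst prod.union_disjoint[symmetric]) (auto intro!: prod.cong)
    finally have "(\<Prod>j\<in>F n - range g. ?r j) \<le> 2 / real (Suc n)" using F(3) by simp
    then have "M * (\<Prod>j\<in>F n - range g. ?r j) \<le> M * (2 / real (Suc n))"
      using f(1) by (intro mult_left_mono) auto
    from order_trans[OF 1 this] show ?thesis by (simp add: mult_ac)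
  qed
  moreover obtain n where "2 * M < real n" using reals_Archimedean2 by blast
  then have "2 * M / real (Suc n) < 1" by (simp add: divide_less_eq)
  ultimately show False by (meson not_le)
qed

section \<open>Interpolation of bounded data\<close>

text \<open>
  This is a lower Riemann sum of \<open>\<integral> e\<^sup>-\<^sup>t dt\<close>: adding the element with the smallest value of \<open>g\<close> last, each
  summand is at most the drop of \<open>e\<^sup>-\<^sup>t\<close> over an interval of length \<open>w k\<close>.  Ties in \<open>g\<close> only
  make the summands smaller.
\<close>

lemma exp_tail_sum_le:
  fixes w :: "'a \<Rightarrow> real" and g :: "'a \<Rightarrow> real"
  assumes "finite F" "\<And>j. j \<in> F \<Longrightarrow> 0 \<le> w j"
  shows "(\<Sum>k\<in>F. w k * exp (- (\<Sum>j | j \<in> F \<and> g k \<le> g j. w j))) \<le> 1 - exp (- (\<Sum>j\<in>F. w j))"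
  using assms
proof (induction F rule: finite_ranking_induct[where f = "\<lambda>j. - g j"])
  case empty
  then show ?case by simp
next
  case (insert x F)
  show ?case
  proof (cases "x \<in> F")
    case True
    then show ?thesis using insert by (simp add: insert_absorb)
  next
    case False
    let ?T = "\<lambda>F k. \<Sum>j | j \<in> F \<and> g k \<le> g j. w j"
    have w: "0 \<le> w j" if "j \<in> insert x F" for j using insert.prems that by blast
    have set: "{j. j \<in> insert x F \<and> g x \<le> g j} = insert x F"
      using insert.hyps(2) by auto
    have "w k * exp (- ?T (insert x F) k) \<le> w k * exp (- ?T F k)" if "k \<in> F" for k
    proof -
      have "?T F k \<le> ?T (insert x F) k"
        using insert.hyps(1) w by (intro sum_mono2) auto
      then show ?thesis using w that by (intro mult_left_mono) auto
    qed
    then have "(\<Sum>k\<in>F. w k * exp (- ?T (insert x F) k)) \<le> (\<Sum>k\<in>F. w k * exp (- ?T F k))"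
      by (rule sum_mono)
    also have "\<dots> \<le> 1 - exp (- (\<Sum>j\<in>F. w j))"
      by (rule insert.IH) (use w in auto)
    finally have 1: "(\<Sum>k\<in>F. w k * exp (- ?T (insert x F) k)) \<le> 1 - exp (- (\<Sum>j\<in>F. w j))" .
    have "w x * exp (- w x) \<le> 1 - exp (- w x)"
      using exp_ge_add_one_self[of "w x"] by (simp add: exp_minus field_simps)
    then have "w x * exp (- w x) * exp (- (\<Sum>j\<in>F. w j)) \<le> (1 - exp (- w x)) * exp (- (\<Sum>j\<in>F. w j))"
      by (rule mult_right_mono) simp
    then have 2: "w x * exp (- ?T (insert x F) x) \<le> exp (- (\<Sum>j\<in>F. w j)) - exp (- (\<Sum>j\<in>insert x F. w j))"
      unfolding set using False insert.hyps(1) by (simp add: exp_add[symmetric] algebra_simps)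
    have "(\<Sum>k\<in>insert x F. w k * exp (- ?T (insert x F) k))
        = w x * exp (- ?T (insert x F) x) + (\<Sum>k\<in>F. w k * exp (- ?T (insert x F) k))"
      using False insert.hyps(1) by (rule sum.insert[rotated])
    with 1 2 show ?thesis by linarith
  qed
qed

text \<open>
  The Herglotz kernel of an interior point, weighted by its height.  Being holomorphic, it may be
  exponentiated, and its real part is positive.
\<close>

definition herglotz_term :: "complex \<Rightarrow> complex \<Rightarrow> complex"
  where "herglotz_term a z = of_real (1 - (norm a)\<^sup>2) * (1 + cnj a * z) / (1 - cnj a * z)"

lemma Re_herglotz_term:
  "Re (herglotz_term a z) = (1 - (norm a)\<^sup>2) * (1 - (norm a)\<^sup>2 * (norm z)\<^sup>2) / (norm (1 - cnj a * z))\<^sup>2"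
proof -
  have "Re ((1 + u) / (1 - u)) = (1 - (norm u)\<^sup>2) / (norm (1 - u))\<^sup>2" for u :: complex
    unfolding Re_divide cmod_power2 by (simp add: algebra_simps power2_eq_square)
  then have cayley: "Re ((1 + cnj a * z) / (1 - cnj a * z))
      = (1 - (norm a)\<^sup>2 * (norm z)\<^sup>2) / (norm (1 - cnj a * z))\<^sup>2"
    by (simp only: norm_mult power_mult_distrib complex_mod_cnj)
  have "herglotz_term a z = of_real (1 - (norm a)\<^sup>2) * ((1 + cnj a * z) / (1 - cnj a * z))"
    unfolding herglotz_term_def by (rule times_divide_eq_right[symmetric])
  moreover have "Re (of_real r * u) = r * Re u" for r u by simp
  ultimately have "Re (herglotz_term a z) = (1 - (norm a)\<^sup>2) * Re ((1 + cnj a * z) / (1 - cnj a * z))"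
    by metis
  then show ?thesis
    by (simp only: cayley times_divide_eq_right)
qed

lemma herglotz_term_holomorphic:
  assumes "norm a < 1"
  shows "herglotz_term a holomorphic_on \<bbbD>"
  unfolding herglotz_term_def
  using cnj_mult_neq_1[OF assms] by (intro holomorphic_intros) auto

lemma Re_herglotz_term_bounds:
  assumes a: "norm a < 1" and z: "norm z < 1"
  shows "(1 - (norm a)\<^sup>2)\<^sup>2 / (norm (1 - cnj a * z))\<^sup>2 \<le> Re (herglotz_term a z)"
    and "norm z \<le> norm a \<Longrightarrow> Re (herglotz_term a z) \<le> 2 * (1 - (rho a z)\<^sup>2)"
proof -
  have a2: "0 \<le> 1 - (norm a)\<^sup>2" "0 \<le> 1 - (norm z)\<^sup>2"
    using less_imp_le[OF one_minus_norm_sq_pos] a z by blast+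
  then have "(norm a)\<^sup>2 * (norm z)\<^sup>2 \<le> (norm a)\<^sup>2"
    by (simp add: mult_left_le)
  then show "(1 - (norm a)\<^sup>2)\<^sup>2 / (norm (1 - cnj a * z))\<^sup>2 \<le> Re (herglotz_term a z)"
    unfolding Re_herglotz_term power2_eq_square[of "1 - (norm a)\<^sup>2"]
    using a2 by (intro divide_right_mono mult_left_mono) auto
  assume "norm z \<le> norm a"
  then have "(norm z)\<^sup>2 \<le> (norm a)\<^sup>2" by (intro power_mono) auto
  moreover have "0 \<le> (1 - (norm a)\<^sup>2) * (1 - (norm z)\<^sup>2)" using a2 by simp
  then have "0 \<le> 1 - (norm a)\<^sup>2 - (norm z)\<^sup>2 + (norm a)\<^sup>2 * (norm z)\<^sup>2"
    by (simp add: algebra_simps)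
  ultimately have "1 - (norm a)\<^sup>2 * (norm z)\<^sup>2 \<le> 2 * (1 - (norm z)\<^sup>2)"
    by argo
  then have "(1 - (norm a)\<^sup>2) * (1 - (norm a)\<^sup>2 * (norm z)\<^sup>2) / (norm (1 - cnj a * z))\<^sup>2
      \<le> (1 - (norm a)\<^sup>2) * (2 * (1 - (norm z)\<^sup>2)) / (norm (1 - cnj a * z))\<^sup>2"
    using a2 by (intro divide_right_mono mult_left_mono) auto
  then show "Re (herglotz_term a z) \<le> 2 * (1 - (rho a z)\<^sup>2)"
    unfolding Re_herglotz_term one_minus_rho_sq[OF a z] by (simp only: mult_ac times_divide_eq_right)
qed

text \<open>
  Jones's formula.  The interpolating function is \<open>\<Sum>\<^sub>k a\<^sub>k B\<^sub>k(z) / B\<^sub>k(\<lambda>\<^sub>k) G\<^sub>k(z) E\<^sub>k(z)\<close>, where \<open>B\<^sub>k\<close> is the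
  Blaschke product of the points other than \<open>\<lambda>\<^sub>k\<close>.  The factors \<open>G\<^sub>k\<close> and \<open>E\<^sub>k\<close> equal one at \<open>\<lambda>\<^sub>k\<close> and make
  \<open>\<Sum>\<^sub>k |G\<^sub>k E\<^sub>k|\<close> bounded independently of the number of points: with \<open>w\<^sub>k\<close> the real part at \<open>z\<close> of the
  Herglotz term of \<open>\<lambda>\<^sub>k\<close>, divided by \<open>A\<close>, the modulus of \<open>G\<^sub>k\<close> is at most \<open>A w\<^sub>k\<close>, that of \<open>E\<^sub>k\<close> is at most
  \<open>e\<^sup>2\<close> times the exponential of minus the sum of the \<open>w\<^sub>j\<close> over \<open>|\<lambda>\<^sub>j| \<ge> |\<lambda>\<^sub>k|\<close>, and \<open>exp_tail_sum_le\<close> applies.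
\<close>

lemma finite_interpolation:
  fixes l :: "nat \<Rightarrow> complex" and a :: "nat \<Rightarrow> complex"
  assumes fin: "finite F" and l: "\<And>j. j \<in> F \<Longrightarrow> norm (l j) < 1"
    and d: "0 < d" "\<And>k. k \<in> F \<Longrightarrow> d \<le> (\<Prod>j\<in>F - {k}. rho (l j) (l k))"
    and A: "0 < A" "\<And>k. k \<in> F \<Longrightarrow> (\<Sum>j\<in>F. 1 - (rho (l j) (l k))\<^sup>2) \<le> A"
    and N: "0 \<le> N" "\<And>j. j \<in> F \<Longrightarrow> norm (a j) \<le> N"
  obtains f where "f holomorphic_on \<bbbD>" "\<And>z. norm z < 1 \<Longrightarrow> norm (f z) \<le> N * (A * exp 2 / d)"
    "\<And>j. j \<in> F \<Longrightarrow> f (l j) = a j"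
proof -
  define B where "B = (\<lambda>k z. \<Prod>j\<in>F - {k}. (z - l j) / (1 - cnj (l j) * z))"
  define G where "G = (\<lambda>k z. (of_real (1 - (norm (l k))\<^sup>2) / (1 - cnj (l k) * z))\<^sup>2)"
  define S where "S = (\<lambda>k. {j \<in> F. norm (l k) \<le> norm (l j)})"
  define E where "E = (\<lambda>k z. exp (- (\<Sum>j\<in>S k. herglotz_term (l j) z - herglotz_term (l j) (l k)) / of_real A))"
  define f where "f = (\<lambda>z. \<Sum>k\<in>F. a k * (B k z / B k (l k)) * G k z * E k z)"
  have nz: "1 - cnj (l k) * z \<noteq> 0" if "k \<in> F" "norm z < 1" for k z
    using cnj_mult_neq_1[OF l[OF that(1)] that(2)] .
  have SF: "S k \<subseteq> F" for k by (auto simp: S_def)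
  have normB: "norm (B k z) = (\<Prod>j\<in>F - {k}. rho (l j) z)" for k z
    by (simp add: B_def rho_def norm_divide prod_norm[symmetric] norm_minus_commute)
  have B_ge: "d \<le> norm (B k (l k))" if "k \<in> F" for k
    unfolding normB by (rule d(2)[OF that])
  have B_nz: "B k (l k) \<noteq> 0" if "k \<in> F" for k
    using B_ge[OF that] d(1) by auto
  have B_le: "norm (B k z) \<le> 1" if z: "norm z < 1" for k z
    unfolding normB
  proof (intro prod_le_1 conjI rho_nonneg)
    show "rho (l i) z \<le> 1" if "i \<in> F - {k}" for i
      using that l z by (intro less_imp_le rho_less_1) auto
  qed
  show thesis
  proof (rule that)
    have "(\<lambda>z. B k z) holomorphic_on \<bbbD>" if "k \<in> F" for k
      unfolding B_def using nz by (intro holomorphic_intros) auto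
    moreover have "(\<lambda>z. G k z) holomorphic_on \<bbbD>" if "k \<in> F" for k
      unfolding G_def using nz that by (intro holomorphic_intros) auto
    moreover have "(\<lambda>z. E k z) holomorphic_on \<bbbD>" if "k \<in> F" for k
    proof -
      have "herglotz_term (l j) holomorphic_on \<bbbD>" if "j \<in> S k" for j
        using SF l that by (intro herglotz_term_holomorphic) blast
      then show ?thesis
        unfolding E_def using A(1) by (intro holomorphic_intros) auto
    qed
    ultimately show "f holomorphic_on \<bbbD>"
      unfolding f_def using B_nz by (intro holomorphic_intros) auto
  next
    fix i assume i: "i \<in> F"
    have "B k (l i) = 0" if "k \<in> F - {i}" for k
      unfolding B_def using i that fin by (intro prod_zero) (auto intro!: bexI[of _ i])
    then have "f (l i) = (\<Sum>k\<in>{i}. a k * (B k (l i) / B k (l k)) * G k (l i) * E k (l i))"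
      unfolding f_def using fin i by (intro sum.mono_neutral_right) auto
    also have "\<dots> = a i * G i (l i)"
      using B_nz[OF i] by (simp add: E_def)
    also have "G i (l i) = 1"
    proof -
      have "complex_of_real (1 - (norm (l i))\<^sup>2) = 1 - cnj (l i) * l i"
        by (simp add: complex_norm_square[symmetric] mult.commute)
      then show ?thesis using nz[OF i l[OF i]] by (simp add: G_def)
    qed
    finally show "f (l i) = a i" by simp
  next
    fix z :: complex assume z: "norm z < 1"
    define w where "w = (\<lambda>j. Re (herglotz_term (l j) z) / A)"
    have w0: "0 \<le> w j" if "j \<in> F" for j
      using order_trans[OF _ Re_herglotz_term_bounds(1)[OF l[OF that] z]] A(1) by (simp add: w_def)
    have term_le: "norm (a k * (B k z / B k (l k)) * G k z * E k z)
        \<le> N * (A * exp 2 / d) * (w k * exp (- (\<Sum>j | j \<in> F \<and> norm (l k) \<le> norm (l j). w j)))"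
      if k: "k \<in> F" for k
    proof -
      have BB: "norm (B k z / B k (l k)) \<le> 1 / d"
        unfolding norm_divide using B_le[OF z] B_ge[OF k] d(1) by (intro frac_le) auto
      have "norm (G k z) = (1 - (norm (l k))\<^sup>2)\<^sup>2 / (norm (1 - cnj (l k) * z))\<^sup>2"
        unfolding G_def norm_power norm_divide norm_of_real power_divide by simp
      also have "\<dots> \<le> A * w k"
        using Re_herglotz_term_bounds(1)[OF l[OF k] z] A(1) by (simp add: w_def)
      finally have GG: "norm (G k z) \<le> A * w k" .
      have "(\<Sum>j\<in>S k. Re (herglotz_term (l j) (l k))) \<le> (\<Sum>j\<in>S k. 2 * (1 - (rho (l j) (l k))\<^sup>2))"
        using l k by (intro sum_mono Re_herglotz_term_bounds(2)) (auto simp: S_def)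
      also have "\<dots> \<le> (\<Sum>j\<in>F. 2 * (1 - (rho (l j) (l k))\<^sup>2))"
      proof (rule sum_mono2[OF fin SF])
        fix j assume "j \<in> F - S k"
        then have "(rho (l j) (l k))\<^sup>2 \<le> 1"
          using rho_less_1[OF l l[OF k], of j] by (simp add: abs_square_le_1)
        then show "0 \<le> 2 * (1 - (rho (l j) (l k))\<^sup>2)" by simp
      qed
      also have "\<dots> \<le> 2 * A"
        unfolding sum_distrib_left[symmetric] using A(2)[OF k] by simp
      finally have "(\<Sum>j\<in>S k. Re (herglotz_term (l j) (l k))) / A \<le> 2"
        using A(1) by (simp add: divide_le_eq)
      moreover have "norm (E k z) = exp ((\<Sum>j\<in>S k. Re (herglotz_term (l j) (l k))) / A - (\<Sum>j\<in>S k. w j))"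
        unfolding E_def norm_exp_eq_Re
        by (simp add: w_def sum_subtractf sum_divide_distrib[symmetric] diff_divide_distrib)
      ultimately have "norm (E k z) \<le> exp (2 - (\<Sum>j\<in>S k. w j))" by simp
      also have "\<dots> = exp 2 * exp (- (\<Sum>j | j \<in> F \<and> norm (l k) \<le> norm (l j). w j))"
        by (simp add: S_def exp_add[symmetric])
      finally have EE: "norm (E k z) \<le> exp 2 * exp (- (\<Sum>j | j \<in> F \<and> norm (l k) \<le> norm (l j). w j))" .
      have "norm (a k) * norm (B k z / B k (l k)) * norm (G k z) * norm (E k z)
          \<le> N * (1 / d) * (A * w k) * (exp 2 * exp (- (\<Sum>j | j \<in> F \<and> norm (l k) \<le> norm (l j). w j)))"
        using N(1) d(1) A(1) w0[OF k] by (intro mult_mono N(2)[OF k] BB GG EE mult_nonneg_nonneg) auto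
      also have "\<dots> = N * (A * exp 2 / d) * (w k * exp (- (\<Sum>j | j \<in> F \<and> norm (l k) \<le> norm (l j). w j)))"
        by (simp add: mult_ac)
      finally show ?thesis
        unfolding norm_mult .
    qed
    have "norm (f z) \<le> (\<Sum>k\<in>F. norm (a k * (B k z / B k (l k)) * G k z * E k z))"
      unfolding f_def by (rule norm_sum)
    also have "\<dots> \<le> (\<Sum>k\<in>F. N * (A * exp 2 / d) * (w k * exp (- (\<Sum>j | j \<in> F \<and> norm (l k) \<le> norm (l j). w j))))"
      by (rule sum_mono[OF term_le])
    also have "\<dots> = N * (A * exp 2 / d) * (\<Sum>k\<in>F. w k * exp (- (\<Sum>j | j \<in> F \<and> norm (l k) \<le> norm (l j). w j)))"
      by (simp only: sum_distrib_left)
    also have "\<dots> \<le> N * (A * exp 2 / d) * 1"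
    proof (rule mult_left_mono)
      show "(\<Sum>k\<in>F. w k * exp (- (\<Sum>j | j \<in> F \<and> norm (l k) \<le> norm (l j). w j))) \<le> 1"
        using exp_tail_sum_le[OF fin, of w "\<lambda>j. norm (l j)", OF w0] exp_gt_zero[of "- (\<Sum>j\<in>F. w j)"] by linarith
    qed (use N(1) A(1) d(1) in auto)
    finally show "norm (f z) \<le> N * (A * exp 2 / d)" by simp
  qed
qed

text \<open>
  The last clause is the Carleson measure condition tested only at the points of the sequence.
  Phrasing it with finite subsets avoids any question of summability.
\<close>

definition separated_finite_mass :: "nat set \<Rightarrow> (nat \<Rightarrow> complex) \<Rightarrow> bool"
  where "separated_finite_mass J l \<longleftrightarrow> l ` J \<subseteq> \<bbbD> \<and>
    (\<exists>s>0. \<forall>j\<in>J. \<forall>k\<in>J. j \<noteq> k \<longrightarrow> s \<le> rho (l j) (l k)) \<and>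
    (\<exists>A. \<forall>k\<in>J. \<forall>F. finite F \<longrightarrow> F \<subseteq> J \<longrightarrow> (\<Sum>j\<in>F. 1 - (rho (l j) (l k))\<^sup>2) \<le> A)"

text \<open>
  The elementary inequality \<open>- ln x\<^sup>2 \<le> (1 - x\<^sup>2) / x\<^sup>2\<close>, by which separation turns bounded sums of
  \<open>1 - \<rho>\<^sup>2\<close> into lower bounds for products of \<open>\<rho>\<close>.
\<close>

lemma exp_le_of_sq:
  fixes x s :: real
  assumes "0 < s" "s \<le> x" "x \<le> 1"
  shows "exp (- ((1 - x\<^sup>2) / s\<^sup>2)) \<le> x"
proof -
  have x: "0 < x" using assms by simp
  have x2: "x\<^sup>2 \<le> 1" "s\<^sup>2 \<le> x\<^sup>2" using assms by (auto simp: abs_square_le_1 intro: power_mono)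
  have "- ln (x\<^sup>2) = ln (1 / x\<^sup>2)" using x by (simp add: ln_div)
  also have "\<dots> \<le> 1 / x\<^sup>2 - 1" using x by (intro ln_le_minus_one) auto
  also have "\<dots> = (1 - x\<^sup>2) / x\<^sup>2" using x by (simp add: field_simps)
  also have "\<dots> \<le> (1 - x\<^sup>2) / s\<^sup>2" using x x2 assms by (intro divide_left_mono) auto
  finally have "- ((1 - x\<^sup>2) / s\<^sup>2) \<le> ln (x\<^sup>2)" by simp
  then have "exp (- ((1 - x\<^sup>2) / s\<^sup>2)) \<le> exp (ln (x\<^sup>2))" by simp
  also have "\<dots> = x\<^sup>2" using x by simp
  also have "\<dots> \<le> x" using assms by (simp add: power2_eq_square mult_left_le)
  finally show ?thesis .
qed

lemma carleson_seq_imp_separated_finite_mass: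
  assumes C: "carleson_seq J l"
  shows "separated_finite_mass J l"
proof -
  have l: "norm (l j) < 1" if "j \<in> J" for j using C that by (auto simp: carleson_seq_def)
  obtain d where d: "0 < d"
    "\<forall>k\<in>J. \<forall>F. finite F \<longrightarrow> F \<subseteq> J - {k} \<longrightarrow> d \<le> (\<Prod>j\<in>F. rho (l j) (l k))"
    using carleson_seq_uniformly_separated[OF C] by (elim exE conjE)
  have sep: "d \<le> rho (l j) (l k)" if "j \<in> J" "k \<in> J" "j \<noteq> k" for j k
    using d(2)[rule_format, of k "{j}"] that by simp
  have mass: "(\<Sum>j\<in>F. 1 - (rho (l j) (l k))\<^sup>2) \<le> 1 - 2 * ln d"
    if k: "k \<in> J" and F: "finite F" "F \<subseteq> J" for k F
  proof -
    have pos: "0 < rho (l j) (l k)" if "j \<in> F - {k}" for j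
      using sep[of j k] that F k d(1) by auto
    have "1 - x\<^sup>2 \<le> - 2 * ln x" if "0 < x" for x :: real
      using ln_le_minus_one[of "x\<^sup>2"] that by (simp add: ln_realpow)
    then have "(\<Sum>j\<in>F - {k}. 1 - (rho (l j) (l k))\<^sup>2) \<le> (\<Sum>j\<in>F - {k}. - 2 * ln (rho (l j) (l k)))"
      using pos by (intro sum_mono) blast
    also have "\<dots> = - 2 * ln (\<Prod>j\<in>F - {k}. rho (l j) (l k))"
      using pos F by (subst ln_prod) (auto simp: sum_distrib_left dest!: pos[OF DiffI])
    also have "\<dots> \<le> - 2 * ln d"
    proof -
      have "d \<le> (\<Prod>j\<in>F - {k}. rho (l j) (l k))"
        using d(2)[rule_format, OF k, of "F - {k}"] F by auto
      then show ?thesis using d(1) by simp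
    qed
    finally have 1: "(\<Sum>j\<in>F - {k}. 1 - (rho (l j) (l k))\<^sup>2) \<le> - 2 * ln d" .
    show ?thesis
    proof (cases "k \<in> F")
      case True
      then show ?thesis using 1 F by (simp add: sum.remove[of F k])
    next
      case False
      then show ?thesis using 1 by simp
    qed
  qed
  show ?thesis
    unfolding separated_finite_mass_def
  proof (intro conjI)
    show "l ` J \<subseteq> \<bbbD>" using C by (simp add: carleson_seq_def)
    show "\<exists>s>0. \<forall>j\<in>J. \<forall>k\<in>J. j \<noteq> k \<longrightarrow> s \<le> rho (l j) (l k)"
      using d(1) sep by blast
    show "\<exists>A. \<forall>k\<in>J. \<forall>F. finite F \<longrightarrow> F \<subseteq> J \<longrightarrow> (\<Sum>j\<in>F. 1 - (rho (l j) (l k))\<^sup>2) \<le> A"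
      using mass by blast
  qed
qed

text \<open>
  The bound in \<open>finite_interpolation\<close> is the same for all finite subfamilies, so a normal families
  argument passes to the whole sequence.
\<close>

lemma separated_finite_mass_imp_carleson_seq:
  assumes "separated_finite_mass J l"
  shows "carleson_seq J l"
proof -
  obtain s A0 where l: "l ` J \<subseteq> \<bbbD>"
    and s: "0 < s" "\<forall>j\<in>J. \<forall>k\<in>J. j \<noteq> k \<longrightarrow> s \<le> rho (l j) (l k)"
    and A0: "\<forall>k\<in>J. \<forall>F. finite F \<longrightarrow> F \<subseteq> J \<longrightarrow> (\<Sum>j\<in>F. 1 - (rho (l j) (l k))\<^sup>2) \<le> A0"
    using assms unfolding separated_finite_mass_def by (elim conjE exE)
  have l1: "norm (l j) < 1" if "j \<in> J" for j using l that by auto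
  define A where "A = max 1 A0"
  have A: "0 < A" "(\<Sum>j\<in>F. 1 - (rho (l j) (l k))\<^sup>2) \<le> A" if "k \<in> J" "finite F" "F \<subseteq> J" for k F
    using A0[rule_format, OF that] by (auto simp: A_def)
  have A1: "0 < A" by (simp add: A_def)
  define d where "d = exp (- (A / s\<^sup>2))"
  have prod: "d \<le> (\<Prod>j\<in>F - {k}. rho (l j) (l k))" if k: "k \<in> J" and F: "finite F" "F \<subseteq> J" for k F
  proof -
    have "(\<Sum>j\<in>F - {k}. 1 - (rho (l j) (l k))\<^sup>2) \<le> A"
      using F by (intro A(2)[OF k]) auto
    then have "(\<Sum>j\<in>F - {k}. 1 - (rho (l j) (l k))\<^sup>2) / s\<^sup>2 \<le> A / s\<^sup>2"
      by (rule divide_right_mono) simp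
    then have "d \<le> exp (- ((\<Sum>j\<in>F - {k}. 1 - (rho (l j) (l k))\<^sup>2) / s\<^sup>2))"
      by (simp add: d_def)
    also have "\<dots> = (\<Prod>j\<in>F - {k}. exp (- ((1 - (rho (l j) (l k))\<^sup>2) / s\<^sup>2)))"
      using F by (simp add: exp_sum[symmetric] sum_negf sum_divide_distrib)
    also have "\<dots> \<le> (\<Prod>j\<in>F - {k}. rho (l j) (l k))"
    proof (intro prod_mono conjI)
      fix j assume j: "j \<in> F - {k}"
      then have "j \<in> J" "j \<noteq> k" using F by auto
      then show "exp (- ((1 - (rho (l j) (l k))\<^sup>2) / s\<^sup>2)) \<le> rho (l j) (l k)"
        using s k l1 by (intro exp_le_of_sq less_imp_le[OF rho_less_1]) auto
    qed simp
    finally show ?thesis .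
  qed
  have d: "0 < d" by (simp add: d_def)
  have "\<exists>f\<in>H_infinity. \<forall>j\<in>J. f (l j) = a j" if bd: "bounded (a ` J)" for a :: "nat \<Rightarrow> complex"
  proof -
    obtain N where N: "0 < N" "\<forall>x\<in>a ` J. norm x \<le> N" using bd unfolding bounded_pos by blast
    define M where "M = N * (A * exp 2 / d)"
    define P where "P = (\<lambda>n f. f holomorphic_on \<bbbD> \<and> (\<forall>z. norm z < 1 \<longrightarrow> norm (f z) \<le> M)
      \<and> (\<forall>j\<in>J \<inter> {..<n}. f (l j) = a j))"
    \<comment> \<open>Interpolation at the first indices only, with a bound independent of \<open>n\<close>.\<close>
    have "\<exists>f. P n f" for n
    proof (rule finite_interpolation[of "J \<inter> {..<n}" l d A N a])
      fix f assume "f holomorphic_on \<bbbD>" "\<And>z. norm z < 1 \<Longrightarrow> norm (f z) \<le> N * (A * exp 2 / d)"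
        "\<And>j. j \<in> J \<inter> {..<n} \<Longrightarrow> f (l j) = a j"
      then have "P n f" by (simp add: P_def M_def)
      then show "\<exists>f. P n f" by blast
    qed (use l1 d A1 N in \<open>auto intro!: prod A(2)\<close>)
    then obtain f where f: "\<And>n. P n (f n)" by metis
    obtain g r where g: "g holomorphic_on \<bbbD>" "strict_mono (r :: nat \<Rightarrow> nat)"
      "\<And>x. x \<in> \<bbbD> \<Longrightarrow> ((\<lambda>n. f (r n) x) \<longlongrightarrow> g x) sequentially"
    proof (rule Montel[of \<bbbD> "range f" f])
      show "h holomorphic_on \<bbbD>" if "h \<in> range f" for h
        using that f by (auto simp: P_def)
      show "\<exists>B. \<forall>h\<in>range f. \<forall>z\<in>K. norm (h z) \<le> B" if "compact K" "K \<subseteq> \<bbbD>" for K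
        using that f by (intro exI[of _ M]) (auto simp: P_def subset_iff)
    qed auto
    have "g \<in> H_infinity"
      unfolding H_infinity_def
    proof (intro CollectI conjI g(1))
      have "norm (g z) \<le> M" if z: "z \<in> \<bbbD>" for z
        by (rule tendsto_upperbound[OF tendsto_norm[OF g(3)[OF z]]])
           (use f z in \<open>auto simp: P_def\<close>)
      then show "bounded (g ` \<bbbD>)" unfolding bounded_iff by (intro exI[of _ M]) blast
    qed
    moreover have "g (l j) = a j" if j: "j \<in> J" for j
    proof (rule LIMSEQ_unique)
      show "(\<lambda>n. f (r n) (l j)) \<longlonglongrightarrow> g (l j)" using g(3) l j by auto
      have "f (r n) (l j) = a j" if "Suc j \<le> n" for n
      proof -
        have "j < r n" using seq_suble[OF g(2), of n] that by simp
        then show ?thesis using f[of "r n"] j by (simp add: P_def)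
      qed
      then show "(\<lambda>n. f (r n) (l j)) \<longlonglongrightarrow> a j"
        by (intro tendsto_eventually eventually_sequentiallyI[of "Suc j"]) auto
    qed
    ultimately show ?thesis by blast
  qed
  then show ?thesis using l by (simp add: carleson_seq_def)
qed

text \<open>
  Carleson's interpolation theorem.
\<close>

theorem carleson_seq_iff: "carleson_seq J l \<longleftrightarrow> separated_finite_mass J l"
  using carleson_seq_imp_separated_finite_mass separated_finite_mass_imp_carleson_seq by blast

section \<open>Bi-Lipschitz circle maps\<close>

text \<open>
  Chord and arc are comparable, so bi-Lipschitz conditions may be checked with the Euclidean
  distance.
\<close>

lemma circle_dist_chord:
  assumes "\<zeta> \<in> \<bbbT>" "\<eta> \<in> \<bbbT>"
  shows "norm (\<zeta> - \<eta>) \<le> 2 * pi * circle_dist \<zeta> \<eta>" "circle_dist \<zeta> \<eta> \<le> norm (\<zeta> - \<eta>)"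
proof -
  define t where "t = Arg (\<zeta> / \<eta>)"
  have n: "norm \<zeta> = 1" "norm \<eta> = 1" using assms by auto
  then have "\<eta> \<noteq> 0" "\<zeta> / \<eta> \<noteq> 0" "norm (\<zeta> / \<eta>) = 1" by (auto simp: norm_divide)
  then have "\<zeta> / \<eta> = exp (\<i> * of_real t)"
    using Arg_eq[of "\<zeta> / \<eta>"] by (simp add: t_def)
  moreover have "norm (\<zeta> - \<eta>) = norm (\<zeta> / \<eta> - 1)"
  proof -
    have "\<zeta> / \<eta> - 1 = (\<zeta> - \<eta>) / \<eta>" using \<open>\<eta> \<noteq> 0\<close> by (simp add: diff_divide_distrib)
    then show ?thesis using n by (simp add: norm_divide)
  qed
  ultimately have chord: "norm (\<zeta> - \<eta>) = 2 * \<bar>sin (t / 2)\<bar>"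
    by (simp add: dist_exp_i_1)
  have dist: "circle_dist \<zeta> \<eta> = \<bar>t\<bar> / (2 * pi)"
    by (simp add: circle_dist_def t_def)
  have "\<bar>sin (t / 2)\<bar> \<le> \<bar>t / 2\<bar>" by (rule abs_sin_x_le_abs_x)
  then show "norm (\<zeta> - \<eta>) \<le> 2 * pi * circle_dist \<zeta> \<eta>"
    unfolding chord dist by simp
  define x where "x = \<bar>t\<bar> / 2"
  have "\<bar>t\<bar> \<le> pi" using mpi_less_Arg[of "\<zeta> / \<eta>"] Arg_le_pi[of "\<zeta> / \<eta>"] by (simp add: t_def abs_le_iff)
  then have x: "0 \<le> x" "x \<le> 2" using pi_less_4 by (auto simp: x_def)
  \<comment> \<open>The cubic Taylor bound suffices: on \<open>[0, 2]\<close> it gives \<open>sin x \<ge> x / 3\<close>.\<close>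
  have "\<bar>sin x - (\<Sum>m<3. sin_coeff m * x ^ m)\<bar> \<le> inverse (fact 3) * \<bar>x\<bar> ^ 3"
    by (rule Maclaurin_sin_bound)
  moreover have "(\<Sum>m<3. sin_coeff m * x ^ m) = x"
    by (simp add: sin_coeff_def eval_nat_numeral)
  moreover have "inverse (fact 3) * \<bar>x\<bar> ^ 3 = x ^ 3 / 6"
    using x by (simp add: fact_numeral)
  ultimately have "x - x ^ 3 / 6 \<le> sin x"
    by linarith
  moreover have "x ^ 3 \<le> 4 * x"
  proof -
    have "x * (x * x) \<le> x * (2 * 2)" using x by (intro mult_mono) auto
    then show ?thesis by (simp add: power3_eq_cube mult_ac)
  qed
  ultimately have sinx: "x \<le> 3 * sin x" by linarith
  have "\<bar>sin (t / 2)\<bar> = \<bar>sin x\<bar>"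
    by (cases "0 \<le> t") (auto simp: x_def)
  then have "\<bar>t\<bar> / 2 \<le> 3 * \<bar>sin (t / 2)\<bar>"
    using sinx by (simp add: x_def)
  then have "\<bar>t\<bar> \<le> 3 * norm (\<zeta> - \<eta>)" unfolding chord by linarith
  also have "\<dots> \<le> (2 * pi) * norm (\<zeta> - \<eta>)"
    using pi_ge_two by (intro mult_right_mono) auto
  finally show "circle_dist \<zeta> \<eta> \<le> norm (\<zeta> - \<eta>)"
    unfolding dist by (simp add: divide_le_eq mult_ac)
qed

lemma BiLip_iff:
  "h \<in> BiLip \<longleftrightarrow> h \<in> extensional \<bbbT> \<and> h ` \<bbbT> = \<bbbT> \<and>
    (\<exists>L\<ge>1. \<forall>\<zeta>\<in>\<bbbT>. \<forall>\<eta>\<in>\<bbbT>. norm (\<zeta> - \<eta>) \<le> L * norm (h \<zeta> - h \<eta>) \<and> norm (h \<zeta> - h \<eta>) \<le> L * norm (\<zeta> - \<eta>))"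
  (is "_ \<longleftrightarrow> ?R")
proof
  assume h: "h \<in> BiLip"
  then obtain g L where ext: "h \<in> extensional \<bbbT>" and g: "homeomorphism \<bbbT> \<bbbT> h g"
    and L: "1 \<le> L" "\<forall>\<zeta>\<in>\<bbbT>. \<forall>\<eta>\<in>\<bbbT>. inverse L * circle_dist \<zeta> \<eta> \<le> circle_dist (h \<zeta>) (h \<eta>) \<and>
        circle_dist (h \<zeta>) (h \<eta>) \<le> L * circle_dist \<zeta> \<eta>"
    unfolding BiLip_def by blast
  have im: "h ` \<bbbT> = \<bbbT>" using g by (simp add: homeomorphism_def)
  have "norm (\<zeta> - \<eta>) \<le> (2 * pi * L) * norm (h \<zeta> - h \<eta>) \<and> norm (h \<zeta> - h \<eta>) \<le> (2 * pi * L) * norm (\<zeta> - \<eta>)"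
    if z: "\<zeta> \<in> \<bbbT>" "\<eta> \<in> \<bbbT>" for \<zeta> \<eta>
  proof -
    have hz: "h \<zeta> \<in> \<bbbT>" "h \<eta> \<in> \<bbbT>" using im z by blast+
    have lips: "circle_dist \<zeta> \<eta> \<le> L * circle_dist (h \<zeta>) (h \<eta>)" "circle_dist (h \<zeta>) (h \<eta>) \<le> L * circle_dist \<zeta> \<eta>"
      using L z by (auto simp: field_simps)
    have "circle_dist \<zeta> \<eta> \<le> L * norm (h \<zeta> - h \<eta>)"
      using order_trans[OF lips(1) mult_left_mono[OF circle_dist_chord(2)[OF hz]]] L(1) by simp
    then have "2 * pi * circle_dist \<zeta> \<eta> \<le> 2 * pi * (L * norm (h \<zeta> - h \<eta>))"
      by (intro mult_left_mono) auto
    moreover have "circle_dist (h \<zeta>) (h \<eta>) \<le> L * norm (\<zeta> - \<eta>)"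
      using order_trans[OF lips(2) mult_left_mono[OF circle_dist_chord(2)[OF z]]] L(1) by simp
    then have "2 * pi * circle_dist (h \<zeta>) (h \<eta>) \<le> 2 * pi * (L * norm (\<zeta> - \<eta>))"
      by (intro mult_left_mono) auto
    ultimately show ?thesis
      using order_trans[OF circle_dist_chord(1)[OF z]] order_trans[OF circle_dist_chord(1)[OF hz]]
      by (simp add: mult.assoc)
  qed
  moreover have "1 * 1 \<le> 2 * pi * L" using L(1) pi_ge_two by (intro mult_mono) auto
  ultimately show ?R using ext im by (intro conjI exI[of _ "2 * pi * L"]) auto
next
  assume ?R
  then obtain L where ext: "h \<in> extensional \<bbbT>" and im: "h ` \<bbbT> = \<bbbT>" and L: "1 \<le> L"
    "\<forall>\<zeta>\<in>\<bbbT>. \<forall>\<eta>\<in>\<bbbT>. norm (\<zeta> - \<eta>) \<le> L * norm (h \<zeta> - h \<eta>) \<and> norm (h \<zeta> - h \<eta>) \<le> L * norm (\<zeta> - \<eta>)"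
    by blast
  have inj: "inj_on h \<bbbT>"
  proof (rule inj_onI)
    fix \<zeta> \<eta> assume "\<zeta> \<in> \<bbbT>" "\<eta> \<in> \<bbbT>" "h \<zeta> = h \<eta>"
    then have "norm (\<zeta> - \<eta>) \<le> L * norm (h \<eta> - h \<eta>)" using L(2) by metis
    then show "\<zeta> = \<eta>" by simp
  qed
  have "L-lipschitz_on \<bbbT> h"
    using L by (auto simp: lipschitz_on_def dist_norm)
  then have "continuous_on \<bbbT> h" by (rule lipschitz_on_continuous_on)
  then obtain g where g: "homeomorphism \<bbbT> \<bbbT> h g"
    using homeomorphism_compact[OF _ _ im inj] by auto
  have "inverse (2 * pi * L) * circle_dist \<zeta> \<eta> \<le> circle_dist (h \<zeta>) (h \<eta>) \<and>
        circle_dist (h \<zeta>) (h \<eta>) \<le> (2 * pi * L) * circle_dist \<zeta> \<eta>"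
    if z: "\<zeta> \<in> \<bbbT>" "\<eta> \<in> \<bbbT>" for \<zeta> \<eta>
  proof -
    have hz: "h \<zeta> \<in> \<bbbT>" "h \<eta> \<in> \<bbbT>" using im z by blast+
    have lips: "norm (\<zeta> - \<eta>) \<le> L * norm (h \<zeta> - h \<eta>)" "norm (h \<zeta> - h \<eta>) \<le> L * norm (\<zeta> - \<eta>)"
      using L z by auto
    have "circle_dist \<zeta> \<eta> \<le> L * norm (h \<zeta> - h \<eta>)"
      using order_trans[OF circle_dist_chord(2)[OF z] lips(1)] .
    also have "\<dots> \<le> L * (2 * pi * circle_dist (h \<zeta>) (h \<eta>))"
      using circle_dist_chord(1)[OF hz] L(1) by (intro mult_left_mono) auto
    finally have 1: "circle_dist \<zeta> \<eta> \<le> (2 * pi * L) * circle_dist (h \<zeta>) (h \<eta>)"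
      by (simp add: mult_ac)
    have "circle_dist (h \<zeta>) (h \<eta>) \<le> L * norm (\<zeta> - \<eta>)"
      using order_trans[OF circle_dist_chord(2)[OF hz] lips(2)] .
    also have "\<dots> \<le> L * (2 * pi * circle_dist \<zeta> \<eta>)"
      using circle_dist_chord(1)[OF z] L(1) by (intro mult_left_mono) auto
    finally have 2: "circle_dist (h \<zeta>) (h \<eta>) \<le> (2 * pi * L) * circle_dist \<zeta> \<eta>"
      by (simp add: mult_ac)
    have "0 < 2 * pi * L" using L(1) by simp
    moreover have "inverse M * x \<le> y" if "0 < M" "x \<le> M * y" for M x y :: real
      using that by (simp add: field_simps)
    ultimately show ?thesis using 1 2 by blast
  qed
  moreover have "1 * 1 \<le> 2 * pi * L" using L(1) pi_ge_two by (intro mult_mono) auto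
  ultimately show "h \<in> BiLip"
    unfolding BiLip_def using ext g by (intro CollectI conjI exI[of _ "2 * pi * L"] exI[of _ g]) auto
qed

lemma BiLip_chord:
  assumes "h \<in> BiLip"
  obtains L where "1 \<le> L" "\<And>\<zeta> \<eta>. \<zeta> \<in> \<bbbT> \<Longrightarrow> \<eta> \<in> \<bbbT> \<Longrightarrow> norm (\<zeta> - \<eta>) \<le> L * norm (h \<zeta> - h \<eta>)"
    "\<And>\<zeta> \<eta>. \<zeta> \<in> \<bbbT> \<Longrightarrow> \<eta> \<in> \<bbbT> \<Longrightarrow> norm (h \<zeta> - h \<eta>) \<le> L * norm (\<zeta> - \<eta>)"
  using assms unfolding BiLip_iff by blast

lemma BiLip_image: "h \<in> BiLip \<Longrightarrow> h ` \<bbbT> = \<bbbT>"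
  by (simp add: BiLip_iff)

lemma BiLip_in_circle: "h \<in> BiLip \<Longrightarrow> \<zeta> \<in> \<bbbT> \<Longrightarrow> h \<zeta> \<in> \<bbbT>"
  using BiLip_image by blast

lemma BiLip_inj: "h \<in> BiLip \<Longrightarrow> inj_on h \<bbbT>"
  by (auto simp: BiLip_def homeomorphism_def intro: inj_on_inverseI)

lemma BiLip_Bij: "h \<in> BiLip \<Longrightarrow> h \<in> Bij \<bbbT>"
  using BiLip_inj BiLip_image by (auto simp: Bij_def bij_betw_def BiLip_iff)

lemma id_BiLip: "(\<lambda>\<zeta>\<in>\<bbbT>. \<zeta>) \<in> BiLip"
  unfolding BiLip_iff by (auto intro: exI[of _ 1])

lemma compose_BiLip:
  assumes h: "h \<in> BiLip" and g: "g \<in> BiLip"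
  shows "compose \<bbbT> h g \<in> BiLip"
proof -
  obtain L where L: "1 \<le> L" "\<And>\<zeta> \<eta>. \<zeta> \<in> \<bbbT> \<Longrightarrow> \<eta> \<in> \<bbbT> \<Longrightarrow> norm (\<zeta> - \<eta>) \<le> L * norm (h \<zeta> - h \<eta>)"
    "\<And>\<zeta> \<eta>. \<zeta> \<in> \<bbbT> \<Longrightarrow> \<eta> \<in> \<bbbT> \<Longrightarrow> norm (h \<zeta> - h \<eta>) \<le> L * norm (\<zeta> - \<eta>)"
    using BiLip_chord[OF h] by blast
  obtain M where M: "1 \<le> M" "\<And>\<zeta> \<eta>. \<zeta> \<in> \<bbbT> \<Longrightarrow> \<eta> \<in> \<bbbT> \<Longrightarrow> norm (\<zeta> - \<eta>) \<le> M * norm (g \<zeta> - g \<eta>)"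
    "\<And>\<zeta> \<eta>. \<zeta> \<in> \<bbbT> \<Longrightarrow> \<eta> \<in> \<bbbT> \<Longrightarrow> norm (g \<zeta> - g \<eta>) \<le> M * norm (\<zeta> - \<eta>)"
    using BiLip_chord[OF g] by blast
  have "norm (\<zeta> - \<eta>) \<le> (M * L) * norm (h (g \<zeta>) - h (g \<eta>)) \<and> norm (h (g \<zeta>) - h (g \<eta>)) \<le> (M * L) * norm (\<zeta> - \<eta>)"
    if z: "\<zeta> \<in> \<bbbT>" "\<eta> \<in> \<bbbT>" for \<zeta> \<eta>
  proof
    note gz = BiLip_in_circle[OF g z(1)] BiLip_in_circle[OF g z(2)]
    have "norm (\<zeta> - \<eta>) \<le> M * norm (g \<zeta> - g \<eta>)" by (rule M(2)[OF z])
    also have "\<dots> \<le> M * (L * norm (h (g \<zeta>) - h (g \<eta>)))"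
      using M(1) by (intro mult_left_mono L(2)[OF gz]) auto
    finally show "norm (\<zeta> - \<eta>) \<le> (M * L) * norm (h (g \<zeta>) - h (g \<eta>))" by (simp add: mult_ac)
    have "norm (h (g \<zeta>) - h (g \<eta>)) \<le> L * norm (g \<zeta> - g \<eta>)" by (rule L(3)[OF gz])
    also have "\<dots> \<le> L * (M * norm (\<zeta> - \<eta>))"
      using L(1) by (intro mult_left_mono M(3)[OF z]) auto
    finally show "norm (h (g \<zeta>) - h (g \<eta>)) \<le> (M * L) * norm (\<zeta> - \<eta>)" by (simp add: mult_ac)
  qed
  moreover have "1 * 1 \<le> M * L" using L M by (intro mult_mono) auto
  moreover have "compose \<bbbT> h g ` \<bbbT> = \<bbbT>"
  proof -
    have "compose \<bbbT> h g ` \<bbbT> = h ` g ` \<bbbT>" by (simp add: compose_def image_image)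
    then show ?thesis by (simp only: BiLip_image[OF g] BiLip_image[OF h])
  qed
  ultimately show ?thesis
    unfolding BiLip_iff by (intro conjI exI[of _ "M * L"]) (auto simp: compose_eq)
qed

lemma circle_inv_BiLip:
  assumes h: "h \<in> BiLip"
  shows "circle_inv h \<in> BiLip"
proof -
  obtain L where L: "1 \<le> L" "\<And>\<zeta> \<eta>. \<zeta> \<in> \<bbbT> \<Longrightarrow> \<eta> \<in> \<bbbT> \<Longrightarrow> norm (\<zeta> - \<eta>) \<le> L * norm (h \<zeta> - h \<eta>)"
    "\<And>\<zeta> \<eta>. \<zeta> \<in> \<bbbT> \<Longrightarrow> \<eta> \<in> \<bbbT> \<Longrightarrow> norm (h \<zeta> - h \<eta>) \<le> L * norm (\<zeta> - \<eta>)"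
    using BiLip_chord[OF h] by blast
  have Bij: "circle_inv h \<in> Bij \<bbbT>"
    unfolding circle_inv_def by (rule restrict_inv_into_Bij[OF BiLip_Bij[OF h]])
  then have im: "circle_inv h ` \<bbbT> = \<bbbT>" by (simp add: Bij_def bij_betw_def)
  have inv: "h (circle_inv h \<zeta>) = \<zeta>" if "\<zeta> \<in> \<bbbT>" for \<zeta>
    using that BiLip_image[OF h] by (simp add: circle_inv_def f_inv_into_f)
  have "norm (\<zeta> - \<eta>) \<le> L * norm (circle_inv h \<zeta> - circle_inv h \<eta>) \<and>
      norm (circle_inv h \<zeta> - circle_inv h \<eta>) \<le> L * norm (\<zeta> - \<eta>)" if z: "\<zeta> \<in> \<bbbT>" "\<eta> \<in> \<bbbT>" for \<zeta> \<eta>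
  proof -
    have "circle_inv h \<zeta> \<in> \<bbbT>" "circle_inv h \<eta> \<in> \<bbbT>" using im z by blast+
    from L(2)[OF this] L(3)[OF this] show ?thesis unfolding inv[OF z(1)] inv[OF z(2)] by blast
  qed
  then show ?thesis
    unfolding BiLip_iff using im L(1) by (intro conjI exI[of _ L]) (auto simp: circle_inv_def)
qed

lemma compose_circle_inv:
  assumes h: "h \<in> BiLip"
  shows "compose \<bbbT> h (circle_inv h) = (\<lambda>\<zeta>\<in>\<bbbT>. \<zeta>)" "compose \<bbbT> (circle_inv h) h = (\<lambda>\<zeta>\<in>\<bbbT>. \<zeta>)"
  using BiLip_Bij[OF h] unfolding circle_inv_def
  by (auto simp: Bij_compose_restrict_eq Bij_def compose_id_inv_into bij_betw_def compose_inv_into_id)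

section \<open>The radial extension\<close>

lemma radial_ext_polar:
  assumes "\<zeta> \<in> \<bbbT>" "0 \<le> r" "r < 1"
  shows "radial_ext h (of_real r * \<zeta>) = of_real r * h \<zeta>"
  using assms by (auto simp: radial_ext_def norm_mult)

lemma polarE:
  obtains \<zeta> where "\<zeta> \<in> \<bbbT>" "z = of_real (norm z) * \<zeta>"
proof (cases "z = 0")
  case True
  then show ?thesis using that[of 1] by simp
next
  case False
  then show ?thesis using that[of "z / of_real (norm z)"] by (simp add: norm_divide)
qed

text \<open>
  In polar coordinates the angular variables enter the distance only through their chord, which is
  why a radial extension inherits the Lipschitz constant of its boundary map.
\<close>

lemma norm_polar_diff_sq:
  assumes "\<zeta> \<in> \<bbbT>" "\<eta> \<in> \<bbbT>"
  shows "(norm (of_real r * \<zeta> - of_real s * \<eta>))\<^sup>2 = (r - s)\<^sup>2 + r * s * (norm (\<zeta> - \<eta>))\<^sup>2"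
proof -
  have "(norm \<zeta>)\<^sup>2 = 1" "(norm \<eta>)\<^sup>2 = 1" using assms by auto
  then have *: "(Im \<zeta>)\<^sup>2 = 1 - (Re \<zeta>)\<^sup>2" "(Im \<eta>)\<^sup>2 = 1 - (Re \<eta>)\<^sup>2" by (auto simp: cmod_power2)
  show ?thesis
    unfolding cmod_power2 using * by (simp add: power2_diff power_mult_distrib) (simp add: algebra_simps power2_eq_square)
qed

lemma norm_radial_ext:
  assumes h: "h \<in> BiLip" and z: "norm z < 1"
  shows "norm (radial_ext h z) = norm z"
proof -
  obtain \<zeta> where \<zeta>: "\<zeta> \<in> \<bbbT>" "z = of_real (norm z) * \<zeta>" by (rule polarE)
  have "norm (h \<zeta>) = 1" using BiLip_in_circle[OF h \<zeta>(1)] by simp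
  moreover have "radial_ext h z = of_real (norm z) * h \<zeta>"
    using radial_ext_polar[OF \<zeta>(1) _ z, of h] \<zeta>(2) by simp
  ultimately show ?thesis by (simp add: norm_mult)
qed

lemma radial_ext_bilipschitz:
  assumes h: "h \<in> BiLip"
  obtains L where "1 \<le> L"
    "\<And>z w. norm z < 1 \<Longrightarrow> norm w < 1 \<Longrightarrow> norm (z - w) \<le> L * norm (radial_ext h z - radial_ext h w)"
    "\<And>z w. norm z < 1 \<Longrightarrow> norm w < 1 \<Longrightarrow> norm (radial_ext h z - radial_ext h w) \<le> L * norm (z - w)"
proof -
  obtain L where L: "1 \<le> L" "\<And>\<zeta> \<eta>. \<zeta> \<in> \<bbbT> \<Longrightarrow> \<eta> \<in> \<bbbT> \<Longrightarrow> norm (\<zeta> - \<eta>) \<le> L * norm (h \<zeta> - h \<eta>)"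
    "\<And>\<zeta> \<eta>. \<zeta> \<in> \<bbbT> \<Longrightarrow> \<eta> \<in> \<bbbT> \<Longrightarrow> norm (h \<zeta> - h \<eta>) \<le> L * norm (\<zeta> - \<eta>)"
    using BiLip_chord[OF h] by blast
  have mono: "norm (of_real r * \<zeta> - of_real s * \<eta>) \<le> L * norm (of_real r * \<zeta>' - of_real s * \<eta>')"
    if "0 \<le> r" "0 \<le> s" "\<zeta> \<in> \<bbbT>" "\<eta> \<in> \<bbbT>" "\<zeta>' \<in> \<bbbT>" "\<eta>' \<in> \<bbbT>" "norm (\<zeta> - \<eta>) \<le> L * norm (\<zeta>' - \<eta>')"
    for r s and \<zeta> \<eta> \<zeta>' \<eta>' :: complex
  proof (rule power2_le_imp_le)
    have "(norm (\<zeta> - \<eta>))\<^sup>2 \<le> (L * norm (\<zeta>' - \<eta>'))\<^sup>2" using that(7) by (intro power_mono) auto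
    then have "r * s * (norm (\<zeta> - \<eta>))\<^sup>2 \<le> r * s * (L\<^sup>2 * (norm (\<zeta>' - \<eta>'))\<^sup>2)"
      using that by (intro mult_left_mono) (auto simp: power_mult_distrib)
    moreover have "1 * (r - s)\<^sup>2 \<le> L\<^sup>2 * (r - s)\<^sup>2"
      using L(1) by (intro mult_right_mono) auto
    ultimately show "(norm (of_real r * \<zeta> - of_real s * \<eta>))\<^sup>2 \<le> (L * norm (of_real r * \<zeta>' - of_real s * \<eta>'))\<^sup>2"
      unfolding power_mult_distrib norm_polar_diff_sq[OF that(3,4)] norm_polar_diff_sq[OF that(5,6)]
      by (simp add: algebra_simps)
  qed (use L in auto)
  have "norm (z - w) \<le> L * norm (radial_ext h z - radial_ext h w) \<and>
      norm (radial_ext h z - radial_ext h w) \<le> L * norm (z - w)" if zw: "norm z < 1" "norm w < 1" for z w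
  proof -
    obtain \<zeta> where \<zeta>: "\<zeta> \<in> \<bbbT>" "z = of_real (norm z) * \<zeta>" by (rule polarE)
    obtain \<eta> where \<eta>: "\<eta> \<in> \<bbbT>" "w = of_real (norm w) * \<eta>" by (rule polarE)
    have E: "radial_ext h z = of_real (norm z) * h \<zeta>" "radial_ext h w = of_real (norm w) * h \<eta>"
      using radial_ext_polar[OF \<zeta>(1) _ zw(1), of h] radial_ext_polar[OF \<eta>(1) _ zw(2), of h] \<zeta>(2) \<eta>(2)
      by simp_all
    note hin = BiLip_in_circle[OF h \<zeta>(1)] BiLip_in_circle[OF h \<eta>(1)]
    have "norm (of_real (norm z) * \<zeta> - of_real (norm w) * \<eta>)
        \<le> L * norm (of_real (norm z) * h \<zeta> - of_real (norm w) * h \<eta>)"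
      by (rule mono[OF _ _ \<zeta>(1) \<eta>(1) hin L(2)[OF \<zeta>(1) \<eta>(1)]]) auto
    moreover have "norm (of_real (norm z) * h \<zeta> - of_real (norm w) * h \<eta>)
        \<le> L * norm (of_real (norm z) * \<zeta> - of_real (norm w) * \<eta>)"
      by (rule mono[OF _ _ hin \<zeta>(1) \<eta>(1) L(3)[OF \<zeta>(1) \<eta>(1)]]) auto
    ultimately show ?thesis
      unfolding E \<zeta>(2)[symmetric] \<eta>(2)[symmetric] by blast
  qed
  then show thesis using that[OF L(1)] by blast
qed

lemma radial_ext_compose:
  assumes g: "g \<in> BiLip"
  shows "compose \<bbbD> (radial_ext h) (radial_ext g) = radial_ext (compose \<bbbT> h g)"
proof (rule extensionalityI)
  fix z :: complex assume "z \<in> \<bbbD>"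
  then have z: "norm z < 1" by simp
  obtain \<zeta> where \<zeta>: "\<zeta> \<in> \<bbbT>" "z = of_real (norm z) * \<zeta>" by (rule polarE)
  have "radial_ext g z = of_real (norm z) * g \<zeta>" "radial_ext (compose \<bbbT> h g) z = of_real (norm z) * compose \<bbbT> h g \<zeta>"
    using radial_ext_polar[OF \<zeta>(1) _ z] \<zeta>(2) by (metis norm_ge_zero)+
  moreover have "radial_ext h (of_real (norm z) * g \<zeta>) = of_real (norm z) * h (g \<zeta>)"
    using radial_ext_polar[OF BiLip_in_circle[OF g \<zeta>(1)] _ z] by simp
  ultimately show "compose \<bbbD> (radial_ext h) (radial_ext g) z = radial_ext (compose \<bbbT> h g) z"
    using \<open>z \<in> \<bbbD>\<close> \<zeta>(1) by (simp add: compose_eq)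
qed (auto simp: radial_ext_def)

lemma radial_ext_id: "radial_ext (\<lambda>\<zeta>\<in>\<bbbT>. \<zeta>) = (\<lambda>z\<in>\<bbbD>. z)"
  by (auto simp: radial_ext_def fun_eq_iff norm_divide)

lemma radial_ext_inverse:
  assumes h: "h \<in> BiLip" and z: "z \<in> \<bbbD>"
  shows "radial_ext h (radial_ext (circle_inv h) z) = z" "radial_ext (circle_inv h) (radial_ext h z) = z"
  using fun_cong[OF radial_ext_compose[OF circle_inv_BiLip[OF h], of h], of z]
    fun_cong[OF radial_ext_compose[OF h, of "circle_inv h"], of z]
    compose_circle_inv[OF h] z
  by (simp_all add: compose_eq radial_ext_id)

section \<open>Radial extensions preserve Carleson sequences\<close>

text \<open>
  When moduli are preserved, \<open>\<rho>\<^sup>2 = X / (X + P)\<close> with \<open>X = |z - w|\<^sup>2\<close> and the same \<open>P\<close> for both pairs of points.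
\<close>

lemma rho_expansion:
  assumes zw: "norm z < 1" "norm w < 1" and n: "norm z' = norm z" "norm w' = norm w"
    and L: "1 \<le> L" "norm (z - w) \<le> L * norm (z' - w')"
  shows "rho z w \<le> L * rho z' w'" "1 - (rho z' w')\<^sup>2 \<le> L\<^sup>2 * (1 - (rho z w)\<^sup>2)"
proof -
  define P where "P = (1 - (norm z)\<^sup>2) * (1 - (norm w)\<^sup>2)"
  define X where "X = (norm (z - w))\<^sup>2"
  define X' where "X' = (norm (z' - w'))\<^sup>2"
  have P: "0 < P" unfolding P_def using zw by (intro mult_pos_pos one_minus_norm_sq_pos)
  have X: "0 \<le> X" "0 \<le> X'" by (auto simp: X_def X'_def)
  have XL: "X \<le> L\<^sup>2 * X'"
    using power_mono[OF L(2), of 2] by (simp add: X_def X'_def power_mult_distrib)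
  have PL: "P \<le> L\<^sup>2 * P" using P L(1) mult_right_mono[of 1 "L\<^sup>2" P] by simp
  have r: "(rho z w)\<^sup>2 = X / (X + P)" "(rho z' w')\<^sup>2 = X' / (X' + P)"
    using norm_1_minus_cnj_mult[of z w] norm_1_minus_cnj_mult[of z' w']
    by (simp_all add: rho_def norm_divide power_divide X_def X'_def P_def n)
  have le: "X + P \<le> L\<^sup>2 * (X' + P)" using XL PL by (simp add: distrib_left)
  have "1 - (rho z' w')\<^sup>2 = P / (X' + P)" "1 - (rho z w)\<^sup>2 = P / (X + P)"
    unfolding r using P X by (simp_all add: field_simps)
  moreover have "P / (X' + P) \<le> L\<^sup>2 * (P / (X + P))"
  proof -
    have "P / (X' + P) = (L\<^sup>2 * P) / (L\<^sup>2 * (X' + P))" using L(1) by simp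
    also have "\<dots> \<le> (L\<^sup>2 * P) / (X + P)" using le P X by (intro divide_left_mono) auto
    finally show ?thesis by simp
  qed
  ultimately show "1 - (rho z' w')\<^sup>2 \<le> L\<^sup>2 * (1 - (rho z w)\<^sup>2)" by simp
  show "rho z w \<le> L * rho z' w'"
  proof (rule power2_le_imp_le)
    have "X * P \<le> L\<^sup>2 * X' * P" "X * X' \<le> L\<^sup>2 * (X * X')"
      using XL P X L(1) mult_right_mono[of 1 "L\<^sup>2" "X * X'"] by (auto intro: mult_right_mono)
    then have "X * (X' + P) \<le> (L\<^sup>2 * X') * (X + P)" by (simp add: algebra_simps)
    then have "X / (X + P) \<le> (L\<^sup>2 * X') / (X' + P)"
      using P X by (simp add: frac_le_eq divide_le_0_iff frac_le_eq field_simps)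
    then show "(rho z w)\<^sup>2 \<le> (L * rho z' w')\<^sup>2" by (simp add: power_mult_distrib r)
  qed (use L in auto)
qed

text \<open>
  Up to the factors \<open>L\<close> and \<open>L\<^sup>2\<close> such a map increases \<open>\<rho>\<close> and decreases \<open>1 - \<rho>\<^sup>2\<close>, so both conditions
  of \<open>carleson_seq_iff\<close> carry over to the image.
\<close>

lemma carleson_seq_norm_preserving_expansion:
  assumes \<Phi>: "\<And>z. norm z < 1 \<Longrightarrow> norm (\<Phi> z) = norm z" and L: "1 \<le> L"
    "\<And>z w. norm z < 1 \<Longrightarrow> norm w < 1 \<Longrightarrow> norm (z - w) \<le> L * norm (\<Phi> z - \<Phi> w)"
    and C: "carleson_seq J l"
  shows "carleson_seq J (\<lambda>j. \<Phi> (l j))"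
proof -
  obtain s A where l: "l ` J \<subseteq> \<bbbD>"
    and s: "0 < s" "\<forall>j\<in>J. \<forall>k\<in>J. j \<noteq> k \<longrightarrow> s \<le> rho (l j) (l k)"
    and A: "\<forall>k\<in>J. \<forall>F. finite F \<longrightarrow> F \<subseteq> J \<longrightarrow> (\<Sum>j\<in>F. 1 - (rho (l j) (l k))\<^sup>2) \<le> A"
    using C unfolding carleson_seq_iff separated_finite_mass_def by (elim conjE exE)
  have l1: "norm (l j) < 1" if "j \<in> J" for j using l that by auto
  have R: "rho (l j) (l k) \<le> L * rho (\<Phi> (l j)) (\<Phi> (l k))"
    "1 - (rho (\<Phi> (l j)) (\<Phi> (l k)))\<^sup>2 \<le> L\<^sup>2 * (1 - (rho (l j) (l k))\<^sup>2)" if "j \<in> J" "k \<in> J" for j k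
    using rho_expansion[OF l1[OF that(1)] l1[OF that(2)] \<Phi>[OF l1[OF that(1)]] \<Phi>[OF l1[OF that(2)]] L(1)
        L(2)[OF l1[OF that(1)] l1[OF that(2)]]] by blast+
  have "s / L \<le> rho (\<Phi> (l j)) (\<Phi> (l k))" if "j \<in> J" "k \<in> J" "j \<noteq> k" for j k
    using order_trans[OF s(2)[rule_format, OF that] R(1)[OF that(1,2)]] L(1) by (simp add: divide_le_eq mult_ac)
  moreover have "(\<Sum>j\<in>F. 1 - (rho (\<Phi> (l j)) (\<Phi> (l k)))\<^sup>2) \<le> L\<^sup>2 * A" if "k \<in> J" "finite F" "F \<subseteq> J" for k F
  proof -
    have "(\<Sum>j\<in>F. 1 - (rho (\<Phi> (l j)) (\<Phi> (l k)))\<^sup>2) \<le> (\<Sum>j\<in>F. L\<^sup>2 * (1 - (rho (l j) (l k))\<^sup>2))"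
      using that by (intro sum_mono R(2)) auto
    also have "\<dots> = L\<^sup>2 * (\<Sum>j\<in>F. 1 - (rho (l j) (l k))\<^sup>2)" by (simp only: sum_distrib_left)
    also have "\<dots> \<le> L\<^sup>2 * A" using A that by (intro mult_left_mono) auto
    finally show ?thesis .
  qed
  moreover have "0 < s / L" using s L by simp
  moreover have "(\<lambda>j. \<Phi> (l j)) ` J \<subseteq> \<bbbD>" using \<Phi> l1 by auto
  ultimately show ?thesis
    unfolding carleson_seq_iff separated_finite_mass_def by blast
qed

lemma carleson_seq_cong:
  "(\<And>j. j \<in> J \<Longrightarrow> l j = l' j) \<Longrightarrow> carleson_seq J l \<longleftrightarrow> carleson_seq J l'"
  unfolding carleson_seq_def by (simp cong: image_cong)

lemma radial_ext_carleson:
  assumes h: "h \<in> BiLip" and C: "carleson_seq J l"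
  shows "carleson_seq J (\<lambda>j. radial_ext h (l j))"
proof -
  obtain L where L: "1 \<le> L"
    "\<And>z w. norm z < 1 \<Longrightarrow> norm w < 1 \<Longrightarrow> norm (z - w) \<le> L * norm (radial_ext h z - radial_ext h w)"
    by (rule radial_ext_bilipschitz[OF h]) (rule that)
  show ?thesis
    by (rule carleson_seq_norm_preserving_expansion[OF norm_radial_ext[OF h] L C])
qed

lemma radial_ext_P_c:
  assumes h: "h \<in> BiLip"
  shows "radial_ext h \<in> P_c"
proof -
  obtain L where L: "1 \<le> L"
    "\<And>z w. norm z < 1 \<Longrightarrow> norm w < 1 \<Longrightarrow> norm (radial_ext h z - radial_ext h w) \<le> L * norm (z - w)"
    by (rule radial_ext_bilipschitz[OF h]) (rule that)
  have "L-lipschitz_on \<bbbD> (radial_ext h)"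
    using L by (auto simp: lipschitz_on_def dist_norm)
  then have cont: "continuous_on \<bbbD> (radial_ext h)" by (rule lipschitz_on_continuous_on)
  have "carleson_seq J l" if "l ` J \<subseteq> \<bbbD>" "carleson_seq J (\<lambda>j. radial_ext h (l j))" for J l
  proof -
    have "carleson_seq J (\<lambda>j. radial_ext (circle_inv h) (radial_ext h (l j)))"
      by (rule radial_ext_carleson[OF circle_inv_BiLip[OF h] that(2)])
    moreover have "radial_ext (circle_inv h) (radial_ext h (l j)) = l j" if "j \<in> J" for j
      using radial_ext_inverse(2)[OF h] \<open>l ` J \<subseteq> \<bbbD>\<close> that by blast
    ultimately show ?thesis using carleson_seq_cong by (metis (no_types, lifting))
  qed
  moreover have "radial_ext h \<in> \<bbbD> \<rightarrow>\<^sub>E \<bbbD>"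
    using norm_radial_ext[OF h] by (auto simp: PiE_iff) (simp add: radial_ext_def)
  ultimately have "radial_ext h \<in> carleson_maps"
    unfolding carleson_maps_def using cont radial_ext_carleson[OF h] by blast
  then show ?thesis
    unfolding P_c_def using norm_radial_ext[OF h] by (auto intro!: exI[of _ 1])
qed

section \<open>Carleson-preserving maps of the disc\<close>

lemma carleson_maps_maps: "\<Phi> \<in> carleson_maps \<Longrightarrow> norm z < 1 \<Longrightarrow> norm (\<Phi> z) < 1"
  unfolding carleson_maps_def by (auto simp: PiE_iff)

lemma carleson_maps_iff:
  "\<Phi> \<in> carleson_maps \<Longrightarrow> l ` J \<subseteq> \<bbbD> \<Longrightarrow> carleson_seq J l \<longleftrightarrow> carleson_seq J (\<lambda>j. \<Phi> (l j))"
  unfolding carleson_maps_def by blast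

lemma carleson_maps_continuous: "\<Phi> \<in> carleson_maps \<Longrightarrow> continuous_on \<bbbD> \<Phi>"
  unfolding carleson_maps_def by blast

lemma P_c_carleson: "\<Phi> \<in> P_c \<Longrightarrow> \<Phi> \<in> carleson_maps"
  unfolding P_c_def by blast

lemma P_c_heights:
  assumes "\<Phi> \<in> P_c"
  obtains c C :: real where "0 < c" "c \<le> C"
    "\<And>z. norm z < 1 \<Longrightarrow> c * (1 - (norm z)\<^sup>2) \<le> 1 - (norm (\<Phi> z))\<^sup>2"
    "\<And>z. norm z < 1 \<Longrightarrow> 1 - (norm (\<Phi> z))\<^sup>2 \<le> C * (1 - (norm z)\<^sup>2)"
proof -
  obtain c C :: real where "0 < c" "c \<le> C"
    "\<forall>z\<in>\<bbbD>. c * (1 - (norm z)\<^sup>2) \<le> 1 - (norm (\<Phi> z))\<^sup>2 \<and> 1 - (norm (\<Phi> z))\<^sup>2 \<le> C * (1 - (norm z)\<^sup>2)"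
    using assms unfolding P_c_def by blast
  then show thesis by (intro that[of c C]) auto
qed

lemma P_c_extensional: "\<Phi> \<in> P_c \<Longrightarrow> \<Phi> \<in> extensional \<bbbD>"
  unfolding P_c_def carleson_maps_def by (auto simp: PiE_iff)

lemma P_c_in_disc: "\<Phi> \<in> P_c \<Longrightarrow> z \<in> \<bbbD> \<Longrightarrow> \<Phi> z \<in> \<bbbD>"
  using carleson_maps_maps[OF P_c_carleson] by simp

text \<open>
  With two-point sequences, a map that preserves Carleson sequences is seen to be injective.
\<close>

lemma carleson_seq_pair:
  assumes "z \<in> \<bbbD>" "w \<in> \<bbbD>" "z \<noteq> w"
  shows "carleson_seq {0, 1} (\<lambda>j. if j = 0 then z else w)"
proof -
  let ?l = "\<lambda>j::nat. if j = 0 then z else w"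
  have zw: "norm z < 1" "norm w < 1" using assms by auto
  have "0 < rho z w" using rho_eq_0_iff[OF zw] assms(3) rho_nonneg[of z w] by linarith
  moreover have "\<forall>j\<in>{0,1}. \<forall>k\<in>{0,1}. j \<noteq> k \<longrightarrow> rho z w \<le> rho (?l j) (?l k)"
    by (auto simp: rho_commute)
  moreover have "(\<Sum>j\<in>F. 1 - (rho (?l j) (?l k))\<^sup>2) \<le> 2" if "finite F" "F \<subseteq> {0, 1}" for F k
  proof -
    have "(\<Sum>j\<in>F. 1 - (rho (?l j) (?l k))\<^sup>2) \<le> (\<Sum>j\<in>F. 1)" by (rule sum_mono) simp
    also have "\<dots> \<le> real (card {0::nat, 1})" using card_mono[OF _ that(2)] by simp
    finally show ?thesis by simp
  qed
  ultimately show ?thesis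
    unfolding carleson_seq_iff separated_finite_mass_def using assms(1,2)
    by (intro conjI exI[of _ "rho z w"] exI[of _ 2]) auto
qed

lemma carleson_maps_inj:
  assumes \<Phi>: "\<Phi> \<in> carleson_maps"
  shows "inj_on \<Phi> \<bbbD>"
proof (rule inj_onI, rule ccontr)
  fix z w assume zw: "z \<in> \<bbbD>" "w \<in> \<bbbD>" "\<Phi> z = \<Phi> w" "z \<noteq> w"
  let ?l = "\<lambda>j::nat. if j = 0 then z else w"
  have "carleson_seq {0, 1} (\<lambda>j. \<Phi> (?l j))"
    using carleson_seq_pair[OF zw(1,2,4)] carleson_maps_iff[OF \<Phi>, of ?l "{0, 1}"] zw(1,2) by auto
  from carleson_seq_inj_on[OF this] zw(3) show False by (auto simp: inj_on_def)
qed

text \<open>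
  The image is open by invariance of domain.  Inside a ball \<open>ball 0 r\<close> it coincides with the image
  of a compact set, as \<open>\<Phi>\<close> sends points near the circle to points near the circle; so it is also closed
  there, and connectedness shows that it fills the ball.
\<close>

lemma P_c_surj:
  assumes \<Phi>: "\<Phi> \<in> P_c"
  shows "\<Phi> ` \<bbbD> = \<bbbD>"
proof (rule antisym)
  show "\<Phi> ` \<bbbD> \<subseteq> \<bbbD>" using P_c_in_disc[OF \<Phi>] by blast
  obtain c C :: real where cC: "0 < c" "c \<le> C"
    "\<And>z. norm z < 1 \<Longrightarrow> 1 - (norm (\<Phi> z))\<^sup>2 \<le> C * (1 - (norm z)\<^sup>2)"
    by (rule P_c_heights[OF \<Phi>]) (rule that)
  have cont: "continuous_on \<bbbD> \<Phi>" by (rule carleson_maps_continuous[OF P_c_carleson[OF \<Phi>]])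
  have op: "open (\<Phi> ` \<bbbD>)"
    by (rule invariance_of_domain[OF cont open_ball carleson_maps_inj[OF P_c_carleson[OF \<Phi>]]])
  show "\<bbbD> \<subseteq> \<Phi> ` \<bbbD>"
  proof
    fix y assume "y \<in> \<bbbD>"
    moreover have "norm (\<Phi> 0) < 1" using P_c_in_disc[OF \<Phi>, of 0] by simp
    ultimately obtain r where r: "norm y < r" "norm (\<Phi> 0) < r" "r < 1"
      using dense[of "max (norm y) (norm (\<Phi> 0))" 1] by auto
    \<comment> \<open>All points mapped into \<open>ball 0 r\<close> lie in the following compact set.\<close>
    define K where "K = {z::complex. (norm z)\<^sup>2 \<le> 1 - (1 - r\<^sup>2) / C}"
    have r0: "0 \<le> r" using r(1) norm_ge_zero[of y] by linarith
    then have r2: "r\<^sup>2 < 1" using r(3) by (simp add: abs_square_less_1)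
    have KD: "K \<subseteq> \<bbbD>"
    proof
      fix z assume "z \<in> K"
      moreover have "0 < (1 - r\<^sup>2) / C" using r2 cC by simp
      ultimately have "(norm z)\<^sup>2 < 1" by (simp add: K_def)
      then show "z \<in> \<bbbD>" using abs_square_less_1[of "norm z"] by simp
    qed
    have "closed K" unfolding K_def by (intro closed_Collect_le continuous_intros)
    then have K: "compact K" using KD bounded_subset[OF bounded_ball KD] by (simp add: compact_eq_bounded_closed)
    then have "compact (\<Phi> ` K)" using cont KD by (intro compact_continuous_image) (auto intro: continuous_on_subset)
    then have clos: "closed (\<Phi> ` K)" by (rule compact_imp_closed)
    have in_K: "z \<in> K" if z: "norm z < 1" "norm (\<Phi> z) < r" for z
    proof -
      have "(norm (\<Phi> z))\<^sup>2 \<le> r\<^sup>2" using z by (intro power_mono) auto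
      then have "1 - r\<^sup>2 \<le> C * (1 - (norm z)\<^sup>2)" using cC(3)[OF z(1)] by linarith
      then have "(1 - r\<^sup>2) / C \<le> 1 - (norm z)\<^sup>2" using cC by (simp add: divide_le_eq mult.commute)
      then show ?thesis by (simp add: K_def)
    qed
    have eq: "\<Phi> ` \<bbbD> \<inter> ball 0 r = \<Phi> ` K \<inter> ball 0 r"
      using in_K KD by auto
    have "openin (top_of_set (ball 0 r)) (\<Phi> ` \<bbbD> \<inter> ball 0 r)"
      using op by (metis Int_commute openin_open_Int)
    moreover have "closedin (top_of_set (ball 0 r)) (\<Phi> ` \<bbbD> \<inter> ball 0 r)"
      unfolding eq using clos by (metis Int_commute closedin_closed_Int)
    moreover have "connected (ball (0::complex) r)" by (intro convex_connected convex_ball)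
    moreover have "\<Phi> ` \<bbbD> \<inter> ball 0 r \<noteq> {}"
    proof -
      have "\<Phi> 0 \<in> \<Phi> ` \<bbbD> \<inter> ball 0 r" using r(2) by simp
      then show ?thesis by blast
    qed
    ultimately have "\<Phi> ` \<bbbD> \<inter> ball 0 r = ball 0 r" unfolding connected_clopen by blast
    then show "y \<in> \<Phi> ` \<bbbD>" using r(1) by auto
  qed
qed

lemma P_c_Bij: "\<Phi> \<in> P_c \<Longrightarrow> \<Phi> \<in> Bij \<bbbD>"
  using P_c_surj P_c_extensional carleson_maps_inj[OF P_c_carleson] by (auto simp: Bij_def bij_betw_def)

definition disc_inv :: "(complex \<Rightarrow> complex) \<Rightarrow> complex \<Rightarrow> complex"
  where "disc_inv \<Phi> = restrict (inv_into \<bbbD> \<Phi>) \<bbbD>"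

lemma disc_inv_Bij: "\<Phi> \<in> P_c \<Longrightarrow> disc_inv \<Phi> \<in> Bij \<bbbD>"
  unfolding disc_inv_def by (rule restrict_inv_into_Bij[OF P_c_Bij])

lemma disc_inv_in_disc: "\<Phi> \<in> P_c \<Longrightarrow> z \<in> \<bbbD> \<Longrightarrow> disc_inv \<Phi> z \<in> \<bbbD>"
  using Bij_imp_funcset[OF disc_inv_Bij] by blast

lemma disc_inv_right: "\<Phi> \<in> P_c \<Longrightarrow> z \<in> \<bbbD> \<Longrightarrow> \<Phi> (disc_inv \<Phi> z) = z"
  using P_c_surj[of \<Phi>] unfolding disc_inv_def by (simp add: f_inv_into_f)

lemma disc_inv_left: "\<Phi> \<in> P_c \<Longrightarrow> z \<in> \<bbbD> \<Longrightarrow> disc_inv \<Phi> (\<Phi> z) = z"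
  using P_c_in_disc[of \<Phi> z] carleson_maps_inj[OF P_c_carleson] unfolding disc_inv_def by simp

lemma P_cI:
  assumes "\<Phi> \<in> extensional \<bbbD>" "\<And>z. z \<in> \<bbbD> \<Longrightarrow> \<Phi> z \<in> \<bbbD>" "continuous_on \<bbbD> \<Phi>"
    and "\<And>J l. l ` J \<subseteq> \<bbbD> \<Longrightarrow> carleson_seq J l \<longleftrightarrow> carleson_seq J (\<lambda>j. \<Phi> (l j))"
    and "0 < c" "c \<le> C"
    and "\<And>z. norm z < 1 \<Longrightarrow> c * (1 - (norm z)\<^sup>2) \<le> 1 - (norm (\<Phi> z))\<^sup>2 \<and> 1 - (norm (\<Phi> z))\<^sup>2 \<le> C * (1 - (norm z)\<^sup>2)"
  shows "\<Phi> \<in> P_c"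
proof -
  have "\<Phi> \<in> \<bbbD> \<rightarrow>\<^sub>E \<bbbD>" using assms(1,2) by (simp add: PiE_iff)
  then have "\<Phi> \<in> carleson_maps" unfolding carleson_maps_def using assms(3,4) by blast
  moreover have "\<forall>z\<in>\<bbbD>. c * (1 - (norm z)\<^sup>2) \<le> 1 - (norm (\<Phi> z))\<^sup>2 \<and> 1 - (norm (\<Phi> z))\<^sup>2 \<le> C * (1 - (norm z)\<^sup>2)"
    using assms(7) by simp
  ultimately show ?thesis unfolding P_c_def using assms(5,6) by blast
qed

lemma disc_inv_P_c:
  assumes \<Phi>: "\<Phi> \<in> P_c"
  shows "disc_inv \<Phi> \<in> P_c"
proof -
  obtain c C :: real where cC: "0 < c" "c \<le> C"
    "\<And>z. norm z < 1 \<Longrightarrow> c * (1 - (norm z)\<^sup>2) \<le> 1 - (norm (\<Phi> z))\<^sup>2"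
    "\<And>z. norm z < 1 \<Longrightarrow> 1 - (norm (\<Phi> z))\<^sup>2 \<le> C * (1 - (norm z)\<^sup>2)"
    by (rule P_c_heights[OF \<Phi>]) (rule that)
  show ?thesis
  proof (rule P_cI[of _ "1 / C" "1 / c"])
    show "disc_inv \<Phi> \<in> extensional \<bbbD>" by (simp add: disc_inv_def)
    have "continuous_on (\<Phi> ` \<bbbD>) (disc_inv \<Phi>)"
      by (rule continuous_on_inverse_open[OF open_ball carleson_maps_continuous[OF P_c_carleson[OF \<Phi>]]])
         (use disc_inv_left[OF \<Phi>] in auto)
    then show "continuous_on \<bbbD> (disc_inv \<Phi>)" by (simp only: P_c_surj[OF \<Phi>])
    show "disc_inv \<Phi> z \<in> \<bbbD>" if "z \<in> \<bbbD>" for z by (rule disc_inv_in_disc[OF \<Phi> that])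
    show "carleson_seq J l \<longleftrightarrow> carleson_seq J (\<lambda>j. disc_inv \<Phi> (l j))" if l: "l ` J \<subseteq> \<bbbD>" for J l
    proof -
      have "(\<lambda>j. disc_inv \<Phi> (l j)) ` J \<subseteq> \<bbbD>" using l disc_inv_in_disc[OF \<Phi>] by blast
      from carleson_maps_iff[OF P_c_carleson[OF \<Phi>] this]
      have "carleson_seq J (\<lambda>j. disc_inv \<Phi> (l j)) \<longleftrightarrow> carleson_seq J (\<lambda>j. \<Phi> (disc_inv \<Phi> (l j)))" .
      also have "\<dots> \<longleftrightarrow> carleson_seq J l"
        using l disc_inv_right[OF \<Phi>] by (intro carleson_seq_cong) blast
      finally show ?thesis by simp
    qed
    show "0 < 1 / C" "1 / C \<le> 1 / c" using cC by (auto intro: divide_left_mono)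
    fix z :: complex assume "norm z < 1"
    then have z: "z \<in> \<bbbD>" by simp
    then have "norm (disc_inv \<Phi> z) < 1" using disc_inv_in_disc[OF \<Phi>] by simp
    from cC(3)[OF this] cC(4)[OF this]
    have "c * (1 - (norm (disc_inv \<Phi> z))\<^sup>2) \<le> 1 - (norm z)\<^sup>2" "1 - (norm z)\<^sup>2 \<le> C * (1 - (norm (disc_inv \<Phi> z))\<^sup>2)"
      by (simp_all only: disc_inv_right[OF \<Phi> z])
    then show "1 / C * (1 - (norm z)\<^sup>2) \<le> 1 - (norm (disc_inv \<Phi> z))\<^sup>2 \<and>
        1 - (norm (disc_inv \<Phi> z))\<^sup>2 \<le> 1 / c * (1 - (norm z)\<^sup>2)"
      using cC by (simp add: divide_le_eq le_divide_eq mult.commute)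
  qed
qed

lemma compose_P_c:
  assumes \<Phi>: "\<Phi> \<in> P_c" and \<Psi>: "\<Psi> \<in> P_c"
  shows "compose \<bbbD> \<Phi> \<Psi> \<in> P_c"
proof -
  obtain c C :: real where cC: "0 < c" "c \<le> C"
    "\<And>z. norm z < 1 \<Longrightarrow> c * (1 - (norm z)\<^sup>2) \<le> 1 - (norm (\<Phi> z))\<^sup>2"
    "\<And>z. norm z < 1 \<Longrightarrow> 1 - (norm (\<Phi> z))\<^sup>2 \<le> C * (1 - (norm z)\<^sup>2)"
    by (rule P_c_heights[OF \<Phi>]) (rule that)
  obtain b B :: real where bB: "0 < b" "b \<le> B"
    "\<And>z. norm z < 1 \<Longrightarrow> b * (1 - (norm z)\<^sup>2) \<le> 1 - (norm (\<Psi> z))\<^sup>2"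
    "\<And>z. norm z < 1 \<Longrightarrow> 1 - (norm (\<Psi> z))\<^sup>2 \<le> B * (1 - (norm z)\<^sup>2)"
    by (rule P_c_heights[OF \<Psi>]) (rule that)
  show ?thesis
  proof (rule P_cI[of _ "c * b" "C * B"])
    show "compose \<bbbD> \<Phi> \<Psi> \<in> extensional \<bbbD>" by simp
    show "compose \<bbbD> \<Phi> \<Psi> z \<in> \<bbbD>" if "z \<in> \<bbbD>" for z
      using P_c_in_disc[OF \<Phi> P_c_in_disc[OF \<Psi> that]] that by (simp add: compose_eq)
    have "continuous_on \<bbbD> (\<lambda>z. \<Phi> (\<Psi> z))"
      using carleson_maps_continuous[OF P_c_carleson] P_c_in_disc[OF \<Psi>] \<Phi> \<Psi>
      by (intro continuous_on_compose2[of \<bbbD> \<Phi> \<bbbD> \<Psi>]) auto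
    then show "continuous_on \<bbbD> (compose \<bbbD> \<Phi> \<Psi>)"
      by (rule continuous_on_eq) (simp add: compose_eq)
    show "carleson_seq J l \<longleftrightarrow> carleson_seq J (\<lambda>j. compose \<bbbD> \<Phi> \<Psi> (l j))" if l: "l ` J \<subseteq> \<bbbD>" for J l
    proof -
      have \<Psi>l: "(\<lambda>j. \<Psi> (l j)) ` J \<subseteq> \<bbbD>" using l P_c_in_disc[OF \<Psi>] by blast
      have "carleson_seq J l \<longleftrightarrow> carleson_seq J (\<lambda>j. \<Phi> (\<Psi> (l j)))"
        using carleson_maps_iff[OF P_c_carleson[OF \<Psi>] l] carleson_maps_iff[OF P_c_carleson[OF \<Phi>] \<Psi>l] by simp
      also have "\<dots> \<longleftrightarrow> carleson_seq J (\<lambda>j. compose \<bbbD> \<Phi> \<Psi> (l j))"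
      proof (rule carleson_seq_cong)
        fix j assume "j \<in> J"
        then have "l j \<in> \<bbbD>" using l by blast
        then show "\<Phi> (\<Psi> (l j)) = compose \<bbbD> \<Phi> \<Psi> (l j)" by (simp only: compose_eq)
      qed
      finally show ?thesis .
    qed
    show "0 < c * b" "c * b \<le> C * B" using cC bB by (auto intro: mult_mono)
    fix z :: complex assume z: "norm z < 1"
    then have \<Psi>z: "norm (\<Psi> z) < 1" using P_c_in_disc[OF \<Psi>] by simp
    have "c * (b * (1 - (norm z)\<^sup>2)) \<le> c * (1 - (norm (\<Psi> z))\<^sup>2)"
      using cC(1) bB(3)[OF z] by (intro mult_left_mono) auto
    moreover have "C * (1 - (norm (\<Psi> z))\<^sup>2) \<le> C * (B * (1 - (norm z)\<^sup>2))"
      using cC(1,2) bB(4)[OF z] by (intro mult_left_mono) auto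
    moreover have "compose \<bbbD> \<Phi> \<Psi> z = \<Phi> (\<Psi> z)" using z by (simp add: compose_eq)
    ultimately show "c * b * (1 - (norm z)\<^sup>2) \<le> 1 - (norm (compose \<bbbD> \<Phi> \<Psi> z))\<^sup>2 \<and>
        1 - (norm (compose \<bbbD> \<Phi> \<Psi> z))\<^sup>2 \<le> C * B * (1 - (norm z)\<^sup>2)"
      using cC(3)[OF \<Psi>z] cC(4)[OF \<Psi>z] by (simp only: mult.assoc) linarith
  qed
qed

lemma id_P_c: "(\<lambda>z\<in>\<bbbD>. z) \<in> P_c"
  using radial_ext_P_c[OF id_BiLip] by (simp add: radial_ext_id)

section \<open>Uniform continuity in the pseudohyperbolic distance\<close>

lemma tendsto_rho:
  assumes "f \<longlonglongrightarrow> a" "g \<longlonglongrightarrow> b" "norm a < 1" "norm b < 1"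
  shows "(\<lambda>n. rho (f n) (g n)) \<longlonglongrightarrow> rho a b"
  unfolding rho_def using cnj_mult_neq_1[OF assms(3,4)] assms(1,2) by (intro tendsto_intros)

lemma norm_diff_le_rho:
  assumes "norm z < 1" "norm w < 1"
  shows "norm (z - w) \<le> 2 * rho z w"
proof -
  have "norm (1 - cnj z * w) \<le> 1 + norm (cnj z * w)" using norm_triangle_ineq4[of 1 "cnj z * w"] by simp
  also have "norm (cnj z * w) \<le> 1" using assms by (simp add: norm_mult mult_le_one)
  finally have "norm (1 - cnj z * w) \<le> 2" by simp
  then have "rho z w * norm (1 - cnj z * w) \<le> rho z w * 2" by (intro mult_left_mono) auto
  moreover have "norm (z - w) = rho z w * norm (1 - cnj z * w)"
    using cnj_mult_neq_1[OF assms] by (simp add: rho_def norm_divide)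
  ultimately show ?thesis by simp
qed

text \<open>
  By compactness, uniform continuity can fail only near the circle.
\<close>

lemma bad_pairs_escape:
  assumes \<Phi>: "continuous_on \<bbbD> \<Phi>" "\<And>z. z \<in> \<bbbD> \<Longrightarrow> \<Phi> z \<in> \<bbbD>" and e: "0 < e"
    and bad: "\<And>d. 0 < d \<Longrightarrow> \<exists>z w. norm z < 1 \<and> norm w < 1 \<and> rho z w < d \<and> e \<le> rho (\<Phi> z) (\<Phi> w)"
    and d: "0 < d" "0 < t"
  shows "\<exists>z w. norm z < 1 \<and> norm w < 1 \<and> rho z w < d \<and> e \<le> rho (\<Phi> z) (\<Phi> w) \<and> 1 - (norm z)\<^sup>2 \<le> t"
proof (rule ccontr)
  assume neg: "\<not> ?thesis"
  have "\<exists>p. norm (fst p) < 1 \<and> norm (snd p) < 1 \<and> rho (fst p) (snd p) < min d (1 / real (Suc n)) \<and>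
      e \<le> rho (\<Phi> (fst p)) (\<Phi> (snd p))" for n
    using bad[of "min d (1 / real (Suc n))"] d by auto
  then obtain p where p: "\<And>n. norm (fst (p n)) < 1" "\<And>n. norm (snd (p n)) < 1"
    "\<And>n. rho (fst (p n)) (snd (p n)) < min d (1 / real (Suc n))"
    "\<And>n. e \<le> rho (\<Phi> (fst (p n))) (\<Phi> (snd (p n)))"
    by metis
  define z where "z = (\<lambda>n. fst (p n))"
  define w where "w = (\<lambda>n. snd (p n))"
  have zw: "norm (z n) < 1" "norm (w n) < 1" "rho (z n) (w n) < d" "rho (z n) (w n) < 1 / real (Suc n)"
    "e \<le> rho (\<Phi> (z n)) (\<Phi> (w n))" for n
    using p[of n] by (auto simp: z_def w_def)
  define K where "K = {u::complex. (norm u)\<^sup>2 \<le> 1 - t}"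
  have zK: "z n \<in> K" for n
    using neg zw(1,2,3,5)[of n] unfolding K_def by force
  have KD: "K \<subseteq> \<bbbD>"
  proof
    fix u assume "u \<in> K"
    then have "(norm u)\<^sup>2 < 1" using d(2) by (simp add: K_def)
    then show "u \<in> \<bbbD>" using abs_square_less_1[of "norm u"] by simp
  qed
  have "closed K" unfolding K_def by (intro closed_Collect_le continuous_intros)
  then have "compact K" using KD bounded_subset[OF bounded_ball KD] by (simp add: compact_eq_bounded_closed)
  then obtain a r where a: "a \<in> K" "strict_mono r" "(z \<circ> r) \<longlonglongrightarrow> a"
    using zK unfolding compact_def by meson
  have aD: "norm a < 1" using a(1) KD by auto
  have "(\<lambda>n. z n - w n) \<longlonglongrightarrow> 0"
  proof (rule Lim_null_comparison)
    show "\<forall>\<^sub>F n in sequentially. norm (z n - w n) \<le> 2 * (1 / real (Suc n))"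
    proof (intro always_eventually allI)
      fix n show "norm (z n - w n) \<le> 2 * (1 / real (Suc n))"
        using norm_diff_le_rho[OF zw(1)[of n] zw(2)[of n]] zw(4)[of n] by linarith
    qed
    show "(\<lambda>n. 2 * (1 / real (Suc n))) \<longlonglongrightarrow> 0"
      using tendsto_mult_right_zero[OF LIMSEQ_Suc[OF lim_1_over_n]] by simp
  qed
  from tendsto_diff[OF a(3) LIMSEQ_subseq_LIMSEQ[OF this a(2)]]
  have wr: "(\<lambda>n. w (r n)) \<longlonglongrightarrow> a" by (simp add: comp_def)
  have zr: "(\<lambda>n. z (r n)) \<longlonglongrightarrow> a" using a(3) by (simp add: comp_def)
  have "isCont \<Phi> a" using \<Phi>(1) aD by (simp add: continuous_on_eq_continuous_at)
  then have "(\<lambda>n. rho (\<Phi> (z (r n))) (\<Phi> (w (r n)))) \<longlonglongrightarrow> rho (\<Phi> a) (\<Phi> a)"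
    using \<Phi>(2)[of a] aD by (intro tendsto_rho isCont_tendsto_compose[OF _ zr] isCont_tendsto_compose[OF _ wr]) auto
  then have "(\<lambda>n. rho (\<Phi> (z (r n))) (\<Phi> (w (r n)))) \<longlonglongrightarrow> 0" by simp
  then have "e \<le> 0"
    by (rule tendsto_lowerbound) (use zw(5) in auto)
  then show False using e by simp
qed

text \<open>
  The points come in pairs with indices \<open>2 * n\<close> and \<open>2 * n + 1\<close>, both at height comparable with \<open>h n\<close>.
  Points of different pairs are far apart, so only the separation within each pair matters.
\<close>

lemma carleson_seq_lacunary_pairs:
  fixes h :: "nat \<Rightarrow> real" and l :: "nat \<Rightarrow> complex"
  assumes c: "0 < c" "c \<le> C" and h: "\<And>n. 0 < h n" "\<And>n. h (Suc n) \<le> c / (64 * C) * h n"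
    and l: "\<And>j. norm (l j) < 1"
    and lh: "\<And>j. c * h (j div 2) \<le> 1 - (norm (l j))\<^sup>2" "\<And>j. 1 - (norm (l j))\<^sup>2 \<le> C * h (j div 2)"
    and pair: "\<And>j k. j \<noteq> k \<Longrightarrow> j div 2 = k div 2 \<Longrightarrow> 1 / 2 \<le> rho (l j) (l k)"
  shows "carleson_seq UNIV l"
proof -
  let ?g = "\<lambda>m n. 4 * (1/64 :: real) ^ ((m - n) + (n - m))"
  have far: "1 - (rho (l j) (l k))\<^sup>2 \<le> ?g (j div 2) (k div 2)" if "j div 2 \<noteq> k div 2" for j k
    by (rule lacunary_rho[OF c h that l l lh lh])
  have sep: "1 / 2 \<le> rho (l j) (l k)" if "j \<noteq> k" for j k
  proof (cases "j div 2 = k div 2")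
    case False
    then obtain d where "(j div 2 - k div 2) + (k div 2 - j div 2) = Suc d"
      by (metis add_is_0 diff_is_0_eq' diffs0_imp_equal nat.exhaust)
    then have "1 - (rho (l j) (l k))\<^sup>2 \<le> 4 * (1/64) ^ Suc d" using far[OF False] by simp
    moreover have "(1/64 :: real) ^ Suc d \<le> (1/64) ^ 1" by (rule power_decreasing) auto
    ultimately have "(1/2)\<^sup>2 \<le> (rho (l j) (l k))\<^sup>2" by (simp add: power2_eq_square)
    then show ?thesis by (rule power2_le_imp_le) simp
  qed (use pair that in blast)
  have mass: "(\<Sum>j\<in>F. 1 - (rho (l j) (l k))\<^sup>2) \<le> 3" if F: "finite F" for F k
  proof -
    \<comment> \<open>The pair of \<open>k\<close> contributes at most 2.  The remaining indices, split by parity, contribute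
      at most 1/2 each, as \<open>j \<mapsto> j div 2\<close> is injective on indices of equal parity.\<close>
    define S where "S = {j \<in> F. j div 2 = k div 2}"
    define T where "T = (\<lambda>e::nat. {j \<in> F. j div 2 \<noteq> k div 2 \<and> j mod 2 = e})"
    have fin: "finite S" "finite (T e)" for e using F by (auto simp: S_def T_def)
    have "S \<subseteq> {2 * (k div 2), Suc (2 * (k div 2))}" by (auto simp: S_def)
    then have "card S \<le> card {2 * (k div 2), Suc (2 * (k div 2))}" by (intro card_mono) auto
    then have "card S \<le> 2" by simp
    moreover have "(\<Sum>j\<in>S. 1 - (rho (l j) (l k))\<^sup>2) \<le> (\<Sum>j\<in>S. 1)" by (rule sum_mono) simp
    ultimately have S: "(\<Sum>j\<in>S. 1 - (rho (l j) (l k))\<^sup>2) \<le> 2" by simp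
    have T: "(\<Sum>j\<in>T e. 1 - (rho (l j) (l k))\<^sup>2) \<le> 1/2" for e
    proof -
      have "inj_on (\<lambda>j. j div 2) (T e)"
        by (rule inj_onI) (metis (mono_tags, lifting) T_def div_mult_mod_eq mem_Collect_eq)
      then have "(\<Sum>m\<in>(\<lambda>j. j div 2) ` T e. ?g m (k div 2)) = (\<Sum>j\<in>T e. ?g (j div 2) (k div 2))"
        by (simp add: sum.reindex)
      moreover have "(\<Sum>m\<in>(\<lambda>j. j div 2) ` T e. ?g m (k div 2)) \<le> 1/2"
        by (rule lacunary_sum) (use fin in \<open>auto simp: T_def\<close>)
      moreover have "(\<Sum>j\<in>T e. 1 - (rho (l j) (l k))\<^sup>2) \<le> (\<Sum>j\<in>T e. ?g (j div 2) (k div 2))"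
        by (rule sum_mono[OF far]) (simp add: T_def)
      ultimately show ?thesis by simp
    qed
    have "F = S \<union> (T 0 \<union> T 1)" by (auto simp: S_def T_def)
    then have "(\<Sum>j\<in>F. 1 - (rho (l j) (l k))\<^sup>2) = (\<Sum>j\<in>S \<union> (T 0 \<union> T 1). 1 - (rho (l j) (l k))\<^sup>2)" by simp
    also have "\<dots> = (\<Sum>j\<in>S. 1 - (rho (l j) (l k))\<^sup>2) + (\<Sum>j\<in>T 0 \<union> T 1. 1 - (rho (l j) (l k))\<^sup>2)"
      using fin by (intro sum.union_disjoint) (auto simp: S_def T_def)
    also have "(\<Sum>j\<in>T 0 \<union> T 1. 1 - (rho (l j) (l k))\<^sup>2)
        = (\<Sum>j\<in>T 0. 1 - (rho (l j) (l k))\<^sup>2) + (\<Sum>j\<in>T 1. 1 - (rho (l j) (l k))\<^sup>2)"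
      using fin by (intro sum.union_disjoint) (auto simp: T_def)
    finally show ?thesis using S T[of 0] T[of 1] by linarith
  qed
  show ?thesis
    unfolding carleson_seq_iff separated_finite_mass_def
  proof (intro conjI)
    show "l ` UNIV \<subseteq> \<bbbD>" using l by auto
    show "\<exists>s>0. \<forall>j\<in>UNIV. \<forall>k\<in>UNIV. j \<noteq> k \<longrightarrow> s \<le> rho (l j) (l k)"
      using sep by (intro exI[of _ "1/2"]) auto
    show "\<exists>A. \<forall>k\<in>UNIV. \<forall>F. finite F \<longrightarrow> F \<subseteq> UNIV \<longrightarrow> (\<Sum>j\<in>F. 1 - (rho (l j) (l k))\<^sup>2) \<le> A"
      using mass by (intro exI[of _ 3]) auto
  qed
qed

lemma height_comparable:
  assumes zw: "norm z < 1" "norm w < 1" and "rho z w \<le> 1/2"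
  shows "3/16 * (1 - (norm z)\<^sup>2) \<le> 1 - (norm w)\<^sup>2" "1 - (norm w)\<^sup>2 \<le> 16/3 * (1 - (norm z)\<^sup>2)"
proof -
  have main: "3/16 * (1 - (norm z)\<^sup>2) \<le> 1 - (norm w)\<^sup>2"
    if "norm z < 1" "norm w < 1" "rho z w \<le> 1/2" for z w
  proof -
    have "(rho z w)\<^sup>2 \<le> (1/2)\<^sup>2" using that(3) by (intro power_mono) auto
    then have "3/4 \<le> 1 - (rho z w)\<^sup>2" by (simp add: power2_eq_square)
    also have "\<dots> \<le> 4 * (1 - (norm w)\<^sup>2) / (1 - (norm z)\<^sup>2)" by (rule one_minus_rho_sq_le[OF that(1,2)])
    finally show ?thesis using one_minus_norm_sq_pos[OF that(1)] by (simp add: le_divide_eq)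
  qed
  show "3/16 * (1 - (norm z)\<^sup>2) \<le> 1 - (norm w)\<^sup>2" by (rule main[OF assms])
  show "1 - (norm w)\<^sup>2 \<le> 16/3 * (1 - (norm z)\<^sup>2)"
    using main[OF zw(2,1)] assms(3) by (simp add: rho_commute)
qed

text \<open>
  Suppose there are arbitrarily close pairs with images at distance at least one half.  They can be
  chosen with geometrically decreasing heights, and then the heights of their images decrease
  comparably.  So the sequence of images is Carleson by \<open>carleson_seq_lacunary_pairs\<close>; but the
  original sequence is not even separated.
\<close>

lemma P_c_rho_uniformly_continuous:
  assumes \<Phi>: "\<Phi> \<in> P_c"
  obtains d where "0 < d" "\<And>z w. norm z < 1 \<Longrightarrow> norm w < 1 \<Longrightarrow> rho z w < d \<Longrightarrow> rho (\<Phi> z) (\<Phi> w) < 1/2"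
proof -
  have "\<exists>d>0. \<forall>z w. norm z < 1 \<longrightarrow> norm w < 1 \<longrightarrow> rho z w < d \<longrightarrow> rho (\<Phi> z) (\<Phi> w) < 1/2"
  proof (rule ccontr)
    assume neg: "\<not> ?thesis"
    then have bad: "\<exists>z w. norm z < 1 \<and> norm w < 1 \<and> rho z w < d \<and> 1/2 \<le> rho (\<Phi> z) (\<Phi> w)" if "0 < d" for d
      using that by (meson not_le)
    obtain c C :: real where cC: "0 < c" "c \<le> C"
      "\<And>z. norm z < 1 \<Longrightarrow> c * (1 - (norm z)\<^sup>2) \<le> 1 - (norm (\<Phi> z))\<^sup>2"
      "\<And>z. norm z < 1 \<Longrightarrow> 1 - (norm (\<Phi> z))\<^sup>2 \<le> C * (1 - (norm z)\<^sup>2)"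
      by (rule P_c_heights[OF \<Phi>]) (rule that)
    \<comment> \<open>The factors 3/16 and 16/3 bound the ratio of the heights within a close pair.\<close>
    define c' where "c' = c * (3/16)"
    define C' where "C' = C * (16/3)"
    have c': "0 < c'" "c' \<le> C'" using cC by (auto simp: c'_def C'_def)
    define P where "P = (\<lambda>(n::nat) (p::complex \<times> complex). norm (fst p) < 1 \<and> norm (snd p) < 1 \<and>
       rho (fst p) (snd p) < 1 / (real n + 2) \<and> 1/2 \<le> rho (\<Phi> (fst p)) (\<Phi> (snd p)))"
    have escape: "\<exists>p. P n p \<and> 1 - (norm (fst p))\<^sup>2 \<le> t" if "0 < t" for n t
    proof -
      have "\<exists>z w. norm z < 1 \<and> norm w < 1 \<and> rho z w < 1 / (real n + 2) \<and> 1/2 \<le> rho (\<Phi> z) (\<Phi> w) \<and> 1 - (norm z)\<^sup>2 \<le> t"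
        by (rule bad_pairs_escape[OF carleson_maps_continuous[OF P_c_carleson[OF \<Phi>]] P_c_in_disc[OF \<Phi>] _ bad _ that]) auto
      then show ?thesis unfolding P_def by (metis fst_conv snd_conv)
    qed
    have "\<exists>p. \<forall>n. P n (p n) \<and> 1 - (norm (fst (p (Suc n))))\<^sup>2 \<le> c' / (64 * C') * (1 - (norm (fst (p n)))\<^sup>2)"
    proof (rule dependent_nat_choice)
      show "\<exists>p. P 0 p" using escape[of 1 0] by auto
    next
      fix p n assume "P n p"
      then have "0 < 1 - (norm (fst p))\<^sup>2" by (intro one_minus_norm_sq_pos) (simp add: P_def)
      then have "0 < c' / (64 * C') * (1 - (norm (fst p))\<^sup>2)" using c' by (intro mult_pos_pos divide_pos_pos) auto
      then show "\<exists>q. P (Suc n) q \<and> 1 - (norm (fst q))\<^sup>2 \<le> c' / (64 * C') * (1 - (norm (fst p))\<^sup>2)"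
        by (rule escape)
    qed
    then obtain p where P: "\<And>n. P n (p n)"
      and decay: "\<And>n. 1 - (norm (fst (p (Suc n))))\<^sup>2 \<le> c' / (64 * C') * (1 - (norm (fst (p n)))\<^sup>2)"
      by blast
    define z where "z = (\<lambda>n. fst (p n))"
    define w where "w = (\<lambda>n. snd (p n))"
    have zw: "norm (z n) < 1" "norm (w n) < 1" "rho (z n) (w n) < 1 / (real n + 2)"
      "1/2 \<le> rho (\<Phi> (z n)) (\<Phi> (w n))" for n
      using P[of n] by (auto simp: P_def z_def w_def)
    define h where "h = (\<lambda>n. 1 - (norm (z n))\<^sup>2)"
    have h: "0 < h n" "h (Suc n) \<le> c' / (64 * C') * h n" for n
      using decay[of n] one_minus_norm_sq_pos[OF zw(1)] by (simp_all add: h_def z_def)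
    define l where "l = (\<lambda>j. if even j then z (j div 2) else w (j div 2))"
    have l: "norm (l j) < 1" for j using zw by (simp add: l_def)
    have lh: "3/16 * h (j div 2) \<le> 1 - (norm (l j))\<^sup>2 \<and> 1 - (norm (l j))\<^sup>2 \<le> 16/3 * h (j div 2)" for j
    proof (cases "even j")
      case True
      then show ?thesis using h(1)[of "j div 2"] by (simp add: l_def h_def)
    next
      case False
      have "1 / (real (j div 2) + 2) \<le> 1/2" by (simp add: divide_le_eq)
      then have "rho (z (j div 2)) (w (j div 2)) \<le> 1/2" using zw(3)[of "j div 2"] by linarith
      from height_comparable[OF zw(1,2) this] False show ?thesis by (simp add: l_def h_def)
    qed
    have "carleson_seq UNIV (\<lambda>j. \<Phi> (l j))"
    proof (rule carleson_seq_lacunary_pairs[OF c', where h = h, OF h])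
      show "norm (\<Phi> (l j)) < 1" for j using P_c_in_disc[OF \<Phi>, of "l j"] l[of j] by simp
      show "c' * h (j div 2) \<le> 1 - (norm (\<Phi> (l j)))\<^sup>2" for j
        using order_trans[OF mult_left_mono[OF conjunct1[OF lh]] cC(3)[OF l]] cC(1) by (simp add: c'_def mult.assoc)
      show "1 - (norm (\<Phi> (l j)))\<^sup>2 \<le> C' * h (j div 2)" for j
        using order_trans[OF cC(4)[OF l] mult_left_mono[OF conjunct2[OF lh]]] cC(1,2) by (simp add: C'_def mult.assoc)
      show "1/2 \<le> rho (\<Phi> (l j)) (\<Phi> (l k))" if "j \<noteq> k" "j div 2 = k div 2" for j k
      proof (cases "even j")
        case True
        then have "odd k" using that by (metis bit_eq_rec)
        then show ?thesis using True zw(4)[of "k div 2"] that(2) by (simp add: l_def)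
      next
        case False
        then have "even k" using that by (metis bit_eq_rec)
        then show ?thesis using False zw(4)[of "k div 2"] that(2) by (simp add: l_def rho_commute)
      qed
    qed
    moreover have "range l \<subseteq> \<bbbD>" using l by auto
    ultimately have "carleson_seq UNIV l"
      using carleson_maps_iff[OF P_c_carleson[OF \<Phi>], of l UNIV] by blast
    then obtain s where "0 < s" and sep: "\<forall>j\<in>UNIV. \<forall>k\<in>UNIV. j \<noteq> k \<longrightarrow> s \<le> rho (l j) (l k)"
      unfolding carleson_seq_iff separated_finite_mass_def by (elim conjE exE)
    have "s \<le> 1 / (real n + 2)" for n
      using sep[rule_format, of "2 * n" "Suc (2 * n)"] zw(3)[of n] by (simp add: l_def)
    moreover obtain n where "1 / s < real n" using reals_Archimedean2 by blast
    then have "1 / (real n + 2) < s" using \<open>0 < s\<close> by (simp add: field_simps)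
    ultimately show False by (meson not_le)
  qed
  then show thesis using that by blast
qed

section \<open>Coarse Lipschitz estimates by chaining\<close>

lemma chain_steps:
  fixes F :: "complex \<Rightarrow> complex"
  assumes "\<And>i. i < n \<Longrightarrow> norm (F (p i) - F (p (Suc i))) \<le> B"
  shows "norm (F (p 0) - F (p n)) \<le> real n * B"
  using assms
proof (induction n)
  case (Suc n)
  have "norm (F (p 0) - F (p (Suc n))) \<le> norm (F (p 0) - F (p n)) + norm (F (p n) - F (p (Suc n)))"
    using norm_triangle_ineq[of "F (p 0) - F (p n)" "F (p n) - F (p (Suc n))"] by simp
  also have "\<dots> \<le> real n * B + B"
    using Suc.IH Suc.prems by (intro add_mono) auto
  finally show ?case by (simp add: algebra_simps)
qed simp

text \<open>
  The distance to the circle shrinks by the factor \<open>1 - d\<close> in each step, so the steps add up to the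
  geometric series \<open>K (1 - r) \<Sum> (1 - d)\<^sup>k\<close>.
\<close>

lemma chain_radial:
  fixes F :: "complex \<Rightarrow> complex"
  assumes d: "0 < d" "d < 1" and K: "0 \<le> K"
    and local: "\<And>z w. norm z < 1 \<Longrightarrow> norm w < 1 \<Longrightarrow> norm (z - w) \<le> d * (1 - norm z) \<Longrightarrow> norm (F z - F w) \<le> K * (1 - norm z)"
    and \<zeta>: "\<zeta> \<in> \<bbbT>" and rs: "0 \<le> r" "r \<le> s" "s < 1"
  shows "norm (F (of_real r * \<zeta>) - F (of_real s * \<zeta>)) \<le> K / d * (1 - r)"
proof -
  have n: "norm (of_real t * \<zeta>) = t" if "0 \<le> t" for t using \<zeta> that by (simp add: norm_mult)
  have nd: "norm (of_real t * \<zeta> - of_real u * \<zeta>) = \<bar>t - u\<bar>" for t u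
    using \<zeta> by (simp add: norm_mult left_diff_distrib[symmetric] of_real_diff[symmetric] del: of_real_diff)
  have "norm (F (of_real r * \<zeta>) - F (of_real s * \<zeta>)) \<le> K / d * (1 - r)"
    if "(1 - d) ^ k * (1 - r) \<le> 1 - s" "0 \<le> r" "r \<le> s" for k r
    using that
  proof (induction k arbitrary: r)
    case 0
    then have "r = s" by simp
    then show ?case using d K rs by simp
  next
    case (Suc k)
    show ?case
    proof (cases "s \<le> r + d * (1 - r)")
      case True
      have "norm (F (of_real r * \<zeta>) - F (of_real s * \<zeta>)) \<le> K * (1 - norm (of_real r * \<zeta>))"
        using True Suc.prems rs by (intro local) (simp_all add: n nd)
      also have "\<dots> = K * (1 - r)" using n[OF Suc.prems(2)] by simp
      also have "\<dots> \<le> K / d * (1 - r)"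
        using d K Suc.prems rs by (intro mult_right_mono) (auto simp: le_divide_eq mult_left_le)
      finally show ?thesis .
    next
      case False
      define r' where "r' = r + d * (1 - r)"
      have r1: "r < 1" using Suc.prems rs by simp
      have dr: "0 \<le> d * (1 - r)" using d r1 by simp
      have r': "0 \<le> r'" "r' \<le> s" "1 - r' = (1 - d) * (1 - r)" "\<bar>r - r'\<bar> = d * (1 - r)"
      proof -
        show "0 \<le> r'" "\<bar>r - r'\<bar> = d * (1 - r)" using dr Suc.prems(2) by (simp_all add: r'_def)
        show "r' \<le> s" using False by (simp add: r'_def)
        show "1 - r' = (1 - d) * (1 - r)" by (simp add: r'_def algebra_simps)
      qed
      have "norm (F (of_real r' * \<zeta>) - F (of_real s * \<zeta>)) \<le> K / d * (1 - r')"
        by (rule Suc.IH) (use r' Suc.prems in \<open>simp_all add: mult_ac\<close>)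
      moreover have "norm (F (of_real r * \<zeta>) - F (of_real r' * \<zeta>)) \<le> K * (1 - norm (of_real r * \<zeta>))"
      proof (rule local)
        show "norm (of_real r * \<zeta>) < 1" using n[OF Suc.prems(2)] r1 by simp
        show "norm (of_real r' * \<zeta>) < 1" using n[OF r'(1)] r'(2) rs(3) by simp
        show "norm (of_real r * \<zeta> - of_real r' * \<zeta>) \<le> d * (1 - norm (of_real r * \<zeta>))"
          unfolding nd n[OF Suc.prems(2)] r'(4) by simp
      qed
      ultimately have "norm (F (of_real r * \<zeta>) - F (of_real s * \<zeta>)) \<le> K * (1 - r) + K / d * ((1 - d) * (1 - r))"
        using norm_triangle_ineq[of "F (of_real r * \<zeta>) - F (of_real r' * \<zeta>)" "F (of_real r' * \<zeta>) - F (of_real s * \<zeta>)"]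
          r'(3) n[OF Suc.prems(2)] by simp
      also have "\<dots> = K / d * (1 - r)" using d by (simp add: field_simps)
      finally show ?thesis .
    qed
  qed
  moreover obtain k where "(1 - d) ^ k < 1 - s"
    using real_arch_pow_inv[of "1 - s" "1 - d"] d rs by auto
  then have "(1 - d) ^ k * (1 - r) \<le> 1 - s"
  proof -
    have "(1 - d) ^ k * (1 - r) \<le> (1 - d) ^ k * 1" using d rs by (intro mult_left_mono) auto
    then show ?thesis using \<open>(1 - d) ^ k < 1 - s\<close> by simp
  qed
  ultimately show ?thesis using rs by blast
qed

text \<open>
  Along the segment the distance to the circle stays between \<open>t\<close> and \<open>4 * t\<close>, so a number of steps
  independent of \<open>t\<close> suffices.
\<close>

lemma chain_segment:
  fixes F :: "complex \<Rightarrow> complex"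
  assumes d: "0 < d" and K: "0 \<le> K"
    and local: "\<And>z w. norm z < 1 \<Longrightarrow> norm w < 1 \<Longrightarrow> norm (z - w) \<le> d * (1 - norm z) \<Longrightarrow> norm (F z - F w) \<le> K * (1 - norm z)"
    and t: "0 < t" "t \<le> 1" and ab: "norm a = 1 - t" "norm b = 1 - t" "norm (a - b) \<le> 3 * t"
    and N: "3 \<le> d * real N"
  shows "norm (F a - F b) \<le> real N * (K * (4 * t))"
proof -
  have N0: "0 < real N" using N d by (cases "N = 0") auto
  define p where "p = (\<lambda>i. (1 - real i / real N) *\<^sub>R a + (real i / real N) *\<^sub>R b)"
  have p: "norm (p i) \<le> 1 - t" "1 - norm (p i) \<le> 4 * t" if "i \<le> N" for i
  proof -
    have x: "0 \<le> real i / real N" "real i / real N \<le> 1" using that N0 by auto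
    have "norm (p i) \<le> (1 - real i / real N) * norm a + (real i / real N) * norm b"
      unfolding p_def using x by (intro norm_triangle_le) simp
    then show "norm (p i) \<le> 1 - t" unfolding ab by (simp add: algebra_simps)
    have "a - p i = (real i / real N) *\<^sub>R (a - b)" by (simp add: p_def algebra_simps)
    then have "norm (a - p i) \<le> 3 * t"
      using x order_trans[OF mult_left_le_one_le[OF norm_ge_zero x] ab(3)] by simp
    then show "1 - norm (p i) \<le> 4 * t"
      using norm_triangle_ineq2[of a "p i"] ab(1) by linarith
  qed
  have "norm (F (p 0) - F (p N)) \<le> real N * (K * (4 * t))"
  proof (rule chain_steps)
    fix i assume i: "i < N"
    have "p i - p (Suc i) = (1 / real N) *\<^sub>R (a - b)"
      by (simp add: p_def algebra_simps add_divide_distrib)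
    then have "norm (p i - p (Suc i)) = norm (a - b) / real N" by simp
    also have "\<dots> \<le> 3 * t / real N" using ab(3) N0 by (intro divide_right_mono) auto
    also have "\<dots> \<le> d * t" using N N0 t mult_right_mono[OF N, of t] by (simp add: divide_le_eq mult_ac)
    also have "\<dots> \<le> d * (1 - norm (p i))" using p(1)[of i] i d by (intro mult_left_mono) auto
    finally have "norm (F (p i) - F (p (Suc i))) \<le> K * (1 - norm (p i))"
      using p(1)[of i] p(1)[of "Suc i"] i t by (intro local) auto
    also have "\<dots> \<le> K * (4 * t)" using p(2)[of i] i K by (intro mult_left_mono) auto
    finally show "norm (F (p i) - F (p (Suc i))) \<le> K * (4 * t)" .
  qed
  moreover have "p 0 = a" "p N = b" using N0 by (simp_all add: p_def)
  ultimately show ?thesis by simp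
qed

text \<open>
  Two points are joined by moving radially inwards to the distance \<open>t\<close> from the circle, where \<open>t\<close> is
  the sum in the conclusion, and then along a segment.
\<close>

lemma coarse_lipschitz_of_local:
  fixes F :: "complex \<Rightarrow> complex"
  assumes d: "0 < d" "d < 1" and K: "0 \<le> K"
    and local: "\<And>z w. norm z < 1 \<Longrightarrow> norm w < 1 \<Longrightarrow> norm (z - w) \<le> d * (1 - norm z) \<Longrightarrow> norm (F z - F w) \<le> K * (1 - norm z)"
    and FD: "\<And>z. norm z < 1 \<Longrightarrow> norm (F z) \<le> 1"
  obtains M where "0 < M" "\<And>z w. norm z < 1 \<Longrightarrow> norm w < 1 \<Longrightarrow> norm (F z - F w) \<le> M * (norm (z - w) + (1 - norm z) + (1 - norm w))"
proof -
  obtain N :: nat where "3 / d \<le> real N" using real_arch_simple by blast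
  then have N: "3 \<le> d * real N" using d by (simp add: divide_le_eq mult.commute)
  define M where "M = 2 * (K / d) + 4 * real N * K + 4"
  have "norm (F z - F w) \<le> M * (norm (z - w) + (1 - norm z) + (1 - norm w))" if zw: "norm z < 1" "norm w < 1" for z w
  proof -
    define t where "t = norm (z - w) + (1 - norm z) + (1 - norm w)"
    have t: "0 < t" "1 - t \<le> norm z" "1 - t \<le> norm w" "norm (z - w) \<le> t"
      unfolding t_def using zw norm_ge_zero[of "z - w"] by linarith+
    have Kd: "0 \<le> K / d" "0 \<le> real N * K" using K d by auto
    have "norm (F z - F w) \<le> M * t"
    \<comment> \<open>For \<open>t \<ge> 1\<close> the claim is trivial because \<open>F\<close> is bounded.\<close>
    proof (cases "t < 1")
      case False
      have "norm (F z - F w) \<le> norm (F z) + norm (F w)" by (rule norm_triangle_ineq4)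
      also have "\<dots> \<le> 4 * 1" using FD[OF zw(1)] FD[OF zw(2)] by simp
      also have "\<dots> \<le> M * t" using False Kd by (intro mult_mono) (auto simp: M_def)
      finally show ?thesis .
    next
      case True
      obtain \<zeta> where \<zeta>: "\<zeta> \<in> \<bbbT>" "z = of_real (norm z) * \<zeta>" by (rule polarE)
      obtain \<eta> where \<eta>: "\<eta> \<in> \<bbbT>" "w = of_real (norm w) * \<eta>" by (rule polarE)
      \<comment> \<open>The points at distance \<open>t\<close> from the circle on the radii through \<open>z\<close> and \<open>w\<close>.\<close>
      define a where "a = of_real (1 - t) * \<zeta>"
      define b where "b = of_real (1 - t) * \<eta>"
      have na: "norm a = 1 - t" "norm b = 1 - t" using \<zeta>(1) \<eta>(1) True by (simp_all add: a_def b_def norm_mult del: of_real_diff)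
      have az: "norm (a - z) \<le> t" "norm (b - w) \<le> t"
      proof -
        have "a - z = of_real (1 - t) * \<zeta> - of_real (norm z) * \<zeta>" by (simp only: a_def \<zeta>(2)[symmetric])
        then have "a - z = of_real (1 - t - norm z) * \<zeta>" by (simp add: algebra_simps)
        then have "norm (a - z) = \<bar>1 - t - norm z\<bar>" using \<zeta>(1) by (simp add: norm_mult del: of_real_diff)
        then show "norm (a - z) \<le> t" using t zw by simp
        have "b - w = of_real (1 - t) * \<eta> - of_real (norm w) * \<eta>" by (simp only: b_def \<eta>(2)[symmetric])
        then have "b - w = of_real (1 - t - norm w) * \<eta>" by (simp add: algebra_simps)
        then have "norm (b - w) = \<bar>1 - t - norm w\<bar>" using \<eta>(1) by (simp add: norm_mult del: of_real_diff)
        then show "norm (b - w) \<le> t" using t zw by simp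
      qed
      have "a - b = (a - z) + (z - w) - (b - w)" by simp
      then have "norm (a - b) \<le> norm (a - z) + norm (z - w) + norm (b - w)"
        by (metis norm_triangle_ineq norm_triangle_ineq4 add_right_mono order_trans)
      then have ab: "norm (a - b) \<le> 3 * t" using az t(4) by linarith
      have 1: "norm (F a - F b) \<le> real N * (K * (4 * t))"
        by (rule chain_segment[OF d(1) K local t(1) _ na ab N]) (use True in auto)
      have 2: "norm (F a - F z) \<le> K / d * t"
        using chain_radial[OF d K local \<zeta>(1), of "1 - t" "norm z"] \<zeta>(2) t zw True by (simp add: a_def)
      have 3: "norm (F b - F w) \<le> K / d * t"
        using chain_radial[OF d K local \<eta>(1), of "1 - t" "norm w"] \<eta>(2) t zw True by (simp add: b_def)
      have "F z - F w = - (F a - F z) + (F a - F b) + (F b - F w)" by simp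
      then have "norm (F z - F w) \<le> norm (F a - F z) + norm (F a - F b) + norm (F b - F w)"
        by (metis norm_minus_cancel norm_triangle_ineq add_right_mono order_trans)
      also have "\<dots> \<le> K / d * t + real N * (K * (4 * t)) + K / d * t" using 1 2 3 by linarith
      also have "\<dots> \<le> M * t" using t(1) by (simp add: M_def algebra_simps)
      finally show ?thesis .
    qed
    then show ?thesis by (simp add: t_def)
  qed
  moreover have "0 < M" using K d by (simp add: M_def add_nonneg_pos)
  ultimately show thesis using that by blast
qed

text \<open>
  A bound \<open>\<rho> < 1/2\<close> for the images is a Euclidean bound by their height, and that height is comparable
  with the height of the original point.
\<close>

lemma P_c_coarse_lipschitz:
  assumes \<Phi>: "\<Phi> \<in> P_c"
  obtains M where "0 < M" "\<And>z w. norm z < 1 \<Longrightarrow> norm w < 1 \<Longrightarrow> norm (\<Phi> z - \<Phi> w) \<le> M * (norm (z - w) + (1 - norm z) + (1 - norm w))"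
proof -
  obtain c C :: real where cC: "0 < c" "c \<le> C"
    "\<And>z. norm z < 1 \<Longrightarrow> 1 - (norm (\<Phi> z))\<^sup>2 \<le> C * (1 - (norm z)\<^sup>2)"
    by (rule P_c_heights[OF \<Phi>]) (rule that)
  obtain e where e: "0 < e" "\<And>z w. norm z < 1 \<Longrightarrow> norm w < 1 \<Longrightarrow> rho z w < e \<Longrightarrow> rho (\<Phi> z) (\<Phi> w) < 1/2"
    by (rule P_c_rho_uniformly_continuous[OF \<Phi>]) (rule that)
  have \<Phi>D: "norm (\<Phi> z) < 1" if "norm z < 1" for z using P_c_in_disc[OF \<Phi>] that by simp
  define d where "d = min (e / 2) (1 / 2)"
  have d: "0 < d" "d < 1" "d < e" using e(1) by (auto simp: d_def)
  have "norm (\<Phi> z - \<Phi> w) \<le> (2 * C) * (1 - norm z)"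
    if zw: "norm z < 1" "norm w < 1" "norm (z - w) \<le> d * (1 - norm z)" for z w
  proof -
    note D = \<Phi>D[OF zw(1)] \<Phi>D[OF zw(2)]
    have p: "0 < 1 - norm z" using zw by simp
    have "rho z w \<le> norm (z - w) / (1 - norm z)"
      unfolding rho_def norm_divide using p norm_1_minus_cnj_ge(1)[OF zw(1,2)] cnj_mult_neq_1[OF zw(1,2)]
      by (intro divide_left_mono mult_pos_pos) auto
    also have "\<dots> \<le> d" using zw(3) p by (simp add: divide_le_eq)
    finally have "rho (\<Phi> z) (\<Phi> w) < 1/2" using d(3) by (intro e(2) zw) auto
    then have "norm (\<Phi> z - \<Phi> w) / norm (1 - cnj (\<Phi> z) * \<Phi> w) < 1/2"
      by (simp add: rho_def norm_divide)
    then have *: "2 * norm (\<Phi> z - \<Phi> w) \<le> norm (1 - cnj (\<Phi> z) * \<Phi> w)"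
      using cnj_mult_neq_1[OF D] by (simp add: divide_less_eq)
    have "complex_of_real (1 - (norm (\<Phi> z))\<^sup>2) = 1 - cnj (\<Phi> z) * \<Phi> z"
      by (simp add: complex_norm_square[symmetric] mult.commute)
    then have "1 - cnj (\<Phi> z) * \<Phi> w = of_real (1 - (norm (\<Phi> z))\<^sup>2) + cnj (\<Phi> z) * (\<Phi> z - \<Phi> w)"
      by (simp add: algebra_simps)
    then have "norm (1 - cnj (\<Phi> z) * \<Phi> w) \<le> norm (complex_of_real (1 - (norm (\<Phi> z))\<^sup>2)) + norm (cnj (\<Phi> z) * (\<Phi> z - \<Phi> w))"
      using norm_triangle_ineq by metis
    also have "norm (complex_of_real (1 - (norm (\<Phi> z))\<^sup>2)) = 1 - (norm (\<Phi> z))\<^sup>2"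
      using one_minus_norm_sq_pos[OF D(1)] by (simp only: norm_of_real abs_of_pos)
    also have "norm (cnj (\<Phi> z) * (\<Phi> z - \<Phi> w)) \<le> norm (\<Phi> z - \<Phi> w)"
      using D(1) by (simp add: norm_mult mult_left_le_one_le)
    finally have "norm (\<Phi> z - \<Phi> w) \<le> 1 - (norm (\<Phi> z))\<^sup>2" using * by linarith
    also have "\<dots> \<le> C * (1 - (norm z)\<^sup>2)" by (rule cC(3)[OF zw(1)])
    also have "\<dots> \<le> C * (2 * (1 - norm z))"
    proof (rule mult_left_mono)
      show "1 - (norm z)\<^sup>2 \<le> 2 * (1 - norm z)"
        using zero_le_power2[of "1 - norm z"] by (simp add: power2_diff)
    qed (use cC in auto)
    finally show ?thesis by (simp only: mult_ac)
  qed
  then have local: "\<And>z w. norm z < 1 \<Longrightarrow> norm w < 1 \<Longrightarrow> norm (z - w) \<le> d * (1 - norm z) \<Longrightarrow> norm (\<Phi> z - \<Phi> w) \<le> (2 * C) * (1 - norm z)" .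
  have C: "0 \<le> 2 * C" using cC(1,2) by simp
  show thesis
    by (rule coarse_lipschitz_of_local[OF d(1,2) C local less_imp_le[OF \<Phi>D]]) (assumption | rule that)+
qed

section \<open>Extension to the closed disc\<close>

text \<open>
  The index is shifted so that the factors are below one and positive already for \<open>n = 0\<close>.
\<close>

definition radial_seq :: "complex \<Rightarrow> nat \<Rightarrow> complex"
  where "radial_seq z n = of_real (1 - 1 / real (Suc (Suc n))) * z"

lemma radial_seq_in_disc: "norm z \<le> 1 \<Longrightarrow> norm (radial_seq z n) < 1"
proof -
  assume z: "norm z \<le> 1"
  have x: "0 \<le> 1 - 1 / real (Suc (Suc n))" "1 - 1 / real (Suc (Suc n)) < 1" by auto
  have "norm (radial_seq z n) = (1 - 1 / real (Suc (Suc n))) * norm z"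
    unfolding radial_seq_def norm_mult norm_of_real using x(1) by (simp only: abs_of_nonneg)
  also have "\<dots> \<le> 1 - 1 / real (Suc (Suc n))" using z x(1) by (simp add: mult_left_le)
  finally show ?thesis using x(2) by linarith
qed

lemma radial_seq_tendsto: "radial_seq z \<longlonglongrightarrow> z"
proof -
  have "(\<lambda>n. 1 / real (Suc (Suc n))) \<longlonglongrightarrow> 0"
    by (rule LIMSEQ_Suc[OF LIMSEQ_Suc[OF lim_1_over_n]])
  then have "(\<lambda>n. of_real (1 - 1 / real (Suc (Suc n))) * z) \<longlonglongrightarrow> of_real (1 - 0) * z"
    by (intro tendsto_intros)
  then show ?thesis by (simp add: radial_seq_def[abs_def])
qed

lemma continuous_cball_eqI:
  fixes f g :: "complex \<Rightarrow> complex"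
  assumes "continuous_on (cball 0 1) f" "continuous_on (cball 0 1) g"
    and "\<And>z. z \<in> \<bbbD> \<Longrightarrow> f z = g z" and z: "z \<in> cball 0 1"
  shows "f z = g z"
proof (rule LIMSEQ_unique)
  have in_cball: "radial_seq z n \<in> cball 0 1" for n
    using radial_seq_in_disc[of z n] z by simp
  show "(\<lambda>n. f (radial_seq z n)) \<longlonglongrightarrow> f z"
    by (rule continuous_on_tendsto_compose[OF assms(1) radial_seq_tendsto z]) (rule always_eventually, rule allI, rule in_cball)
  have "(\<lambda>n. g (radial_seq z n)) \<longlonglongrightarrow> g z"
    by (rule continuous_on_tendsto_compose[OF assms(2) radial_seq_tendsto z]) (rule always_eventually, rule allI, rule in_cball)
  then show "(\<lambda>n. f (radial_seq z n)) \<longlonglongrightarrow> g z"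
    using assms(3) radial_seq_in_disc[of z] z by simp
qed

text \<open>
  The coarse Lipschitz estimate makes \<open>\<Phi>\<close> Cauchy along every radius.  It persists in the limit, where the
  terms \<open>1 - |z|\<close> vanish on the circle; there it is a Lipschitz condition, and elsewhere it
  controls the approach to the circle.
\<close>

lemma P_c_closed_extension:
  assumes \<Phi>: "\<Phi> \<in> P_c"
  obtains F M where "F \<in> extensional (cball 0 1)" "\<And>z. z \<in> \<bbbD> \<Longrightarrow> F z = \<Phi> z"
    "continuous_on (cball 0 1) F" "\<And>z. z \<in> \<bbbT> \<Longrightarrow> F z \<in> \<bbbT>" "1 \<le> M"
    "\<And>z w. z \<in> \<bbbT> \<Longrightarrow> w \<in> \<bbbT> \<Longrightarrow> norm (F z - F w) \<le> M * norm (z - w)"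
proof -
  obtain c C :: real where cC: "0 < c" "c \<le> C"
    "\<And>z. norm z < 1 \<Longrightarrow> 1 - (norm (\<Phi> z))\<^sup>2 \<le> C * (1 - (norm z)\<^sup>2)"
    by (rule P_c_heights[OF \<Phi>]) (rule that)
  obtain M where M: "0 < M" "\<And>z w. norm z < 1 \<Longrightarrow> norm w < 1 \<Longrightarrow> norm (\<Phi> z - \<Phi> w) \<le> M * (norm (z - w) + (1 - norm z) + (1 - norm w))"
    by (rule P_c_coarse_lipschitz[OF \<Phi>]) (rule that)
  have cont: "isCont \<Phi> z" if "norm z < 1" for z
    using carleson_maps_continuous[OF P_c_carleson[OF \<Phi>]] that by (simp add: continuous_on_eq_continuous_at)
  have conv: "convergent (\<lambda>n. \<Phi> (radial_seq z n))" if z: "norm z \<le> 1" for z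
  proof (cases "norm z < 1")
    case True
    show ?thesis
      by (rule convergentI[OF isCont_tendsto_compose[OF cont[OF True] radial_seq_tendsto]])
  next
    case False
    then have z1: "norm z = 1" using z by simp
    have lim: "(\<lambda>n. 1 - norm (radial_seq z n)) \<longlonglongrightarrow> 0"
      using tendsto_diff[OF tendsto_const tendsto_norm[OF radial_seq_tendsto], of 1 z] z1 by simp
    show ?thesis
      unfolding Cauchy_convergent_iff[symmetric] Cauchy_def dist_norm
    proof (intro allI impI)
      fix e :: real assume e: "0 < e"
      have "0 < e / (4 * M)" using e M by simp
      from LIMSEQ_D[OF lim this] LIMSEQ_D[OF radial_seq_tendsto[of z] this]
      obtain N N' where N: "\<And>n. N \<le> n \<Longrightarrow> norm (1 - norm (radial_seq z n) - 0) < e / (4 * M)"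
        "\<And>n. N' \<le> n \<Longrightarrow> norm (radial_seq z n - z) < e / (4 * M)" by blast
      have "norm (\<Phi> (radial_seq z m) - \<Phi> (radial_seq z n)) < e" if mn: "max N N' \<le> m" "max N N' \<le> n" for m n
      proof -
        have "norm (radial_seq z m - radial_seq z n) \<le> norm (radial_seq z m - z) + norm (radial_seq z n - z)"
          using norm_triangle_ineq4[of "radial_seq z m - z" "radial_seq z n - z"] by simp
        then have "norm (radial_seq z m - radial_seq z n) + (1 - norm (radial_seq z m)) + (1 - norm (radial_seq z n)) < 4 * (e / (4 * M))"
          using N(1)[of m] N(1)[of n] N(2)[of m] N(2)[of n] mn radial_seq_in_disc[OF z, of m] radial_seq_in_disc[OF z, of n]
          by (simp add: abs_of_pos)
        then have "M * (norm (radial_seq z m - radial_seq z n) + (1 - norm (radial_seq z m)) + (1 - norm (radial_seq z n))) < M * (4 * (e / (4 * M)))"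
          using M(1) by (intro mult_strict_left_mono) auto
        moreover have "M * (4 * (e / (4 * M))) = e" using M(1) by simp
        ultimately show ?thesis
          using M(2)[OF radial_seq_in_disc[OF z, of m] radial_seq_in_disc[OF z, of n]] by linarith
      qed
      then show "\<exists>N. \<forall>m\<ge>N. \<forall>n\<ge>N. norm (\<Phi> (radial_seq z m) - \<Phi> (radial_seq z n)) < e" by blast
    qed
  qed
  define F where "F = (\<lambda>z\<in>cball 0 1. lim (\<lambda>n. \<Phi> (radial_seq z n)))"
  have F: "(\<lambda>n. \<Phi> (radial_seq z n)) \<longlonglongrightarrow> F z" if "norm z \<le> 1" for z
    using conv[OF that] that by (simp add: F_def convergent_LIMSEQ_iff)
  have F\<Phi>: "F z = \<Phi> z" if "norm z < 1" for z
    by (rule LIMSEQ_unique[OF F isCont_tendsto_compose[OF cont[OF that] radial_seq_tendsto]]) (use that in simp)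
  have FM: "norm (F z - F w) \<le> M * (norm (z - w) + (1 - norm z) + (1 - norm w))"
    if zw: "norm z \<le> 1" "norm w \<le> 1" for z w
  proof (rule LIMSEQ_le)
    show "(\<lambda>n. norm (\<Phi> (radial_seq z n) - \<Phi> (radial_seq w n))) \<longlonglongrightarrow> norm (F z - F w)"
      by (intro tendsto_intros F zw)
    show "(\<lambda>n. M * (norm (radial_seq z n - radial_seq w n) + (1 - norm (radial_seq z n)) + (1 - norm (radial_seq w n))))
        \<longlonglongrightarrow> M * (norm (z - w) + (1 - norm z) + (1 - norm w))"
      by (intro tendsto_intros radial_seq_tendsto)
    show "\<exists>N. \<forall>n\<ge>N. norm (\<Phi> (radial_seq z n) - \<Phi> (radial_seq w n))
        \<le> M * (norm (radial_seq z n - radial_seq w n) + (1 - norm (radial_seq z n)) + (1 - norm (radial_seq w n)))"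
      by (intro exI[of _ 0] allI impI M(2) radial_seq_in_disc zw)
  qed
  show thesis
  proof (rule that)
    show "F \<in> extensional (cball 0 1)" by (simp add: F_def)
    show "F z = \<Phi> z" if "z \<in> \<bbbD>" for z using F\<Phi> that by simp
    show "1 \<le> max 1 M" by simp
    show "norm (F z - F w) \<le> max 1 M * norm (z - w)" if "z \<in> \<bbbT>" "w \<in> \<bbbT>" for z w
    proof -
      have "norm (F z - F w) \<le> M * norm (z - w)" using FM[of z w] that by simp
      also have "\<dots> \<le> max 1 M * norm (z - w)" by (intro mult_right_mono) auto
      finally show ?thesis .
    qed
    show "F z \<in> \<bbbT>" if "z \<in> \<bbbT>" for z
    proof -
      have z: "norm z = 1" using that by simp
      have lim1: "(\<lambda>n. 1 - (norm (\<Phi> (radial_seq z n)))\<^sup>2) \<longlonglongrightarrow> 1 - (norm (F z))\<^sup>2"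
        by (intro tendsto_intros F) (simp add: z)
      have lim2: "(\<lambda>n. C * (1 - (norm (radial_seq z n))\<^sup>2)) \<longlonglongrightarrow> C * (1 - (norm z)\<^sup>2)"
        by (intro tendsto_intros radial_seq_tendsto)
      have "1 - (norm (F z))\<^sup>2 \<le> C * (1 - (norm z)\<^sup>2)"
        by (rule LIMSEQ_le[OF lim1 lim2]) (intro exI[of _ 0] allI impI cC(3) radial_seq_in_disc, simp add: z)
      moreover have "0 \<le> 1 - (norm (F z))\<^sup>2"
      proof (rule LIMSEQ_le_const[OF lim1], intro exI[of _ 0] allI impI less_imp_le one_minus_norm_sq_pos)
        fix n show "norm (\<Phi> (radial_seq z n)) < 1"
          using P_c_in_disc[OF \<Phi>, of "radial_seq z n"] radial_seq_in_disc[of z n] z by simp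
      qed
      ultimately have "(norm (F z))\<^sup>2 = 1" using z by simp
      then show ?thesis by (simp add: power2_eq_1_iff) (smt (verit) norm_ge_zero)
    qed
    show "continuous_on (cball 0 1) F"
      unfolding continuous_on_eq_continuous_within
    proof
      fix z :: complex assume z: "z \<in> cball 0 1"
      show "continuous (at z within cball 0 1) F"
      proof (cases "norm z < 1")
        case True
        have "continuous_on \<bbbD> F"
          by (rule continuous_on_eq[OF carleson_maps_continuous[OF P_c_carleson[OF \<Phi>]]]) (simp add: F\<Phi>)
        then have "isCont F z" using True by (simp add: continuous_on_eq_continuous_at)
        then show ?thesis by (rule continuous_at_imp_continuous_at_within)
      next
        case False
        then have z1: "norm z = 1" using z by simp
        have "norm (F w - F z) \<le> 2 * M * norm (w - z)" if "norm w \<le> 1" for w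
        proof -
          have "1 - norm w \<le> norm (w - z)" using norm_triangle_ineq2[of z w] z1 by (simp add: norm_minus_commute)
          then have "norm (w - z) + (1 - norm w) + (1 - norm z) \<le> 2 * norm (w - z)" using z1 by simp
          then have "M * (norm (w - z) + (1 - norm w) + (1 - norm z)) \<le> M * (2 * norm (w - z))"
            using M(1) by (intro mult_left_mono) auto
          then show ?thesis using FM[of w z] that z1 by simp
        qed
        then have "\<forall>\<^sub>F w in at z within cball 0 1. norm (F w - F z) \<le> 2 * M * norm (w - z)"
          by (auto simp: eventually_at_filter)
        moreover have "((\<lambda>w. 2 * M * norm (w - z)) \<longlongrightarrow> 2 * M * norm (z - z)) (at z within cball 0 1)"
          by (intro tendsto_intros)
        then have "((\<lambda>w. 2 * M * norm (w - z)) \<longlongrightarrow> 0) (at z within cball 0 1)" by simp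
        ultimately have "((\<lambda>w. F w - F z) \<longlongrightarrow> 0) (at z within cball 0 1)"
          by (rule Lim_null_comparison)
        then show ?thesis unfolding continuous_within by (rule Lim_null[THEN iffD2])
      qed
    qed
  qed
qed

text \<open>
  The extensions of \<open>\<Phi>\<close> and of its inverse are inverse to each other, since they are so on the dense
  open disc.
\<close>

lemma P_c_homeomorphic_extension:
  assumes \<Phi>: "\<Phi> \<in> P_c"
  obtains F where "F \<in> extensional (cball 0 1)" "\<exists>G. homeomorphism (cball 0 1) (cball 0 1) F G"
    "\<And>z. z \<in> \<bbbD> \<Longrightarrow> F z = \<Phi> z" "restrict F \<bbbT> \<in> BiLip"
proof -
  obtain F M where F: "F \<in> extensional (cball 0 1)" "\<And>z. z \<in> \<bbbD> \<Longrightarrow> F z = \<Phi> z"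
    "continuous_on (cball 0 1) F" "\<And>z. z \<in> \<bbbT> \<Longrightarrow> F z \<in> \<bbbT>" "1 \<le> M"
    "\<And>z w. z \<in> \<bbbT> \<Longrightarrow> w \<in> \<bbbT> \<Longrightarrow> norm (F z - F w) \<le> M * norm (z - w)"
    by (rule P_c_closed_extension[OF \<Phi>]) (rule that)
  obtain G N where G: "G \<in> extensional (cball 0 1)" "\<And>z. z \<in> \<bbbD> \<Longrightarrow> G z = disc_inv \<Phi> z"
    "continuous_on (cball 0 1) G" "\<And>z. z \<in> \<bbbT> \<Longrightarrow> G z \<in> \<bbbT>" "1 \<le> N"
    "\<And>z w. z \<in> \<bbbT> \<Longrightarrow> w \<in> \<bbbT> \<Longrightarrow> norm (G z - G w) \<le> N * norm (z - w)"
    by (rule P_c_closed_extension[OF disc_inv_P_c[OF \<Phi>]]) (rule that)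
  have split: "z \<in> \<bbbD> \<or> z \<in> \<bbbT>" if "z \<in> cball 0 1" for z :: complex using that by auto
  have Fin: "F z \<in> cball 0 1" if "z \<in> cball 0 1" for z
    using split[OF that] F(2)[of z] P_c_in_disc[OF \<Phi>, of z] F(4)[of z] by force
  have Gin: "G z \<in> cball 0 1" if "z \<in> cball 0 1" for z
    using split[OF that] G(2)[of z] disc_inv_in_disc[OF \<Phi>, of z] G(4)[of z] by force
  have GF: "G (F z) = z" if z: "z \<in> cball 0 1" for z
  proof (rule continuous_cball_eqI[OF _ _ _ z])
    show "continuous_on (cball 0 1) (\<lambda>z. G (F z))"
      by (rule continuous_on_compose2[OF G(3) F(3)]) (use Fin in blast)
    show "G (F u) = u" if "u \<in> \<bbbD>" for u
      using F(2)[OF that] G(2)[OF P_c_in_disc[OF \<Phi> that]] disc_inv_left[OF \<Phi> that] by simp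
  qed simp
  have FG: "F (G z) = z" if z: "z \<in> cball 0 1" for z
  proof (rule continuous_cball_eqI[OF _ _ _ z])
    show "continuous_on (cball 0 1) (\<lambda>z. F (G z))"
      by (rule continuous_on_compose2[OF F(3) G(3)]) (use Gin in blast)
    show "F (G u) = u" if "u \<in> \<bbbD>" for u
      using G(2)[OF that] F(2)[OF disc_inv_in_disc[OF \<Phi> that]] disc_inv_right[OF \<Phi> that] by simp
  qed simp
  show thesis
  proof (rule that[OF F(1) _ F(2)])
    have "homeomorphism (cball 0 1) (cball 0 1) F G"
      by (rule homeomorphismI) (use F(3) G(3) Fin Gin FG GF in auto)
    then show "\<exists>G. homeomorphism (cball 0 1) (cball 0 1) F G" by blast
    have "restrict F \<bbbT> ` \<bbbT> = \<bbbT>"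
    proof
      show "restrict F \<bbbT> ` \<bbbT> \<subseteq> \<bbbT>" using F(4) by auto
      show "\<bbbT> \<subseteq> restrict F \<bbbT> ` \<bbbT>"
      proof
        fix z :: complex assume z: "z \<in> \<bbbT>"
        then have "restrict F \<bbbT> (G z) = z" using FG[of z] G(4)[OF z] by simp
        then show "z \<in> restrict F \<bbbT> ` \<bbbT>" using G(4)[OF z] by (metis imageI)
      qed
    qed
    moreover have "norm (z - w) \<le> max M N * norm (F z - F w) \<and> norm (F z - F w) \<le> max M N * norm (z - w)"
      if zw: "z \<in> \<bbbT>" "w \<in> \<bbbT>" for z w
    proof
      have "norm (z - w) \<le> N * norm (F z - F w)"
        using G(6)[OF F(4)[OF zw(1)] F(4)[OF zw(2)]] GF[of z] GF[of w] zw by simp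
      also have "\<dots> \<le> max M N * norm (F z - F w)" by (intro mult_right_mono) auto
      finally show "norm (z - w) \<le> max M N * norm (F z - F w)" .
      have "norm (F z - F w) \<le> M * norm (z - w)" by (rule F(6)[OF zw])
      also have "\<dots> \<le> max M N * norm (z - w)" by (intro mult_right_mono) auto
      finally show "norm (F z - F w) \<le> max M N * norm (z - w)" .
    qed
    moreover have "1 \<le> max M N" using F(5) by simp
    ultimately show "restrict F \<bbbT> \<in> BiLip"
      unfolding BiLip_iff by (intro conjI exI[of _ "max M N"]) auto
  qed
qed

section \<open>The boundary map\<close>

lemma closed_disc_extension_eqI:
  assumes F: "F \<in> extensional (cball 0 1)" "\<exists>G. homeomorphism (cball 0 1) (cball 0 1) F G"
    and FD: "\<And>z. z \<in> \<bbbD> \<Longrightarrow> F z = \<Phi> z"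
  shows "closed_disc_extension \<Phi> = F"
  unfolding closed_disc_extension_def
proof (rule the_equality)
  show "F \<in> extensional (cball 0 1) \<and> (\<exists>G. homeomorphism (cball 0 1) (cball 0 1) F G) \<and> (\<forall>z\<in>\<bbbD>. F z = \<Phi> z)"
    using F FD by blast
  fix F' assume F': "F' \<in> extensional (cball 0 1) \<and> (\<exists>G. homeomorphism (cball 0 1) (cball 0 1) F' G) \<and> (\<forall>z\<in>\<bbbD>. F' z = \<Phi> z)"
  have cont: "continuous_on (cball 0 1) F" "continuous_on (cball 0 1) F'"
    using F(2) F' by (auto simp: homeomorphism_def)
  show "F' = F"
  proof (rule extensionalityI[of _ "cball 0 1"])
    show "F' z = F z" if "z \<in> cball 0 1" for z
      by (rule continuous_cball_eqI[OF cont(2,1) _ that]) (use F' FD in simp)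
  qed (use F F' in auto)
qed

lemma closed_disc_extension_P_c:
  assumes \<Phi>: "\<Phi> \<in> P_c"
  shows "closed_disc_extension \<Phi> \<in> extensional (cball 0 1)"
    and "\<exists>G. homeomorphism (cball 0 1) (cball 0 1) (closed_disc_extension \<Phi>) G"
    and "\<And>z. z \<in> \<bbbD> \<Longrightarrow> closed_disc_extension \<Phi> z = \<Phi> z"
    and "boundary_map \<Phi> \<in> BiLip"
proof -
  obtain F where F: "F \<in> extensional (cball 0 1)" "\<exists>G. homeomorphism (cball 0 1) (cball 0 1) F G"
    "\<And>z. z \<in> \<bbbD> \<Longrightarrow> F z = \<Phi> z" "restrict F \<bbbT> \<in> BiLip"
    by (rule P_c_homeomorphic_extension[OF \<Phi>]) (rule that)
  have eq: "closed_disc_extension \<Phi> = F" by (rule closed_disc_extension_eqI[OF F(1-3)])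
  show "closed_disc_extension \<Phi> \<in> extensional (cball 0 1)"
    "\<exists>G. homeomorphism (cball 0 1) (cball 0 1) (closed_disc_extension \<Phi>) G"
    "\<And>z. z \<in> \<bbbD> \<Longrightarrow> closed_disc_extension \<Phi> z = \<Phi> z"
    "boundary_map \<Phi> \<in> BiLip"
    unfolding boundary_map_def eq by (fact F)+
qed

lemma boundary_map_eq: "\<zeta> \<in> \<bbbT> \<Longrightarrow> boundary_map \<Phi> \<zeta> = closed_disc_extension \<Phi> \<zeta>"
  by (simp add: boundary_map_def)

lemma boundary_map_compose:
  assumes \<Phi>: "\<Phi> \<in> P_c" and \<Psi>: "\<Psi> \<in> P_c"
  shows "boundary_map (compose \<bbbD> \<Phi> \<Psi>) = compose \<bbbT> (boundary_map \<Phi>) (boundary_map \<Psi>)"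
proof -
  let ?F = "closed_disc_extension \<Phi>" and ?G = "closed_disc_extension \<Psi>"
  have ext: "closed_disc_extension (compose \<bbbD> \<Phi> \<Psi>) = compose (cball 0 1) ?F ?G"
  proof (rule closed_disc_extension_eqI)
    obtain F' G' where "homeomorphism (cball 0 1) (cball 0 1) ?F F'" "homeomorphism (cball 0 1) (cball 0 1) ?G G'"
      using closed_disc_extension_P_c(2)[OF \<Phi>] closed_disc_extension_P_c(2)[OF \<Psi>] by blast
    then have "homeomorphism (cball 0 1) (cball 0 1) (?F \<circ> ?G) (G' \<circ> F')"
      by (rule homeomorphism_compose[rotated])
    then have "homeomorphism (cball 0 1) (cball 0 1) (compose (cball 0 1) ?F ?G) (G' \<circ> F')"
      by (rule homeomorphism_cong) (auto simp: compose_eq)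
    then show "\<exists>H. homeomorphism (cball 0 1) (cball 0 1) (compose (cball 0 1) ?F ?G) H" by blast
    show "compose (cball 0 1) ?F ?G z = compose \<bbbD> \<Phi> \<Psi> z" if "z \<in> \<bbbD>" for z
      using closed_disc_extension_P_c(3)[OF \<Psi> that]
        closed_disc_extension_P_c(3)[OF \<Phi> P_c_in_disc[OF \<Psi> that]] that
      by (simp add: compose_eq)
  qed simp
  show ?thesis
  proof (rule extensionalityI[of _ \<bbbT>])
    fix \<zeta> :: complex assume \<zeta>: "\<zeta> \<in> \<bbbT>"
    have "?G \<zeta> \<in> \<bbbT>"
      using BiLip_in_circle[OF closed_disc_extension_P_c(4)[OF \<Psi>] \<zeta>] \<zeta> by (simp add: boundary_map_eq)
    then show "boundary_map (compose \<bbbD> \<Phi> \<Psi>) \<zeta> = compose \<bbbT> (boundary_map \<Phi>) (boundary_map \<Psi>) \<zeta>"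
      using \<zeta> by (simp add: boundary_map_eq compose_eq ext)
  qed (simp_all add: boundary_map_def)
qed

lemma boundary_map_radial_ext:
  assumes h: "h \<in> BiLip"
  shows "boundary_map (radial_ext h) = h"
proof (rule extensionalityI[of _ \<bbbT>])
  fix \<zeta> :: complex assume \<zeta>: "\<zeta> \<in> \<bbbT>"
  let ?F = "closed_disc_extension (radial_ext h)"
  note E = closed_disc_extension_P_c[OF radial_ext_P_c[OF h]]
  have cont: "continuous_on (cball 0 1) ?F" using E(2) by (auto simp: homeomorphism_def)
  have "?F \<zeta> = h \<zeta>"
  proof (rule LIMSEQ_unique)
    have disc: "radial_seq \<zeta> n \<in> \<bbbD>" for n using radial_seq_in_disc[of \<zeta> n] \<zeta> by simp
    show "(\<lambda>n. ?F (radial_seq \<zeta> n)) \<longlonglongrightarrow> ?F \<zeta>"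
    proof (rule continuous_on_tendsto_compose[OF cont radial_seq_tendsto])
      show "\<zeta> \<in> cball 0 1" using \<zeta> by simp
      show "\<forall>\<^sub>F n in sequentially. radial_seq \<zeta> n \<in> cball 0 1"
      proof (intro always_eventually allI)
        show "radial_seq \<zeta> n \<in> cball 0 1" for n using disc[of n] by simp
      qed
    qed
    have "?F (radial_seq \<zeta> n) = radial_seq (h \<zeta>) n" for n
    proof -
      have "?F (radial_seq \<zeta> n) = radial_ext h (radial_seq \<zeta> n)" by (rule E(3)[OF disc])
      also have "\<dots> = radial_seq (h \<zeta>) n"
        unfolding radial_seq_def by (rule radial_ext_polar[OF \<zeta>]) auto
      finally show ?thesis .
    qed
    then show "(\<lambda>n. ?F (radial_seq \<zeta> n)) \<longlonglongrightarrow> h \<zeta>" using radial_seq_tendsto[of "h \<zeta>"] by simp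
  qed
  then show "boundary_map (radial_ext h) \<zeta> = h \<zeta>" using \<zeta> by (simp add: boundary_map_eq)
qed (use h in \<open>auto simp: boundary_map_def BiLip_def\<close>)

lemma K_c_P_c: "\<Psi> \<in> K_c \<Longrightarrow> \<Psi> \<in> P_c"
  by (simp add: K_c_def)

lemma K_cI: "\<Psi> \<in> P_c \<Longrightarrow> boundary_map \<Psi> = (\<lambda>\<zeta>\<in>\<bbbT>. \<zeta>) \<Longrightarrow> \<Psi> \<in> K_c"
  by (simp add: K_c_def)

lemma K_c_boundary: "\<Psi> \<in> K_c \<Longrightarrow> boundary_map \<Psi> = (\<lambda>\<zeta>\<in>\<bbbT>. \<zeta>)"
  by (simp add: K_c_def)

lemma BiLip_extensional: "h \<in> BiLip \<Longrightarrow> h \<in> extensional \<bbbT>"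
  by (simp add: BiLip_def)

lemma BiLip_compose_id:
  assumes "h \<in> BiLip"
  shows "compose \<bbbT> (\<lambda>\<zeta>\<in>\<bbbT>. \<zeta>) h = h" "compose \<bbbT> h (\<lambda>\<zeta>\<in>\<bbbT>. \<zeta>) = h"
  using Id_compose[of h \<bbbT> \<bbbT>] compose_Id[of h \<bbbT> \<bbbT>] BiLip_extensional[OF assms] BiLip_in_circle[OF assms]
  by (auto simp: Pi_iff)

section \<open>Groups of maps under composition\<close>

lemma composition_group_simps [simp]:
  "carrier (composition_group S M) = M"
  "f \<otimes>\<^bsub>composition_group S M\<^esub> g = compose S f g"
  "\<one>\<^bsub>composition_group S M\<^esub> = (\<lambda>x\<in>S. x)"
  by (simp_all add: composition_group_def)

lemma group_composition_group:
  assumes M: "M \<subseteq> Bij S" and one: "(\<lambda>x\<in>S. x) \<in> M"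
    and closed: "\<And>f g. f \<in> M \<Longrightarrow> g \<in> M \<Longrightarrow> compose S f g \<in> M"
    and inv: "\<And>f. f \<in> M \<Longrightarrow> restrict (inv_into S f) S \<in> M"
  shows "group (composition_group S M)"
proof (rule groupI)
  have MS: "f \<in> S \<rightarrow> S" "f \<in> extensional S" if "f \<in> M" for f
    using M that Bij_imp_funcset Bij_imp_extensional by blast+
  show "(x \<otimes>\<^bsub>composition_group S M\<^esub> y) \<otimes>\<^bsub>composition_group S M\<^esub> z
      = x \<otimes>\<^bsub>composition_group S M\<^esub> (y \<otimes>\<^bsub>composition_group S M\<^esub> z)"
    if "x \<in> carrier (composition_group S M)" "y \<in> carrier (composition_group S M)"
      "z \<in> carrier (composition_group S M)" for x y z
    using compose_assoc[OF MS(1), of z x y] that by simp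
  show "\<one>\<^bsub>composition_group S M\<^esub> \<otimes>\<^bsub>composition_group S M\<^esub> x = x"
    if "x \<in> carrier (composition_group S M)" for x
    using Id_compose[OF MS, of x] that by simp
  show "\<exists>y\<in>carrier (composition_group S M). y \<otimes>\<^bsub>composition_group S M\<^esub> x = \<one>\<^bsub>composition_group S M\<^esub>"
    if "x \<in> carrier (composition_group S M)" for x
  proof -
    have x: "x \<in> M" using that by simp
    then have "x \<in> Bij S" using M by blast
    from Bij_compose_restrict_eq[OF this] inv[OF x] show ?thesis
      unfolding composition_group_simps by blast
  qed
  show "x \<otimes>\<^bsub>composition_group S M\<^esub> y \<in> carrier (composition_group S M)"
    if "x \<in> carrier (composition_group S M)" "y \<in> carrier (composition_group S M)" for x y
    using closed that unfolding composition_group_simps by blast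
  show "\<one>\<^bsub>composition_group S M\<^esub> \<in> carrier (composition_group S M)"
    unfolding composition_group_simps by (rule one)
qed

lemma group_P_c: "group P_c_group"
  by (rule group_composition_group[OF subsetI[OF P_c_Bij] id_P_c compose_P_c disc_inv_P_c[unfolded disc_inv_def]])

lemma group_BiLip: "group BiLip_group"
  by (rule group_composition_group[OF subsetI[OF BiLip_Bij] id_BiLip compose_BiLip circle_inv_BiLip[unfolded circle_inv_def]])

lemma id_K_c: "(\<lambda>z\<in>\<bbbD>. z) \<in> K_c"
  by (rule K_cI[OF id_P_c boundary_map_radial_ext[OF id_BiLip, unfolded radial_ext_id]])

lemma compose_K_c: "\<Phi> \<in> K_c \<Longrightarrow> \<Psi> \<in> K_c \<Longrightarrow> compose \<bbbD> \<Phi> \<Psi> \<in> K_c"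
proof (rule K_cI)
  assume K: "\<Phi> \<in> K_c" "\<Psi> \<in> K_c"
  note P = K_c_P_c[OF K(1)] K_c_P_c[OF K(2)]
  show "compose \<bbbD> \<Phi> \<Psi> \<in> P_c" by (rule compose_P_c[OF P])
  show "boundary_map (compose \<bbbD> \<Phi> \<Psi>) = (\<lambda>\<zeta>\<in>\<bbbT>. \<zeta>)"
    unfolding boundary_map_compose[OF P] K_c_boundary[OF K(1)] K_c_boundary[OF K(2)]
    by (rule BiLip_compose_id(1)[OF id_BiLip])
qed

lemma disc_inv_K_c:
  assumes \<Psi>: "\<Psi> \<in> K_c"
  shows "disc_inv \<Psi> \<in> K_c"
proof (rule K_cI)
  note P = K_c_P_c[OF \<Psi>]
  show inv: "disc_inv \<Psi> \<in> P_c" by (rule disc_inv_P_c[OF P])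
  have "compose \<bbbD> (disc_inv \<Psi>) \<Psi> = (\<lambda>z\<in>\<bbbD>. z)"
    unfolding disc_inv_def by (rule Bij_compose_restrict_eq[OF P_c_Bij[OF P]])
  then have "compose \<bbbT> (boundary_map (disc_inv \<Psi>)) (boundary_map \<Psi>) = (\<lambda>\<zeta>\<in>\<bbbT>. \<zeta>)"
    using boundary_map_compose[OF inv P] K_c_boundary[OF id_K_c] by simp
  then show "boundary_map (disc_inv \<Psi>) = (\<lambda>\<zeta>\<in>\<bbbT>. \<zeta>)"
    using BiLip_compose_id(2)[OF closed_disc_extension_P_c(4)[OF inv]] K_c_boundary[OF \<Psi>] by simp
qed

lemma group_K_c: "group K_c_group"
  by (rule group_composition_group[OF subsetI[OF P_c_Bij[OF K_c_P_c]] id_K_c compose_K_c disc_inv_K_c[unfolded disc_inv_def]])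

lemma circle_inv_compose:
  assumes h: "h \<in> BiLip" and g: "g \<in> BiLip"
  shows "circle_inv (compose \<bbbT> h g) = compose \<bbbT> (circle_inv g) (circle_inv h)"
proof -
  interpret group BiLip_group by (rule group_BiLip)
  have inv: "inv\<^bsub>BiLip_group\<^esub> f = circle_inv f" if "f \<in> BiLip" for f
    using that compose_circle_inv(2)[OF that] circle_inv_BiLip[OF that] by (intro inv_equality) auto
  have "inv\<^bsub>BiLip_group\<^esub> (compose \<bbbT> h g) = compose \<bbbT> (inv\<^bsub>BiLip_group\<^esub> g) (inv\<^bsub>BiLip_group\<^esub> h)"
    using inv_mult_group[of h g] h g by simp
  then show ?thesis using inv h g compose_BiLip[OF h g] by simp
qed

section \<open>Factorization\<close>

text \<open>
  This gives the uniqueness of \<open>h\<close>: the boundary values see only the radial factor.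
\<close>

lemma boundary_map_factors:
  assumes \<Psi>: "\<Psi> \<in> K_c" and h: "h \<in> BiLip"
  shows "boundary_map (compose \<bbbD> \<Psi> (radial_ext h)) = h"
  unfolding boundary_map_compose[OF K_c_P_c[OF \<Psi>] radial_ext_P_c[OF h]] boundary_map_radial_ext[OF h]
    K_c_boundary[OF \<Psi>] by (rule BiLip_compose_id(1)[OF h])

lemma radial_ext_in_disc: "h \<in> BiLip \<Longrightarrow> z \<in> \<bbbD> \<Longrightarrow> radial_ext h z \<in> \<bbbD>"
  using P_c_in_disc[OF radial_ext_P_c] by blast

lemma compose_radial_ext_cancel:
  assumes \<Phi>: "\<Phi> \<in> extensional \<bbbD>" and h: "h \<in> BiLip"
  shows "compose \<bbbD> (compose \<bbbD> \<Phi> (radial_ext h)) (radial_ext (circle_inv h)) = \<Phi>"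
    and "compose \<bbbD> (compose \<bbbD> \<Phi> (radial_ext (circle_inv h))) (radial_ext h) = \<Phi>"
proof -
  show "compose \<bbbD> (compose \<bbbD> \<Phi> (radial_ext h)) (radial_ext (circle_inv h)) = \<Phi>"
  proof (rule extensionalityI[OF compose_extensional \<Phi>])
    fix z assume z: "z \<in> \<bbbD>"
    show "compose \<bbbD> (compose \<bbbD> \<Phi> (radial_ext h)) (radial_ext (circle_inv h)) z = \<Phi> z"
      unfolding compose_eq[OF z] compose_eq[OF radial_ext_in_disc[OF circle_inv_BiLip[OF h] z]]
        radial_ext_inverse(1)[OF h z] ..
  qed
  show "compose \<bbbD> (compose \<bbbD> \<Phi> (radial_ext (circle_inv h))) (radial_ext h) = \<Phi>"
  proof (rule extensionalityI[OF compose_extensional \<Phi>])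
    fix z assume z: "z \<in> \<bbbD>"
    show "compose \<bbbD> (compose \<bbbD> \<Phi> (radial_ext (circle_inv h))) (radial_ext h) z = \<Phi> z"
      unfolding compose_eq[OF z] compose_eq[OF radial_ext_in_disc[OF h z]]
        radial_ext_inverse(2)[OF h z] ..
  qed
qed

lemma P_c_factorization:
  assumes \<Phi>: "\<Phi> \<in> P_c"
  defines "h \<equiv> boundary_map \<Phi>"
  shows "h \<in> BiLip" "compose \<bbbD> \<Phi> (radial_ext (circle_inv h)) \<in> K_c"
    "\<Phi> = compose \<bbbD> (compose \<bbbD> \<Phi> (radial_ext (circle_inv h))) (radial_ext h)"
proof -
  show h: "h \<in> BiLip" unfolding h_def by (rule closed_disc_extension_P_c(4)[OF \<Phi>])
  note E = radial_ext_P_c[OF circle_inv_BiLip[OF h]]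
  show "compose \<bbbD> \<Phi> (radial_ext (circle_inv h)) \<in> K_c"
  proof (rule K_cI[OF compose_P_c[OF \<Phi> E]])
    have "boundary_map (compose \<bbbD> \<Phi> (radial_ext (circle_inv h))) = compose \<bbbT> h (circle_inv h)"
      unfolding h_def[symmetric] boundary_map_compose[OF \<Phi> E] boundary_map_radial_ext[OF circle_inv_BiLip[OF h]] ..
    then show "boundary_map (compose \<bbbD> \<Phi> (radial_ext (circle_inv h))) = (\<lambda>\<zeta>\<in>\<bbbT>. \<zeta>)"
      by (simp only: compose_circle_inv(1)[OF h])
  qed
  show "\<Phi> = compose \<bbbD> (compose \<bbbD> \<Phi> (radial_ext (circle_inv h))) (radial_ext h)"
    by (rule compose_radial_ext_cancel(2)[OF P_c_extensional[OF \<Phi>] h, symmetric])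
qed

section \<open>The action and the semidirect product\<close>

lemma alpha_apply:
  assumes "h \<in> BiLip" "\<Psi> \<in> K_c" "z \<in> \<bbbD>"
  shows "alpha h \<Psi> z = radial_ext h (\<Psi> (radial_ext (circle_inv h) z))"
  using assms by (simp add: alpha_def compose_eq)

lemma alpha_K_c:
  assumes h: "h \<in> BiLip" and \<Psi>: "\<Psi> \<in> K_c"
  shows "alpha h \<Psi> \<in> K_c"
proof -
  note E = radial_ext_P_c[OF h] and E' = radial_ext_P_c[OF circle_inv_BiLip[OF h]]
  note P = compose_P_c[OF K_c_P_c[OF \<Psi>] E']
  have "boundary_map (compose \<bbbD> (radial_ext h) (compose \<bbbD> \<Psi> (radial_ext (circle_inv h)))) = (\<lambda>\<zeta>\<in>\<bbbT>. \<zeta>)"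
    using boundary_map_compose[OF E P] boundary_map_factors[OF \<Psi> circle_inv_BiLip[OF h]]
      boundary_map_radial_ext[OF h] compose_circle_inv(1)[OF h] by simp
  then show ?thesis using compose_P_c[OF E P] \<Psi> by (simp add: alpha_def K_cI)
qed

lemma K_c_eqI:
  assumes "\<Phi> \<in> K_c" "\<Psi> \<in> K_c" "\<And>z. z \<in> \<bbbD> \<Longrightarrow> \<Phi> z = \<Psi> z"
  shows "\<Phi> = \<Psi>"
  using assms P_c_extensional[OF K_c_P_c] by (intro extensionalityI[of _ \<bbbD>]) auto

lemma alpha_compose:
  assumes h: "h \<in> BiLip" and g: "g \<in> BiLip" and \<Psi>: "\<Psi> \<in> K_c"
  shows "alpha (compose \<bbbT> h g) \<Psi> = alpha h (alpha g \<Psi>)"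
proof (rule K_c_eqI)
  fix z assume z: "z \<in> \<bbbD>"
  note ih = circle_inv_BiLip[OF h] and ig = circle_inv_BiLip[OF g]
  have comp: "radial_ext (compose \<bbbT> f k) u = radial_ext f (radial_ext k u)" if "k \<in> BiLip" "u \<in> \<bbbD>" for f k u
    using fun_cong[OF radial_ext_compose[OF that(1), of f], of u] that(2) by (simp add: compose_eq)
  let ?u = "radial_ext (circle_inv h) z"
  have u: "?u \<in> \<bbbD>" by (rule radial_ext_in_disc[OF ih z])
  have v: "\<Psi> (radial_ext (circle_inv g) ?u) \<in> \<bbbD>"
    by (rule P_c_in_disc[OF K_c_P_c[OF \<Psi>] radial_ext_in_disc[OF ig u]])
  show "alpha (compose \<bbbT> h g) \<Psi> z = alpha h (alpha g \<Psi>) z"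
    unfolding alpha_apply[OF compose_BiLip[OF h g] \<Psi> z] alpha_apply[OF h alpha_K_c[OF g \<Psi>] z]
      alpha_apply[OF g \<Psi> u] circle_inv_compose[OF h g] comp[OF ih z] comp[OF g v] ..
qed (use assms alpha_K_c compose_BiLip in blast)+

lemma alpha_id: "\<Psi> \<in> K_c \<Longrightarrow> alpha (\<lambda>\<zeta>\<in>\<bbbT>. \<zeta>) \<Psi> = \<Psi>"
proof -
  assume \<Psi>: "\<Psi> \<in> K_c"
  have "circle_inv (\<lambda>\<zeta>\<in>\<bbbT>. \<zeta>) = (\<lambda>\<zeta>\<in>\<bbbT>. \<zeta>)"
    using compose_circle_inv(1)[OF id_BiLip] BiLip_compose_id(1)[OF circle_inv_BiLip[OF id_BiLip]] by simp
  then show ?thesis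
    using alpha_apply[OF id_BiLip \<Psi>] P_c_in_disc[OF K_c_P_c[OF \<Psi>]]
    by (intro K_c_eqI alpha_K_c id_BiLip \<Psi>) (simp add: radial_ext_id)
qed

lemma alpha_mult:
  assumes h: "h \<in> BiLip" and \<Phi>: "\<Phi> \<in> K_c" and \<Psi>: "\<Psi> \<in> K_c"
  shows "alpha h (compose \<bbbD> \<Phi> \<Psi>) = compose \<bbbD> (alpha h \<Phi>) (alpha h \<Psi>)"
proof (rule K_c_eqI)
  fix z assume z: "z \<in> \<bbbD>"
  let ?u = "radial_ext (circle_inv h) z"
  have u: "?u \<in> \<bbbD>" by (rule radial_ext_in_disc[OF circle_inv_BiLip[OF h] z])
  have v: "\<Psi> ?u \<in> \<bbbD>" by (rule P_c_in_disc[OF K_c_P_c[OF \<Psi>] u])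
  have "alpha h \<Phi> (radial_ext h (\<Psi> ?u)) = radial_ext h (\<Phi> (\<Psi> ?u))"
    unfolding alpha_apply[OF h \<Phi> radial_ext_in_disc[OF h v]] radial_ext_inverse(2)[OF h v] ..
  then show "alpha h (compose \<bbbD> \<Phi> \<Psi>) z = compose \<bbbD> (alpha h \<Phi>) (alpha h \<Psi>) z"
    using alpha_apply[OF h compose_K_c[OF \<Phi> \<Psi>] z] alpha_apply[OF h \<Psi> z] z u by (simp add: compose_eq)
qed (use assms alpha_K_c compose_K_c in blast)+

lemma alpha_inverse:
  assumes "h \<in> BiLip" "\<Psi> \<in> K_c"
  shows "alpha (circle_inv h) (alpha h \<Psi>) = \<Psi>" "alpha h (alpha (circle_inv h) \<Psi>) = \<Psi>"
  using alpha_compose[OF circle_inv_BiLip[OF assms(1)] assms] alpha_compose[OF assms(1) circle_inv_BiLip[OF assms(1)] assms(2)]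
    compose_circle_inv[OF assms(1)] alpha_id[OF assms(2)] by simp_all

lemma alpha_auto:
  assumes h: "h \<in> BiLip"
  shows "alpha h \<in> auto K_c_group"
proof -
  have "bij_betw (alpha h) K_c K_c"
    by (rule bij_betw_byWitness[of _ "alpha (circle_inv h)"])
       (use alpha_inverse[OF h] alpha_K_c[OF h] alpha_K_c[OF circle_inv_BiLip[OF h]] in auto)
  moreover have "alpha h \<in> extensional K_c" by (simp add: alpha_def)
  moreover have "alpha h \<in> hom K_c_group K_c_group"
    by (rule homI) (use alpha_K_c[OF h] alpha_mult[OF h] in auto)
  ultimately show ?thesis by (simp add: auto_def Bij_def)
qed

lemma AutoGroup_simps:
  "carrier (AutoGroup G) = auto G"
  "f \<in> auto G \<Longrightarrow> g \<in> auto G \<Longrightarrow> f \<otimes>\<^bsub>AutoGroup G\<^esub> g = compose (carrier G) f g"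
  "\<one>\<^bsub>AutoGroup G\<^esub> = (\<lambda>x\<in>carrier G. x)"
  by (simp_all add: AutoGroup_def BijGroup_def auto_def)

lemma alpha_hom: "alpha \<in> hom BiLip_group (AutoGroup K_c_group)"
proof (rule homI)
  fix h g assume "h \<in> carrier BiLip_group" "g \<in> carrier BiLip_group"
  then have hg: "h \<in> BiLip" "g \<in> BiLip" by simp_all
  have "alpha (compose \<bbbT> h g) = compose K_c (alpha h) (alpha g)"
    by (rule extensionalityI[of _ K_c]) (simp_all add: alpha_compose[OF hg] compose_eq, simp add: alpha_def)
  then show "alpha (h \<otimes>\<^bsub>BiLip_group\<^esub> g) = alpha h \<otimes>\<^bsub>AutoGroup K_c_group\<^esub> alpha g"
    using AutoGroup_simps(2)[OF alpha_auto[OF hg(1)] alpha_auto[OF hg(2)]] by simp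
qed (simp add: AutoGroup_simps alpha_auto)

lemma semidirect_product_simps [simp]:
  "carrier (semidirect_product N H \<theta>) = carrier N \<times> carrier H"
  "(a, h) \<otimes>\<^bsub>semidirect_product N H \<theta>\<^esub> (b, k) = (a \<otimes>\<^bsub>N\<^esub> \<theta> h b, h \<otimes>\<^bsub>H\<^esub> k)"
  "\<one>\<^bsub>semidirect_product N H \<theta>\<^esub> = (\<one>\<^bsub>N\<^esub>, \<one>\<^bsub>H\<^esub>)"
  by (simp_all add: semidirect_product_def)

lemma group_semidirect_product:
  assumes N: "group N" and H: "group H" and \<theta>: "\<theta> \<in> hom H (AutoGroup N)"
  shows "group (semidirect_product N H \<theta>)"
proof -
  interpret N: group N by (rule N)
  interpret H: group H by (rule H)
  have auto: "\<theta> h \<in> auto N" if "h \<in> carrier H" for h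
    using hom_in_carrier[OF \<theta> that] by (simp add: AutoGroup_simps)
  then have \<theta>_hom: "\<theta> h \<in> hom N N" if "h \<in> carrier H" for h
    using that by (simp add: auto_def)
  have \<theta>_in: "\<theta> h a \<in> carrier N" if "h \<in> carrier H" "a \<in> carrier N" for h a
    using hom_in_carrier[OF \<theta>_hom] that by blast
  have \<theta>_mult: "\<theta> h (a \<otimes>\<^bsub>N\<^esub> b) = \<theta> h a \<otimes>\<^bsub>N\<^esub> \<theta> h b" if "h \<in> carrier H" "a \<in> carrier N" "b \<in> carrier N" for h a b
    using hom_mult[OF \<theta>_hom] that by blast
  have \<theta>_comp: "\<theta> (h \<otimes>\<^bsub>H\<^esub> k) a = \<theta> h (\<theta> k a)" if "h \<in> carrier H" "k \<in> carrier H" "a \<in> carrier N" for h k a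
    using hom_mult[OF \<theta> that(1,2)] AutoGroup_simps(2)[OF auto[OF that(1)] auto[OF that(2)]] that(3)
    by (simp add: compose_eq)
  have \<theta>_one: "\<theta> \<one>\<^bsub>H\<^esub> a = a" if "a \<in> carrier N" for a
    using hom_one[OF \<theta> H N.AutoGroup] that by (simp add: AutoGroup_simps)
  show ?thesis
  proof (rule groupI)
    fix x y z assume "x \<in> carrier (semidirect_product N H \<theta>)" "y \<in> carrier (semidirect_product N H \<theta>)"
      "z \<in> carrier (semidirect_product N H \<theta>)"
    then show "x \<otimes>\<^bsub>semidirect_product N H \<theta>\<^esub> y \<otimes>\<^bsub>semidirect_product N H \<theta>\<^esub> z
        = x \<otimes>\<^bsub>semidirect_product N H \<theta>\<^esub> (y \<otimes>\<^bsub>semidirect_product N H \<theta>\<^esub> z)"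
      by (auto simp: \<theta>_comp \<theta>_mult \<theta>_in N.m_assoc H.m_assoc)
  next
    fix x assume x: "x \<in> carrier (semidirect_product N H \<theta>)"
    obtain a h where ah: "x = (a, h)" "a \<in> carrier N" "h \<in> carrier H" using x by auto
    show "\<exists>y\<in>carrier (semidirect_product N H \<theta>). y \<otimes>\<^bsub>semidirect_product N H \<theta>\<^esub> x = \<one>\<^bsub>semidirect_product N H \<theta>\<^esub>"
    proof (rule bexI[of _ "(\<theta> (inv\<^bsub>H\<^esub> h) (inv\<^bsub>N\<^esub> a), inv\<^bsub>H\<^esub> h)"])
      have "\<theta> (inv\<^bsub>H\<^esub> h) (inv\<^bsub>N\<^esub> a) \<otimes>\<^bsub>N\<^esub> \<theta> (inv\<^bsub>H\<^esub> h) a = \<theta> (inv\<^bsub>H\<^esub> h) (inv\<^bsub>N\<^esub> a \<otimes>\<^bsub>N\<^esub> a)"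
        by (rule \<theta>_mult[symmetric]) (use ah in auto)
      also have "\<dots> = \<one>\<^bsub>N\<^esub>" using ah hom_one[OF \<theta>_hom N N, of "inv\<^bsub>H\<^esub> h"] by simp
      finally show "(\<theta> (inv\<^bsub>H\<^esub> h) (inv\<^bsub>N\<^esub> a), inv\<^bsub>H\<^esub> h) \<otimes>\<^bsub>semidirect_product N H \<theta>\<^esub> x = \<one>\<^bsub>semidirect_product N H \<theta>\<^esub>"
        using ah by simp
    qed (use ah \<theta>_in in simp)
  qed (auto simp: \<theta>_in \<theta>_one)
qed

text \<open>
  Multiplicativity is the identity \<open>E\<^sub>h \<circ> \<Phi> = \<alpha>\<^sub>h(\<Phi>) \<circ> E\<^sub>h\<close>.  The inverse of \<open>\<Xi>\<close> reads off the boundary values.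
\<close>

lemma Xi_iso: "Xi \<in> iso (semidirect_product K_c_group BiLip_group alpha) P_c_group"
proof (rule isoI)
  have Xi_eq: "Xi (\<Psi>, h) = compose \<bbbD> \<Psi> (radial_ext h)" for \<Psi> h by (simp add: Xi_def)
  have Xi_P_c: "Xi (\<Psi>, h) \<in> P_c" if "\<Psi> \<in> K_c" "h \<in> BiLip" for \<Psi> h
    using that compose_P_c[OF K_c_P_c radial_ext_P_c] by (simp add: Xi_eq)
  show "Xi \<in> hom (semidirect_product K_c_group BiLip_group alpha) P_c_group"
  proof (rule homI)
    fix x assume "x \<in> carrier (semidirect_product K_c_group BiLip_group alpha)"
    then show "Xi x \<in> carrier P_c_group" using Xi_P_c by auto
  next
    fix x y assume "x \<in> carrier (semidirect_product K_c_group BiLip_group alpha)"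
      "y \<in> carrier (semidirect_product K_c_group BiLip_group alpha)"
    then obtain \<Psi> h \<Phi> g where x: "x = (\<Psi>, h)" "\<Psi> \<in> K_c" "h \<in> BiLip" and y: "y = (\<Phi>, g)" "\<Phi> \<in> K_c" "g \<in> BiLip"
      by auto
    have "Xi (compose \<bbbD> \<Psi> (alpha h \<Phi>), compose \<bbbT> h g) = compose \<bbbD> (Xi x) (Xi y)"
    proof (rule extensionalityI[of _ \<bbbD>])
      fix z assume z: "z \<in> \<bbbD>"
      let ?u = "radial_ext g z"
      have u: "?u \<in> \<bbbD>" by (rule radial_ext_in_disc[OF y(3) z])
      have v: "\<Phi> ?u \<in> \<bbbD>" by (rule P_c_in_disc[OF K_c_P_c[OF y(2)] u])
      have E: "radial_ext (compose \<bbbT> h g) z = radial_ext h ?u"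
        using fun_cong[OF radial_ext_compose[OF y(3), of h], of z] z by (simp add: compose_eq)
      have "alpha h \<Phi> (radial_ext h ?u) = radial_ext h (\<Phi> ?u)"
        unfolding alpha_apply[OF x(3) y(2) radial_ext_in_disc[OF x(3) u]] radial_ext_inverse(2)[OF x(3) u] ..
      then show "Xi (compose \<bbbD> \<Psi> (alpha h \<Phi>), compose \<bbbT> h g) z = compose \<bbbD> (Xi x) (Xi y) z"
        using z v radial_ext_in_disc[OF x(3) u] unfolding x(1) y(1) Xi_eq by (simp only: compose_eq E)
    qed (simp_all add: Xi_eq)
    then show "Xi (x \<otimes>\<^bsub>semidirect_product K_c_group BiLip_group alpha\<^esub> y) = Xi x \<otimes>\<^bsub>P_c_group\<^esub> Xi y"
      by (simp add: x y)
  qed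
  let ?inv = "\<lambda>\<Phi>. (compose \<bbbD> \<Phi> (radial_ext (circle_inv (boundary_map \<Phi>))), boundary_map \<Phi>)"
  have "?inv (Xi x) = x" if in_prod: "x \<in> K_c \<times> BiLip" for x
  proof -
    obtain \<Psi> h where x: "x = (\<Psi>, h)" "\<Psi> \<in> K_c" "h \<in> BiLip" using in_prod by auto
    show ?thesis
      unfolding x(1) Xi_eq boundary_map_factors[OF x(2,3)]
        compose_radial_ext_cancel(1)[OF P_c_extensional[OF K_c_P_c[OF x(2)]] x(3)] ..
  qed
  moreover have "Xi (?inv \<Phi>) = \<Phi>" if "\<Phi> \<in> P_c" for \<Phi>
    unfolding Xi_eq by (rule P_c_factorization(3)[OF that, symmetric])
  ultimately show "bij_betw Xi (carrier (semidirect_product K_c_group BiLip_group alpha)) (carrier P_c_group)"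
    using Xi_P_c P_c_factorization(1,2) by (intro bij_betw_byWitness[of _ ?inv]) auto
qed

theorem corollary3p5:
  shows "(\<forall>\<Phi> \<in> P_c.
            (\<exists>!(\<Psi>, h). \<Psi> \<in> K_c \<and> h \<in> BiLip \<and> \<Phi> = compose \<bbbD> \<Psi> (radial_ext h)) \<and>
            (\<forall>\<Psi> \<in> K_c. \<forall>h \<in> BiLip. \<Phi> = compose \<bbbD> \<Psi> (radial_ext h) \<longrightarrow>
               h = boundary_map \<Phi> \<and> \<Psi> = compose \<bbbD> \<Phi> (radial_ext (circle_inv h)))) \<and>
         group P_c_group \<and> group K_c_group \<and> group BiLip_group \<and>
         alpha \<in> hom BiLip_group (AutoGroup K_c_group) \<and>
         group (semidirect_product K_c_group BiLip_group alpha) \<and>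
         Xi \<in> iso (semidirect_product K_c_group BiLip_group alpha) P_c_group"
proof (intro conjI ballI)
  fix \<Phi> assume \<Phi>: "\<Phi> \<in> P_c"
  have factors: "h = boundary_map \<Phi> \<and> \<Psi> = compose \<bbbD> \<Phi> (radial_ext (circle_inv h))"
    if "\<Psi> \<in> K_c" "h \<in> BiLip" "\<Phi> = compose \<bbbD> \<Psi> (radial_ext h)" for \<Psi> h
    unfolding that(3) boundary_map_factors[OF that(1,2)]
      compose_radial_ext_cancel(1)[OF P_c_extensional[OF K_c_P_c[OF that(1)]] that(2)] by simp
  show "\<exists>!(\<Psi>, h). \<Psi> \<in> K_c \<and> h \<in> BiLip \<and> \<Phi> = compose \<bbbD> \<Psi> (radial_ext h)"
  proof (rule ex1I[of _ "(compose \<bbbD> \<Phi> (radial_ext (circle_inv (boundary_map \<Phi>))), boundary_map \<Phi>)"])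
    show "case (compose \<bbbD> \<Phi> (radial_ext (circle_inv (boundary_map \<Phi>))), boundary_map \<Phi>) of
        (\<Psi>, h) \<Rightarrow> \<Psi> \<in> K_c \<and> h \<in> BiLip \<and> \<Phi> = compose \<bbbD> \<Psi> (radial_ext h)"
      unfolding prod.case using P_c_factorization[OF \<Phi>] by blast
    show "p = (compose \<bbbD> \<Phi> (radial_ext (circle_inv (boundary_map \<Phi>))), boundary_map \<Phi>)"
      if "case p of (\<Psi>, h) \<Rightarrow> \<Psi> \<in> K_c \<and> h \<in> BiLip \<and> \<Phi> = compose \<bbbD> \<Psi> (radial_ext h)" for p
    proof (cases p)
      case (Pair \<Psi> h)
      have "\<Psi> \<in> K_c" "h \<in> BiLip" "\<Phi> = compose \<bbbD> \<Psi> (radial_ext h)"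
        using that unfolding Pair prod.case by blast+
      from factors[OF this] show ?thesis unfolding Pair prod.inject by blast
    qed
  qed
  show "\<Phi> = compose \<bbbD> \<Psi> (radial_ext h) \<longrightarrow>
      h = boundary_map \<Phi> \<and> \<Psi> = compose \<bbbD> \<Phi> (radial_ext (circle_inv h))"
    if "\<Psi> \<in> K_c" "h \<in> BiLip" for \<Psi> h
    using factors[OF that] by blast
qed (fact group_P_c group_K_c group_BiLip alpha_hom Xi_iso
    group_semidirect_product[OF group_K_c group_BiLip alpha_hom])+

end
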